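(* Let $n\geq 2$, let $V\subset\mathbb{R}^n$ be a nonempty open set, and let $F\in(\mathcal{E}'(\mathbb{R}^n))^n$ be such that $(\mathrm{d}F)_{ij}\in\mathcal{A}_V$ for all $i,j=1,\dots,n$. If there is some $x_0\in V$ such that $\partial^\beta(\mathrm{d}(N_1F))(x_0)=0$ componentwise for all multi-indices $\beta\in\mathbb{N}^n$, then $F=\mathrm{d}\phi$ for some $\phi\in\mathcal{E}'(\mathbb{R}^n)$.
   Context: All functions and distributions are complex valued, and $\mathbb{N}$ contains $0$. $\mathcal{E}'(\mathbb{R}^n)$ is the space of compactly supported distributions; $F\in(\mathcal{E}'(\mathbb{R}^n))^n$ means $F=(F_1,\dots,F_n)$ with each $F_i\in\mathcal{E}'(\mathbb{R}^n)$. For a vector-valued distribution $F$, the exterior derivative (curl) is the matrix with components $(\mathrm{d}F)_{ij}=\partial_iF_j-\partial_jF_i$; for a scalar distribution $\phi$, $\mathrm{d}\phi$ is its distributional gradient. For $r\in\mathbb{R}$, $H^r(\mathbb{R}^n)=\{f\in\mathscr{S}'(\mathbb{R}^n):(1+|\cdot|^2)^{r/2}\hat f\in L^2(\mathbb{R}^n)\}$, and $H^{-\infty}(\mathbb{R}^n)=\bigcup_{r\in\mathbb{R}}H^r(\mathbb{R}^n)$. $\mathcal{P}$ is the set of all nonzero polynomials on $\mathbb{R}^n$ with complex coefficients; $P(\xi)=\sum_{|\alpha|\leq m}a_\alpha\xi^\alpha\in\mathcal{P}$ induces the constant coefficient operator $P(D)=\sum_{|\alpha|\leq m}a_\alpha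 D^\alpha$, $D^\alpha=D_1^{\alpha_1}\cdots D_n^{\alpha_n}$, $D_j=-i\partial_j$, acting on distributions. For a nonempty open set $V\subset\mathbb{R}^n$ the set of admissible functions is $$\mathcal{A}_V=\{f\in H^{-\infty}(\mathbb{R}^n): P(D)f|_V=0\text{ for some }P\in\mathcal{P}\},$$ where $|_V$ denotes restriction of distributions to $V$ (the polynomial may depend on the component $(\mathrm{d}F)_{ij}$). Oriented lines are parametrized by $\Gamma=\{(z,\theta):\theta\in S^{n-1},\ z\in\theta^\perp\}$. The X-ray transform of vector fields is $X_1F(z,\theta)=\int_{\mathbb{R}}F(z+s\theta)\cdot\theta\,ds$ for $F\in(C_c^\infty(\mathbb{R}^n))^n$, with adjoint $(X_1^*\psi)_i(x)=\int_{S^{n-1}}\theta_i\psi(x-(x\cdot\theta)\theta,\theta)\,d\theta$ for $\psi\in C^\infty(\Gamma)$. By duality, $X_1:(\mathcal{E}'(\mathbb{R}^n))^n\to\mathcal{E}'(\Gamma)$ with $\langle X_1F,\varphi\rangle=\langle F,X_1^*\varphi\rangle$ for $\varphi\in C^\infty(\Gamma)$, and $X_1^*:\mathcal{D}'(\Gamma)\to(\mathcal{D}'(\mathbb{R}^n))^n$ with $\langle X_1^*\psi,\eta\rangle=\langle\psi,X_1\eta\rangle$ for $\eta\in(C_c^\infty(\mathbb{R}^n))^n$, where $\langle F,\varphi\rangle=\sum_i\langle F_i,\varphi_i\rangle$ for vector-valued objects. The normal operator is $N_1=X_1^*X_1:(\mathcal{E}'(\mathbb{R}^n))^n\to(\mathcal{D}'(\mathbb{R}^n))^n$,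 and it satisfies $(N_1F)_i=\sum_{j=1}^n\frac{2x_ix_j}{|x|^{n+1}}*F_j$ in the sense of distributions. The hypothesis that all $\partial^\beta(\mathrm{d}(N_1F))(x_0)$ vanish is understood to include that the components of $\mathrm{d}(N_1F)$ are smooth functions in some neighborhood of $x_0$, so that the pointwise values of the derivatives make sense. *)

theory Defs
  imports "HOL-Analysis.Analysis" "HOL-Library.Poly_Mapping"
begin

section \<open>Derivatives and smooth functions\<close>

definition partial_deriv :: "'n::finite \<Rightarrow> (real^'n \<Rightarrow> complex) \<Rightarrow> real^'n \<Rightarrow> complex" where
  "partial_deriv j f = (\<lambda>x. frechet_derivative f (at x) (axis j 1))"

text \<open>Only used for open \<open>U\<close>: all iterated partial derivatives exist and are (Frechet)
  differentiable at every point of \<open>U\<close>, which is the same as being infinitely often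
  continuously differentiable on \<open>U\<close>.\<close>

definition smooth_on :: "(real^'n::finite) set \<Rightarrow> (real^'n \<Rightarrow> complex) \<Rightarrow> bool" where
  "smooth_on U f \<longleftrightarrow> (\<forall>js. foldr partial_deriv js f differentiable_on U)"

text \<open>Multi-indices are functions \<open>'n \<Rightarrow> nat\<close>. An index type carries no order, so
  \<open>T\<^sub>1\<^bsup>\<alpha>\<^sub>1\<^esup> \<cdots> T\<^sub>n\<^bsup>\<alpha>\<^sub>n\<^esup>\<close> is formed along an arbitrary fixed enumeration of the indices.
  The operators it is applied to (partial derivatives of smooth functions, derivatives of
  distributions) commute, so the enumeration does not matter.\<close>

definition index_enum :: "'n::finite list" where
  "index_enum = (SOME js. distinct js \<and> set js = UNIV)"

definition multi_power :: "('n::finite \<Rightarrow> 'a \<Rightarrow> 'a) \<Rightarrow> ('n \<Rightarrow> nat) \<Rightarrow> 'a \<Rightarrow> 'a" where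
  "multi_power T \<alpha> = foldr (\<lambda>j. T j ^^ \<alpha> j) index_enum"

definition multi_deriv :: "('n::finite \<Rightarrow> nat) \<Rightarrow> (real^'n \<Rightarrow> complex) \<Rightarrow> real^'n \<Rightarrow> complex" where
  "multi_deriv \<alpha> = multi_power partial_deriv \<alpha>"

definition fun_support :: "(real^'n::finite \<Rightarrow> complex) \<Rightarrow> (real^'n) set" where
  "fun_support f = closure {x. f x \<noteq> 0}"

definition test_functions :: "(real^'n::finite \<Rightarrow> complex) set" where
  "test_functions = {\<phi>. smooth_on UNIV \<phi> \<and> compact (fun_support \<phi>)}"

section \<open>Distributions\<close>

text \<open>Distributions are represented by functionals on all functions; only the values on
  test functions (on Schwartz functions, for tempered distributions) are meaningful.
  Consequently equality of distributions is \<open>dist_eq_on UNIV\<close>, and equality of their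
  restrictions to an open set \<open>V\<close> is \<open>dist_eq_on V\<close>.\<close>

type_synonym 'n functional = "(real^'n \<Rightarrow> complex) \<Rightarrow> complex"

definition linear_functional_on :: "(real^'n::finite \<Rightarrow> complex) set \<Rightarrow> 'n functional \<Rightarrow> bool" where
  "linear_functional_on S u \<longleftrightarrow>
     (\<forall>\<phi>\<in>S. \<forall>\<psi>\<in>S. \<forall>a b. u (\<lambda>x. a * \<phi> x + b * \<psi> x) = a * u \<phi> + b * u \<psi>)"

definition distributions :: "'n::finite functional set" where
  "distributions = {u. linear_functional_on test_functions u \<and>
     (\<forall>K. compact K \<longrightarrow> (\<exists>C N. \<forall>\<phi>\<in>test_functions. fun_support \<phi> \<subseteq> K \<longrightarrow>
        cmod (u \<phi>) \<le> C * (\<Sum>\<alpha> | sum \<alpha> UNIV \<le> N. SUP x. cmod (multi_deriv \<alpha> \<phi> x))))}"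

definition dist_eq_on :: "(real^'n::finite) set \<Rightarrow> 'n functional \<Rightarrow> 'n functional \<Rightarrow> bool" where
  "dist_eq_on V u v \<longleftrightarrow> (\<forall>\<phi>\<in>test_functions. fun_support \<phi> \<subseteq> V \<longrightarrow> u \<phi> = v \<phi>)"

definition dist_support :: "'n::finite functional \<Rightarrow> (real^'n) set" where
  "dist_support u = - \<Union>{W. open W \<and> dist_eq_on W u (\<lambda>_. 0)}"

definition compact_distributions :: "'n::finite functional set" where
  "compact_distributions = {u \<in> distributions. compact (dist_support u)}"

text \<open>The pairing of a compactly supported distribution with a smooth function \<open>g\<close>, not
  necessarily of compact support: the common value of \<open>u (\<kappa> g)\<close> over all cut-off
  functions \<open>\<kappa>\<close> that equal \<open>1\<close> near the support of \<open>u\<close>.\<close>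

definition compact_pairing :: "'n::finite functional \<Rightarrow> (real^'n \<Rightarrow> complex) \<Rightarrow> complex" where
  "compact_pairing u g = (THE c. \<forall>\<kappa>\<in>test_functions.
     (\<exists>W. open W \<and> dist_support u \<subseteq> W \<and> (\<forall>x\<in>W. \<kappa> x = 1)) \<longrightarrow> u (\<lambda>x. \<kappa> x * g x) = c)"

definition dist_of_fun :: "(real^'n::finite \<Rightarrow> complex) \<Rightarrow> 'n functional" where
  "dist_of_fun g = (\<lambda>\<phi>. LINT x|lborel. g x * \<phi> x)"

definition dist_deriv :: "'n::finite \<Rightarrow> 'n functional \<Rightarrow> 'n functional" where
  "dist_deriv j u = (\<lambda>\<phi>. - u (partial_deriv j \<phi>))"

definition curl :: "('n::finite \<Rightarrow> 'n functional) \<Rightarrow> 'n \<Rightarrow> 'n \<Rightarrow> 'n functional" where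
  "curl F i j = (\<lambda>\<phi>. dist_deriv i (F j) \<phi> - dist_deriv j (F i) \<phi>)"

text \<open>The distribution \<open>u\<close> is a smooth function near \<open>x\<^sub>0\<close>, and all derivatives of that
  function vanish at \<open>x\<^sub>0\<close>.\<close>

definition vanishes_to_infinite_order_at :: "'n::finite functional \<Rightarrow> real^'n \<Rightarrow> bool" where
  "vanishes_to_infinite_order_at u x\<^sub>0 \<longleftrightarrow>
     (\<exists>W g. open W \<and> x\<^sub>0 \<in> W \<and> smooth_on W g \<and> dist_eq_on W u (dist_of_fun g) \<and>
        (\<forall>\<beta>. multi_deriv \<beta> g x\<^sub>0 = 0))"

section \<open>Sobolev spaces and admissible functions\<close>

definition schwartz_functions :: "(real^'n::finite \<Rightarrow> complex) set" where
  "schwartz_functions = {\<phi>. smooth_on UNIV \<phi> \<and>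
     (\<forall>k \<beta>. bounded (range (\<lambda>x. (1 + norm x) ^ k *\<^sub>R multi_deriv \<beta> \<phi> x)))}"

definition tempered_distributions :: "'n::finite functional set" where
  "tempered_distributions = {u. linear_functional_on schwartz_functions u \<and>
     (\<exists>C N. \<forall>\<phi>\<in>schwartz_functions. cmod (u \<phi>) \<le>
        C * (\<Sum>\<beta> | sum \<beta> UNIV \<le> N. SUP x. (1 + norm x) ^ N * cmod (multi_deriv \<beta> \<phi> x)))}"

definition fourier :: "(real^'n::finite \<Rightarrow> complex) \<Rightarrow> real^'n \<Rightarrow> complex" where
  "fourier f = (\<lambda>\<xi>. LINT x|lborel. exp (- \<i> * of_real (x \<bullet> \<xi>)) * f x)"

definition dist_fourier :: "'n::finite functional \<Rightarrow> 'n functional" where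
  "dist_fourier u = (\<lambda>\<phi>. u (fourier \<phi>))"

definition square_integrable :: "(real^'n::finite \<Rightarrow> complex) \<Rightarrow> bool" where
  "square_integrable g \<longleftrightarrow> g \<in> borel_measurable lborel \<and> integrable lborel (\<lambda>x. (cmod (g x))\<^sup>2)"

text \<open>Membership of \<open>(1 + |\<xi>|\<^sup>2)\<^bsup>r/2\<^esup> \<cdot> \<hat>u\<close> in \<open>L\<^sup>2\<close> is membership of a tempered distribution,
  multiplied by a smooth function of polynomial growth.\<close>

definition sobolev :: "real \<Rightarrow> 'n::finite functional set" where
  "sobolev r = {u \<in> tempered_distributions. \<exists>g. square_integrable g \<and>
     (\<forall>\<phi>\<in>schwartz_functions.
        dist_fourier u (\<lambda>\<xi>. of_real ((1 + (norm \<xi>)\<^sup>2) powr (r / 2)) * \<phi> \<xi>) = dist_of_fun g \<phi>)}"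

definition sobolev_minus_infinity :: "'n::finite functional set" where
  "sobolev_minus_infinity = (\<Union>r. sobolev r)"

definition dist_D :: "'n::finite \<Rightarrow> 'n functional \<Rightarrow> 'n functional" where
  "dist_D j u = (\<lambda>\<phi>. - \<i> * dist_deriv j u \<phi>)"

text \<open>A polynomial is the finitely supported family of its coefficients, so
  a nonzero polynomial is simply \<open>P \<noteq> 0\<close>.\<close>

definition poly_D :: "(('n::finite \<Rightarrow> nat) \<Rightarrow>\<^sub>0 complex) \<Rightarrow> 'n functional \<Rightarrow> 'n functional" where
  "poly_D P u = (\<lambda>\<phi>. \<Sum>\<alpha>\<in>Poly_Mapping.keys P. Poly_Mapping.lookup P \<alpha> * multi_power dist_D \<alpha> u \<phi>)"

text \<open>Tempered distributions are regarded as distributions by restricting them to test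
  functions; \<open>f\<close> below is the tempered distribution that \<open>u\<close> is.\<close>

definition admissible :: "(real^'n::finite) set \<Rightarrow> 'n functional set" where
  "admissible V = {u. \<exists>f\<in>sobolev_minus_infinity. dist_eq_on UNIV u f \<and>
     (\<exists>P. P \<noteq> 0 \<and> dist_eq_on V (poly_D P f) (\<lambda>_. 0))}"

section \<open>The X-ray transform of vector fields\<close>

text \<open>Surface measure on the unit sphere, as a Borel measure on the ambient space:
  \<open>n\<close> times the Lebesgue measure of the cone over a set.\<close>

definition sphere_measure :: "(real^'n::finite) measure" where
  "sphere_measure =
     scale_measure (of_nat CARD('n)) (distr (restrict_space lborel (ball 0 1 - {0})) borel sgn)"

text \<open>Vector-valued objects are families of components indexed by \<open>'n\<close>. A function on the
  set of lines \<open>{(z, \<theta>). norm \<theta> = 1 \<and> z \<bullet> \<theta> = 0}\<close> is represented by a function on pairs;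
  \<open>xray_adjoint\<close>, and hence everything below, depends only on the values on that set.\<close>

definition xray :: "('n::finite \<Rightarrow> real^'n \<Rightarrow> complex) \<Rightarrow> (real^'n) \<times> (real^'n) \<Rightarrow> complex" where
  "xray \<eta> = (\<lambda>(z, \<theta>). LINT s|lborel. (\<Sum>i\<in>UNIV. \<eta> i (z + s *\<^sub>R \<theta>) * of_real (\<theta> $ i)))"

definition xray_adjoint :: "((real^'n::finite) \<times> (real^'n) \<Rightarrow> complex) \<Rightarrow> 'n \<Rightarrow> real^'n \<Rightarrow> complex" where
  "xray_adjoint \<psi> i x =
     (LINT \<theta>|sphere_measure. of_real (\<theta> $ i) * \<psi> (x - (x \<bullet> \<theta>) *\<^sub>R \<theta>, \<theta>))"

definition dist_xray ::
  "('n::finite \<Rightarrow> 'n functional) \<Rightarrow> ((real^'n) \<times> (real^'n) \<Rightarrow> complex) \<Rightarrow> complex" where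
  "dist_xray F = (\<lambda>\<phi>. \<Sum>i\<in>UNIV. compact_pairing (F i) (xray_adjoint \<phi> i))"

text \<open>The \<open>i\<close>-th component of a functional on vector-valued test functions is its value on
  test functions concentrated in the \<open>i\<close>-th component.\<close>

definition dist_xray_adjoint ::
  "(((real^'n::finite) \<times> (real^'n) \<Rightarrow> complex) \<Rightarrow> complex) \<Rightarrow> 'n \<Rightarrow> 'n functional" where
  "dist_xray_adjoint \<psi> i = (\<lambda>\<eta>. \<psi> (xray (\<lambda>j. if j = i then \<eta> else (\<lambda>_. 0))))"

definition normal_operator :: "('n::finite \<Rightarrow> 'n functional) \<Rightarrow> 'n \<Rightarrow> 'n functional" where
  "normal_operator F = dist_xray_adjoint (dist_xray F)"

end

theory Submission
  imports Defs
begin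

text \<open>
  Write \<open>E y = |y|\<^bsup>1-n\<^esup>\<close>. The proof rests on three facts.

  First, \<open>curl (N\<^sub>1 F) = 2/(n-1) E * curl F\<close> componentwise (\<open>curl_normal_operator\<close>). Indeed \<open>N\<^sub>1\<close> is
  convolution with the kernels \<open>2 y\<^sub>k y\<^sub>j |y|\<^bsup>-n-1\<^esup>\<close>, by polar coordinates (\<open>xray_adjoint_xray\<close>), and the
  antisymmetrised derivatives of these kernels are derivatives of \<open>E\<close> (\<open>curl_identity\<close>).

  Second, a compactly supported distribution \<open>T\<close> with \<open>P(D) T = 0\<close> on \<open>V\<close> is zero if its potential
  \<open>E * T\<close> vanishes to infinite order at some \<open>x\<^sub>0 \<in> V\<close> (\<open>unique_continuation\<close>). Put \<open>h = P(D) T\<close>. Its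
  potential \<open>P(D) (E * T)\<close> also vanishes to infinite order at \<open>x\<^sub>0\<close>, and \<open>h = 0\<close> near \<open>x\<^sub>0\<close>, so \<open>h\<close>
  annihilates every derivative of \<open>E(x - x\<^sub>0)\<close>. These derivatives are plentiful because \<open>E\<close> is not
  harmonic: \<open>\<Delta> |y|\<^bsup>-s\<^esup> = s (s + 2 - n) |y|\<^bsup>-s-2\<^esup>\<close>, and the factor is not zero for
  \<open>s = n - 1, n + 1, n + 3, \<dots>\<close>. Thus the span contains all \<open>|y|\<^bsup>1-n-2l\<^esup>\<close>, then by the product rule all
  \<open>p(y) |y|\<^bsup>1-n-2l\<^esup>\<close> with \<open>l\<close> at least the degree of the polynomial \<open>p\<close>, and its closure in the topology
  of smooth functions near the support of \<open>h\<close> contains all \<open>p(y) |y|\<^bsup>1-n\<^esup>\<close>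
  (\<open>vanishes_on_weighted_monomials\<close>). Polynomials are dense among the smooth functions, with
  all derivatives on compact sets (\<open>vanishes_on_tests_if_on_monomials\<close>), so \<open>h = 0\<close>. Hence \<open>T\<close> annihilates
  the image of the polynomials under the transpose of \<open>P(D)\<close>. That image consists of all
  polynomials (\<open>vanishes_on_monomials\<close>), and by density again \<open>T = 0\<close>.

  Third, a compactly supported vector field of distributions whose curl is zero is the gradient of a
  compactly supported distribution, if \<open>n \<ge> 2\<close> (\<open>exact_if_closed\<close>).

  The second fact for the components of \<open>curl F\<close> gives \<open>curl F = 0\<close>, and the third one gives \<open>\<phi>\<close>.
  Iterated partial derivatives are indexed by lists of coordinates here, which suits
  inductions better than multi-indices; by symmetry of second derivatives both agree
  (\<open>derivs_eq_multi_deriv\<close>).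
\<close>

section \<open>Calculus of smooth functions\<close>

abbreviation derivs :: "'n::finite list \<Rightarrow> (real^'n \<Rightarrow> complex) \<Rightarrow> real^'n \<Rightarrow> complex" where
  "derivs js f \<equiv> foldr partial_deriv js f"

lemma partial_deriv_eq:
  assumes "(f has_derivative f') (at x)"
  shows "partial_deriv j f x = f' (axis j 1)"
  using frechet_derivative_at[OF assms] by (simp add: partial_deriv_def)

lemma has_derivative_frechet:
  assumes "f differentiable_on U" "open U" "x \<in> U"
  shows "(f has_derivative frechet_derivative f (at x)) (at x)"
  using assms differentiable_on_eq_differentiable_at frechet_derivative_works by blast

lemma partial_deriv_cong:
  assumes "open U" "x \<in> U" "\<And>y. y \<in> U \<Longrightarrow> f y = g y"
  shows "partial_deriv j f x = partial_deriv j g x"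
proof -
  have "(f has_derivative f') (at x) \<longleftrightarrow> (g has_derivative f') (at x)" for f'
    using assms has_derivative_transform_within_open[of f f' x UNIV U g]
      has_derivative_transform_within_open[of g f' x UNIV U f] by auto
  then show ?thesis
    by (simp add: partial_deriv_def frechet_derivative_def)
qed

lemma derivs_cong:
  assumes "open U" "x \<in> U" "\<And>y. y \<in> U \<Longrightarrow> f y = g y"
  shows "derivs js f x = derivs js g x"
  using assms(2)
proof (induction js arbitrary: x)
  case Nil
  then show ?case using assms by simp
next
  case (Cons j js)
  have "partial_deriv j (derivs js f) x = partial_deriv j (derivs js g) x"
    by (rule partial_deriv_cong[OF assms(1) Cons.prems]) (rule Cons.IH)
  then show ?case by simp
qed

lemma differentiable_on_cong_open:
  assumes "open U" "\<And>y. y \<in> U \<Longrightarrow> f y = g y" "f differentiable_on U"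
  shows "g differentiable_on U"
  using assms unfolding differentiable_on_def differentiable_def
  by (metis has_derivative_transform)

text \<open>Differentiability up to a finite order, for the product and chain rules, whose proofs by
  induction lose one order in each step.\<close>

definition smooth_upto :: "nat \<Rightarrow> (real^'n::finite) set \<Rightarrow> (real^'n \<Rightarrow> complex) \<Rightarrow> bool" where
  "smooth_upto k U f \<longleftrightarrow> (\<forall>js. length js \<le> k \<longrightarrow> derivs js f differentiable_on U)"

lemma smooth_on_iff_upto: "smooth_on U f \<longleftrightarrow> (\<forall>k. smooth_upto k U f)"
  by (auto simp: smooth_on_def smooth_upto_def)

lemma smooth_upto_0: "smooth_upto 0 U f \<longleftrightarrow> f differentiable_on U"
  by (simp add: smooth_upto_def)

lemma smooth_upto_Suc:
  "smooth_upto (Suc k) U f \<longleftrightarrow> f differentiable_on U \<and> (\<forall>j. smooth_upto k U (partial_deriv j f))"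
proof
  assume L: "smooth_upto (Suc k) U f"
  have "f differentiable_on U"
    using L unfolding smooth_upto_def by (metis foldr.simps(1) id_apply le0 list.size(3))
  moreover have "derivs js (partial_deriv j f) differentiable_on U" if "length js \<le> k" for js j
    using L that unfolding smooth_upto_def by (auto dest: spec[of _ "js @ [j]"])
  ultimately show "f differentiable_on U \<and> (\<forall>j. smooth_upto k U (partial_deriv j f))"
    by (simp add: smooth_upto_def)
next
  assume R: "f differentiable_on U \<and> (\<forall>j. smooth_upto k U (partial_deriv j f))"
  have "derivs js f differentiable_on U" if "length js \<le> Suc k" for js
    using that R by (cases js rule: rev_cases) (auto simp: smooth_upto_def)
  then show "smooth_upto (Suc k) U f" by (simp add: smooth_upto_def)
qed

lemma smooth_upto_cong:
  assumes "open U" "\<And>y. y \<in> U \<Longrightarrow> f y = g y" "smooth_upto k U f"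
  shows "smooth_upto k U g"
  unfolding smooth_upto_def
proof (intro allI impI)
  fix js :: "'a list" assume "length js \<le> k"
  then have "derivs js f differentiable_on U" using assms(3) by (simp add: smooth_upto_def)
  then show "derivs js g differentiable_on U"
    by (rule differentiable_on_cong_open[OF assms(1) derivs_cong[OF assms(1)], rotated 2])
      (use assms(2) in auto)
qed

lemma smooth_on_cong:
  assumes "open U" "\<And>y. y \<in> U \<Longrightarrow> f y = g y" "smooth_on U f"
  shows "smooth_on U g"
  using assms smooth_upto_cong unfolding smooth_on_iff_upto by blast

lemma smooth_upto_mono: "smooth_upto k U f \<Longrightarrow> l \<le> k \<Longrightarrow> smooth_upto l U f"
  by (auto simp: smooth_upto_def)

lemma smooth_on_imp_differentiable: "smooth_on U f \<Longrightarrow> f differentiable_on U"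
  using smooth_on_iff_upto smooth_upto_0 by blast

lemma smooth_on_subset: "smooth_on U f \<Longrightarrow> V \<subseteq> U \<Longrightarrow> smooth_on V f"
  by (auto simp: smooth_on_def intro: differentiable_on_subset)

lemma smooth_on_partial_deriv: "smooth_on U f \<Longrightarrow> smooth_on U (partial_deriv j f)"
  using smooth_upto_Suc smooth_on_iff_upto by blast

lemma smooth_on_derivs: "smooth_on U f \<Longrightarrow> smooth_on U (derivs js f)"
  by (induction js) (auto intro: smooth_on_partial_deriv)

lemma smooth_on_union:
  assumes "open U" "open V" "smooth_on U f" "smooth_on V f"
  shows "smooth_on (U \<union> V) f"
  using assms unfolding smooth_on_def
  by (auto simp: differentiable_on_eq_differentiable_at open_Un)

lemma smooth_on_continuous: "smooth_on U f \<Longrightarrow> continuous_on U f"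
  by (simp add: differentiable_imp_continuous_on smooth_on_imp_differentiable)

lemma partial_deriv_const: "partial_deriv j (\<lambda>x. c) = (\<lambda>x. 0)"
  by (rule ext, subst partial_deriv_eq) (auto intro: derivative_eq_intros)

lemma partial_deriv_add:
  assumes "open U" "f differentiable_on U" "g differentiable_on U" "x \<in> U"
  shows "partial_deriv j (\<lambda>x. f x + g x) x = partial_deriv j f x + partial_deriv j g x"
  using partial_deriv_eq[OF has_derivative_add[OF has_derivative_frechet[OF assms(2,1,4)]
      has_derivative_frechet[OF assms(3,1,4)]], of j]
  by (simp add: partial_deriv_def)

lemma partial_deriv_mult:
  assumes "open U" "f differentiable_on U" "g differentiable_on U" "x \<in> U"
  shows "partial_deriv j (\<lambda>x. f x * g x) x = partial_deriv j f x * g x + f x * partial_deriv j g x"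
  using partial_deriv_eq[OF has_derivative_mult[OF has_derivative_frechet[OF assms(2,1,4)]
      has_derivative_frechet[OF assms(3,1,4)]], of j]
  by (simp add: partial_deriv_def)

lemma differentiable_on_const': "(\<lambda>x. c) differentiable_on U"
  by (simp add: differentiable_on_def)

lemma smooth_upto_const: "smooth_upto k U (\<lambda>x. c)"
proof (induction k arbitrary: c)
  case 0
  then show ?case by (simp add: smooth_upto_0 differentiable_on_const')
next
  case (Suc k)
  then show ?case by (simp add: smooth_upto_Suc differentiable_on_const' partial_deriv_const)
qed

lemma smooth_on_const [simp, intro]: "smooth_on U (\<lambda>x. c)"
  by (simp add: smooth_on_iff_upto smooth_upto_const)

lemma differentiable_on_mult':
  fixes f g :: "real^'n::finite \<Rightarrow> complex"
  shows "f differentiable_on U \<Longrightarrow> g differentiable_on U \<Longrightarrow> (\<lambda>x. f x * g x) differentiable_on U"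
  by (auto simp: differentiable_on_def)

lemma differentiable_on_add':
  fixes f g :: "real^'n::finite \<Rightarrow> complex"
  shows "f differentiable_on U \<Longrightarrow> g differentiable_on U \<Longrightarrow> (\<lambda>x. f x + g x) differentiable_on U"
  by (auto simp: differentiable_on_def)

lemma smooth_upto_add:
  assumes "open U"
  shows "smooth_upto k U f \<Longrightarrow> smooth_upto k U g \<Longrightarrow> smooth_upto k U (\<lambda>x. f x + g x)"
proof (induction k arbitrary: f g)
  case 0
  then show ?case by (simp add: smooth_upto_0 differentiable_on_add')
next
  case (Suc k)
  have d: "f differentiable_on U" "g differentiable_on U"
    using Suc.prems by (auto simp: smooth_upto_Suc)
  have "smooth_upto k U (partial_deriv j (\<lambda>x. f x + g x))" for j
    by (rule smooth_upto_cong[OF assms partial_deriv_add[OF assms d, symmetric]])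
      (use Suc in \<open>auto simp: smooth_upto_Suc\<close>)
  then show ?case using d by (simp add: smooth_upto_Suc differentiable_on_add')
qed

lemma smooth_upto_mult:
  assumes "open U"
  shows "smooth_upto k U f \<Longrightarrow> smooth_upto k U g \<Longrightarrow> smooth_upto k U (\<lambda>x. f x * g x)"
proof (induction k arbitrary: f g)
  case 0
  then show ?case by (simp add: smooth_upto_0 differentiable_on_mult')
next
  case (Suc k)
  have d: "f differentiable_on U" "g differentiable_on U"
    using Suc.prems by (auto simp: smooth_upto_Suc)
  have k: "smooth_upto k U f" "smooth_upto k U g"
    using smooth_upto_mono[OF Suc.prems(1), of k] smooth_upto_mono[OF Suc.prems(2), of k] by auto
  have "smooth_upto k U (partial_deriv j (\<lambda>x. f x * g x))" for j
    by (rule smooth_upto_cong[OF assms partial_deriv_mult[OF assms d, symmetric]])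
      (use Suc k in \<open>auto simp: smooth_upto_Suc intro!: smooth_upto_add assms\<close>)
  then show ?case using d by (simp add: smooth_upto_Suc differentiable_on_mult')
qed

lemma smooth_on_add: "open U \<Longrightarrow> smooth_on U f \<Longrightarrow> smooth_on U g \<Longrightarrow> smooth_on U (\<lambda>x. f x + g x)"
  by (simp add: smooth_on_iff_upto smooth_upto_add)

lemma smooth_on_mult: "open U \<Longrightarrow> smooth_on U f \<Longrightarrow> smooth_on U g \<Longrightarrow> smooth_on U (\<lambda>x. f x * g x)"
  by (simp add: smooth_on_iff_upto smooth_upto_mult)

lemma smooth_on_cmult: "open U \<Longrightarrow> smooth_on U f \<Longrightarrow> smooth_on U (\<lambda>x. c * f x)"
  by (simp add: smooth_on_mult)

lemma smooth_on_minus: "open U \<Longrightarrow> smooth_on U f \<Longrightarrow> smooth_on U (\<lambda>x. - f x)"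
  using smooth_on_cmult[of U f "-1"] by simp

lemma smooth_on_diff: "open U \<Longrightarrow> smooth_on U f \<Longrightarrow> smooth_on U g \<Longrightarrow> smooth_on U (\<lambda>x. f x - g x)"
  using smooth_on_add[of U f "\<lambda>x. - g x"] smooth_on_minus[of U g] by simp

lemma smooth_on_sum:
  "open U \<Longrightarrow> (\<And>i. i \<in> I \<Longrightarrow> smooth_on U (f i)) \<Longrightarrow> smooth_on U (\<lambda>x. \<Sum>i\<in>I. f i x)"
  by (induction I rule: infinite_finite_induct) (auto intro: smooth_on_add)

lemma smooth_on_prod:
  "open U \<Longrightarrow> (\<And>i. i \<in> I \<Longrightarrow> smooth_on U (f i)) \<Longrightarrow> smooth_on U (\<lambda>x. \<Prod>i\<in>I. f i x)"
  by (induction I rule: infinite_finite_induct) (auto intro: smooth_on_mult)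

lemma smooth_on_power: "open U \<Longrightarrow> smooth_on U f \<Longrightarrow> smooth_on U (\<lambda>x. f x ^ m)"
  by (induction m) (auto intro: smooth_on_mult)

lemma partial_deriv_coord:
  "partial_deriv j (\<lambda>x. of_real (x $ i - c)) = (\<lambda>x. if i = j then 1 else 0)"
proof (rule ext)
  fix x :: "real^'a"
  have "((\<lambda>x. complex_of_real (x $ i - c)) has_derivative (\<lambda>h. of_real (h $ i))) (at x)"
    by (auto intro!: derivative_eq_intros bounded_linear_imp_has_derivative bounded_linear_vec_nth)
  from partial_deriv_eq[OF this, of j]
  show "partial_deriv j (\<lambda>x. complex_of_real (x $ i - c)) x = (if i = j then 1 else 0)"
    by (simp add: axis_def)
qed

lemma smooth_on_coord: "smooth_on U (\<lambda>x. of_real (x $ i - c))"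
proof -
  have d: "(\<lambda>x. complex_of_real (x $ i - c)) differentiable_on U"
    unfolding differentiable_on_def differentiable_def
    by (auto intro!: exI derivative_eq_intros bounded_linear_imp_has_derivative bounded_linear_vec_nth)
  have "smooth_upto k U (\<lambda>x. complex_of_real (x $ i - c))" for k
    using d by (cases k) (simp_all add: smooth_upto_0 smooth_upto_Suc partial_deriv_coord smooth_upto_const del: of_real_diff)
  then show ?thesis by (simp add: smooth_on_iff_upto)
qed

lemma smooth_on_norm_sq: "open U \<Longrightarrow> smooth_on U (\<lambda>x. of_real ((norm (x - a))\<^sup>2))"
proof -
  assume U: "open U"
  have "(\<lambda>x. of_real ((norm (x - a))\<^sup>2)) = (\<lambda>x. \<Sum>i\<in>UNIV. (complex_of_real (x $ i - a $ i))\<^sup>2)"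
    by (simp add: norm_vec_def L2_set_def sum_nonneg flip: of_real_power of_real_diff of_real_sum)
  then show ?thesis
    by (simp only:) (intro smooth_on_sum smooth_on_power smooth_on_coord U)
qed

subsection \<open>Iterated derivatives of sums\<close>

lemma derivs_add:
  assumes "open U" "smooth_on U f" "smooth_on U g" "x \<in> U"
  shows "derivs js (\<lambda>x. f x + g x) x = derivs js f x + derivs js g x"
  using assms(4)
proof (induction js arbitrary: x)
  case (Cons j js)
  have "derivs (j # js) (\<lambda>x. f x + g x) x = partial_deriv j (\<lambda>x. derivs js f x + derivs js g x) x"
    using partial_deriv_cong[OF assms(1) Cons.prems Cons.IH] by simp
  also have "\<dots> = derivs (j # js) f x + derivs (j # js) g x"
    using partial_deriv_add[OF assms(1) smooth_on_imp_differentiable[OF smooth_on_derivs[OF assms(2)]]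
      smooth_on_imp_differentiable[OF smooth_on_derivs[OF assms(3)]] Cons.prems] by simp
  finally show ?case .
qed simp

lemma partial_deriv_cmult:
  assumes "open U" "f differentiable_on U" "x \<in> U"
  shows "partial_deriv j (\<lambda>x. c * f x) x = c * partial_deriv j f x"
  using partial_deriv_mult[OF assms(1) differentiable_on_const' assms(2,3), of j c]
  by (simp add: partial_deriv_const)

lemma derivs_cmult:
  assumes "open U" "smooth_on U f" "x \<in> U"
  shows "derivs js (\<lambda>x. c * f x) x = c * derivs js f x"
  using assms(3)
proof (induction js arbitrary: x)
  case (Cons j js)
  have "derivs (j # js) (\<lambda>x. c * f x) x = partial_deriv j (\<lambda>x. c * derivs js f x) x"
    using partial_deriv_cong[OF assms(1) Cons.prems Cons.IH] by simp
  also have "\<dots> = c * derivs (j # js) f x"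
    using partial_deriv_cmult[OF assms(1) smooth_on_imp_differentiable[OF smooth_on_derivs[OF assms(2)]]
      Cons.prems] by simp
  finally show ?case .
qed simp

lemma derivs_diff:
  assumes "open U" "smooth_on U f" "smooth_on U g" "x \<in> U"
  shows "derivs js (\<lambda>x. f x - g x) x = derivs js f x - derivs js g x"
  using derivs_add[OF assms(1,2) smooth_on_cmult[OF assms(1,3)] assms(4), of js "-1"]
    derivs_cmult[OF assms(1,3,4), of js "-1"] by simp

lemma derivs_zero: "derivs js (\<lambda>x. 0) = (\<lambda>x. 0)"
  by (induction js) (simp_all add: partial_deriv_const)

lemma derivs_sum:
  assumes "open U" "\<And>i. i \<in> I \<Longrightarrow> smooth_on U (f i)" "x \<in> U"
  shows "derivs js (\<lambda>x. \<Sum>i\<in>I. f i x) x = (\<Sum>i\<in>I. derivs js (f i) x)"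
  using assms(2)
proof (induction I rule: infinite_finite_induct)
  case (insert i I)
  then show ?case
    using derivs_add[OF assms(1) _ smooth_on_sum[OF assms(1)] assms(3), of "f i" I f js] by simp
qed (simp_all add: derivs_zero)

lemma derivs_snoc: "derivs (js @ [j]) f = derivs js (partial_deriv j f)"
  by simp

subsection \<open>Composition with functions of one variable\<close>

lemma has_derivative_of_real_comp:
  fixes s :: "real^'n::finite \<Rightarrow> real"
  assumes "open U" "x \<in> U" "(\<lambda>x. complex_of_real (s x)) differentiable_on U"
    and "(G has_real_derivative d) (at (s x))"
  shows "((\<lambda>x. complex_of_real (G (s x))) has_derivative
     (\<lambda>h. of_real d * frechet_derivative (\<lambda>x. complex_of_real (s x)) (at x) h)) (at x)"
proof -
  let ?L = "frechet_derivative (\<lambda>x. complex_of_real (s x)) (at x)"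
  have L: "((\<lambda>x. complex_of_real (s x)) has_derivative ?L) (at x)"
    by (rule has_derivative_frechet[OF assms(3,1,2)])
  have Re: "(s has_derivative (\<lambda>h. Re (?L h))) (at x)"
    using has_derivative_Re[OF L] by simp
  have "?L h = of_real (Re (?L h))" for h
    using has_derivative_unique[OF L has_derivative_of_real[OF Re]] by (simp add: fun_eq_iff)
  moreover have "((\<lambda>x. complex_of_real (G (s x))) has_derivative (\<lambda>h. of_real (d * Re (?L h)))) (at x)"
    by (intro has_derivative_of_real has_derivative_compose[OF Re]) (use assms(4) in \<open>simp add: has_field_derivative_def\<close>)
  ultimately show ?thesis by simp
qed

text \<open>The chain rule, for a whole class of functions of one real variable that is closed under
  differentiation, so that the induction on the order of differentiability closes up.\<close>

lemma smooth_on_compose: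
  fixes s :: "real^'n::finite \<Rightarrow> real"
  assumes "open U" "smooth_on U (\<lambda>x. complex_of_real (s x))" "s ` U \<subseteq> T"
    and cl: "\<And>G. G \<in> \<G> \<Longrightarrow> \<exists>G'\<in>\<G>. \<forall>t\<in>T. (G has_real_derivative G' t) (at t)"
    and "G \<in> \<G>"
  shows "smooth_on U (\<lambda>x. complex_of_real (G (s x)))"
proof -
  let ?s = "\<lambda>x. complex_of_real (s x)"
  have ds: "?s differentiable_on U" using assms(2) smooth_on_imp_differentiable by blast
  have diff: "(\<lambda>x. complex_of_real (G (s x))) differentiable_on U" if "G \<in> \<G>" for G
    using cl[OF that] has_derivative_of_real_comp[OF assms(1) _ ds] assms(3)
    unfolding differentiable_on_eq_differentiable_at[OF assms(1)] differentiable_def by blast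
  have "smooth_upto k U (\<lambda>x. complex_of_real (G (s x)))" if "G \<in> \<G>" for k G
    using that
  proof (induction k arbitrary: G)
    case 0
    then show ?case by (simp add: smooth_upto_0 diff)
  next
    case (Suc k)
    obtain G' where G': "G' \<in> \<G>" "\<And>t. t \<in> T \<Longrightarrow> (G has_real_derivative G' t) (at t)"
      using cl[OF Suc.prems] by blast
    have pd: "partial_deriv j (\<lambda>x. complex_of_real (G (s x))) x
        = complex_of_real (G' (s x)) * partial_deriv j ?s x" if "x \<in> U" for x j
      using partial_deriv_eq[OF has_derivative_of_real_comp[OF assms(1) that ds G'(2)]] that assms(3)
      by (auto simp: partial_deriv_def)
    have "smooth_upto k U (partial_deriv j ?s)" for j
      using smooth_on_partial_deriv[OF assms(2)] smooth_on_iff_upto by blast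
    note prod = smooth_upto_mult[OF assms(1) Suc.IH[OF G'(1)] this]
    have "smooth_upto k U (partial_deriv j (\<lambda>x. complex_of_real (G (s x))))" for j
      by (rule smooth_upto_cong[OF assms(1) _ prod[of j]]) (simp add: pd)
    then show ?case using diff[OF Suc.prems] by (simp add: smooth_upto_Suc)
  qed
  then show ?thesis using assms(5) by (simp add: smooth_on_iff_upto)
qed

lemma smooth_on_powr:
  fixes s :: "real^'n::finite \<Rightarrow> real"
  assumes "open U" "smooth_on U (\<lambda>x. complex_of_real (s x))" "\<And>x. x \<in> U \<Longrightarrow> s x > 0"
  shows "smooth_on U (\<lambda>x. complex_of_real (s x powr a))"
proof -
  let ?\<G> = "{\<lambda>t::real. c * t powr b | b c. True}"
  have cl: "\<exists>G'\<in>?\<G>. \<forall>t\<in>{0<..}. (G has_real_derivative G' t) (at t)" if mem: "G \<in> ?\<G>" for G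
  proof -
    obtain b c where G: "G = (\<lambda>t. c * t powr b)" using mem by blast
    have "\<forall>t\<in>{0<..}. (G has_real_derivative (\<lambda>t. (c*b) * t powr (b-1)) t) (at t)"
      unfolding G by (auto intro!: derivative_eq_intros)
    then show ?thesis by (intro bexI[of _ "\<lambda>t. (c*b) * t powr (b-1)"] CollectI exI conjI) auto
  qed
  have mem: "(\<lambda>t. t powr a) \<in> ?\<G>"
    by (rule CollectI, rule exI[of _ a], rule exI[of _ 1]) simp
  show ?thesis
    by (rule smooth_on_compose[OF assms(1,2) _ cl mem]) (use assms(3) in auto)
qed

subsection \<open>Symmetry of second derivatives\<close>

lemma has_vector_derivative_along_axis:
  fixes f :: "real^'n::finite \<Rightarrow> complex"
  assumes "open U" "f differentiable_on U" "x + t *\<^sub>R axis i 1 \<in> U"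
  shows "((\<lambda>t. f (x + t *\<^sub>R axis i 1)) has_vector_derivative partial_deriv i f (x + t *\<^sub>R axis i 1)) (at t)"
proof -
  let ?L = "frechet_derivative f (at (x + t *\<^sub>R axis i 1))"
  have L: "(f has_derivative ?L) (at (x + t *\<^sub>R axis i 1))"
    by (rule has_derivative_frechet[OF assms(2,1,3)])
  have "((\<lambda>t. x + t *\<^sub>R axis i 1) has_derivative (\<lambda>h. h *\<^sub>R axis i 1)) (at t)"
    by (auto intro!: derivative_eq_intros)
  from has_derivative_compose[OF this L]
  have "((\<lambda>t. f (x + t *\<^sub>R axis i 1)) has_derivative (\<lambda>h. ?L (h *\<^sub>R axis i 1))) (at t)" .
  moreover have "?L (h *\<^sub>R axis i 1) = h *\<^sub>R ?L (axis i 1)" for h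
    using has_derivative_bounded_linear[OF L] linear_scale bounded_linear.linear by blast
  ultimately show ?thesis by (simp add: has_vector_derivative_def partial_deriv_def)
qed

text \<open>The mean value theorem, applied once in each of the two directions. The left-hand side is
  symmetric in \<open>i\<close> and \<open>j\<close>, which yields the symmetry of the second derivatives for \<open>h \<rightarrow> 0\<close>.\<close>

lemma second_difference_mean_value:
  fixes f :: "real^'n::finite \<Rightarrow> complex" and R :: "complex \<Rightarrow> real"
  assumes "open U" "smooth_on U f" "h > 0" "bounded_linear R"
    and sq: "\<And>s t. 0 \<le> s \<Longrightarrow> s \<le> h \<Longrightarrow> 0 \<le> t \<Longrightarrow> t \<le> h \<Longrightarrow> x + s *\<^sub>R axis i 1 + t *\<^sub>R axis j 1 \<in> U"
  shows "\<exists>s t. 0 \<le> s \<and> s \<le> h \<and> 0 \<le> t \<and> t \<le> h \<and>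
    R (f (x + h *\<^sub>R axis i 1 + h *\<^sub>R axis j 1)) - R (f (x + h *\<^sub>R axis i 1))
      - R (f (x + h *\<^sub>R axis j 1)) + R (f x)
    = h * (h * R (partial_deriv j (partial_deriv i f) (x + s *\<^sub>R axis i 1 + t *\<^sub>R axis j 1)))"
proof -
  have di: "f differentiable_on U" using assms(2) smooth_on_imp_differentiable by blast
  have dj: "partial_deriv i f differentiable_on U"
    using assms(2) smooth_on_imp_differentiable smooth_on_partial_deriv by blast
  define u where "u s = R (f (x + s *\<^sub>R axis i 1 + h *\<^sub>R axis j 1)) - R (f (x + s *\<^sub>R axis i 1))" for s
  define u' where "u' s = R (partial_deriv i f (x + s *\<^sub>R axis i 1 + h *\<^sub>R axis j 1))
     - R (partial_deriv i f (x + s *\<^sub>R axis i 1))" for s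
  have "(u has_real_derivative u' s) (at s)" if s: "0 \<le> s" "s \<le> h" for s
  proof -
    have 1: "((\<lambda>s. f (x + h *\<^sub>R axis j 1 + s *\<^sub>R axis i 1)) has_vector_derivative
        partial_deriv i f (x + h *\<^sub>R axis j 1 + s *\<^sub>R axis i 1)) (at s)"
      by (rule has_vector_derivative_along_axis[OF assms(1) di])
        (use sq[of s h] s assms(3) in \<open>simp add: algebra_simps\<close>)
    have 2: "((\<lambda>s. f (x + s *\<^sub>R axis i 1)) has_vector_derivative
        partial_deriv i f (x + s *\<^sub>R axis i 1)) (at s)"
      by (rule has_vector_derivative_along_axis[OF assms(1) di])
        (use sq[of s 0] s assms(3) in simp)
    show ?thesis
      unfolding u_def u'_def has_real_derivative_iff_has_vector_derivative
      using has_vector_derivative_diff[OF bounded_linear.has_vector_derivative[OF assms(4) 1]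
          bounded_linear.has_vector_derivative[OF assms(4) 2]]
      by (simp add: algebra_simps)
  qed
  from MVT2[OF assms(3) this] obtain s where s: "0 < s" "s < h" "u h - u 0 = (h - 0) * u' s" by blast
  define v where "v t = R (partial_deriv i f (x + s *\<^sub>R axis i 1 + t *\<^sub>R axis j 1))" for t
  have "(v has_real_derivative R (partial_deriv j (partial_deriv i f) (x + s *\<^sub>R axis i 1 + t *\<^sub>R axis j 1))) (at t)"
    if t: "0 \<le> t" "t \<le> h" for t
    unfolding v_def has_real_derivative_iff_has_vector_derivative
    by (rule bounded_linear.has_vector_derivative[OF assms(4)
          has_vector_derivative_along_axis[OF assms(1) dj]]) (use sq[of s t] s t in simp)
  from MVT2[OF assms(3) this] obtain t where t: "0 < t" "t < h" "v h - v 0 = (h - 0) *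
     R (partial_deriv j (partial_deriv i f) (x + s *\<^sub>R axis i 1 + t *\<^sub>R axis j 1))" by blast
  have "u' s = v h - v 0" by (simp add: u'_def v_def)
  then have "u h - u 0 = h * (h * R (partial_deriv j (partial_deriv i f) (x + s *\<^sub>R axis i 1 + t *\<^sub>R axis j 1)))"
    using s(3) t(3) by simp
  then show ?thesis
    using s t by (intro exI[of _ s] exI[of _ t]) (simp add: u_def)
qed

lemma partial_deriv_commute:
  assumes "open U" "smooth_on U f" "x \<in> U"
  shows "partial_deriv i (partial_deriv j f) x = partial_deriv j (partial_deriv i f) x"
proof -
  have key: "R (partial_deriv i (partial_deriv j f) x) = R (partial_deriv j (partial_deriv i f) x)"
    if R: "bounded_linear R" for R :: "complex \<Rightarrow> real"
  proof -
    let ?A = "\<lambda>y. R (partial_deriv i (partial_deriv j f) y)"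
    let ?B = "\<lambda>y. R (partial_deriv j (partial_deriv i f) y)"
    have "continuous_on U ?A" "continuous_on U ?B"
      by (intro bounded_linear.continuous_on[OF R] smooth_on_continuous smooth_on_partial_deriv assms(2))+
    then have cA: "isCont ?A x" and cB: "isCont ?B x"
      using assms(1,3) continuous_on_eq_continuous_at by blast+
    have "\<bar>?A x - ?B x\<bar> \<le> e" if "e > 0" for e
    proof -
      obtain d1 where d1: "d1 > 0" "\<And>y. dist y x < d1 \<Longrightarrow> \<bar>?A y - ?A x\<bar> < e/2"
        using cA \<open>e > 0\<close> unfolding continuous_at_eps_delta dist_real_def by (meson half_gt_zero)
      obtain d2 where d2: "d2 > 0" "\<And>y. dist y x < d2 \<Longrightarrow> \<bar>?B y - ?B x\<bar> < e/2"
        using cB \<open>e > 0\<close> unfolding continuous_at_eps_delta dist_real_def by (meson half_gt_zero)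
      obtain d3 where d3: "d3 > 0" "ball x d3 \<subseteq> U" using assms(1,3) open_contains_ball by blast
      define h where "h = min d1 (min d2 d3) / 3"
      have h: "h > 0" "3 * h \<le> d1" "3 * h \<le> d2" "3 * h \<le> d3" using d1 d2 d3 by (auto simp: h_def)
      have near: "dist (x + s *\<^sub>R axis k 1 + t *\<^sub>R axis l 1) x < 3 * h"
        if "0 \<le> s" "s \<le> h" "0 \<le> t" "t \<le> h" for s t k l
      proof -
        have "norm (s *\<^sub>R axis k 1 + t *\<^sub>R axis l (1::real)) \<le> s + t"
          using norm_triangle_ineq[of "s *\<^sub>R axis k 1" "t *\<^sub>R axis l (1::real)"] that by simp
        then show ?thesis using that h by (simp add: dist_norm algebra_simps)
      qed
      have inU: "x + s *\<^sub>R axis k 1 + t *\<^sub>R axis l 1 \<in> U"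
        if "0 \<le> s" "s \<le> h" "0 \<le> t" "t \<le> h" for s t k l
        using near[OF that, of k l] h d3(2) by (auto simp: dist_commute subset_iff)
      obtain s t where st: "0 \<le> s" "s \<le> h" "0 \<le> t" "t \<le> h"
        "R (f (x + h *\<^sub>R axis i 1 + h *\<^sub>R axis j 1)) - R (f (x + h *\<^sub>R axis i 1))
          - R (f (x + h *\<^sub>R axis j 1)) + R (f x) = h * (h * ?B (x + s *\<^sub>R axis i 1 + t *\<^sub>R axis j 1))"
        using second_difference_mean_value[OF assms(1,2) h(1) R inU, of i j] by blast
      obtain p q where pq: "0 \<le> p" "p \<le> h" "0 \<le> q" "q \<le> h"
        "R (f (x + h *\<^sub>R axis j 1 + h *\<^sub>R axis i 1)) - R (f (x + h *\<^sub>R axis j 1))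
          - R (f (x + h *\<^sub>R axis i 1)) + R (f x) = h * (h * ?A (x + p *\<^sub>R axis j 1 + q *\<^sub>R axis i 1))"
        using second_difference_mean_value[OF assms(1,2) h(1) R inU, of j i] by blast
      have comm: "x + h *\<^sub>R axis j 1 + h *\<^sub>R axis i 1 = x + h *\<^sub>R axis i 1 + h *\<^sub>R axis j 1"
        by (simp add: algebra_simps)
      have "h * (h * ?A (x + p *\<^sub>R axis j 1 + q *\<^sub>R axis i 1))
          = h * (h * ?B (x + s *\<^sub>R axis i 1 + t *\<^sub>R axis j 1))" using st(5) pq(5)[unfolded comm] by linarith
      then have "?A (x + p *\<^sub>R axis j 1 + q *\<^sub>R axis i 1) = ?B (x + s *\<^sub>R axis i 1 + t *\<^sub>R axis j 1)"
        using h(1) by simp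
      moreover have "\<bar>?A (x + p *\<^sub>R axis j 1 + q *\<^sub>R axis i 1) - ?A x\<bar> < e/2"
        using near[OF pq(1-4), of j i] h by (intro d1(2)) simp
      moreover have "\<bar>?B (x + s *\<^sub>R axis i 1 + t *\<^sub>R axis j 1) - ?B x\<bar> < e/2"
        using near[OF st(1-4), of i j] h by (intro d2(2)) simp
      ultimately show ?thesis by linarith
    qed
    then have "\<bar>?A x - ?B x\<bar> \<le> 0" using field_le_epsilon[of "\<bar>?A x - ?B x\<bar>" 0] by simp
    then show ?thesis by simp
  qed
  show ?thesis
    using key[OF bounded_linear_Re] key[OF bounded_linear_Im] by (simp add: complex_eq_iff)
qed

lemma partial_deriv_derivs_commute:
  assumes "open U" "smooth_on U f" "x \<in> U"
  shows "partial_deriv j (derivs js f) x = derivs js (partial_deriv j f) x"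
  using assms(3)
proof (induction js arbitrary: x)
  case (Cons i js)
  have "partial_deriv j (derivs (i # js) f) x = partial_deriv i (partial_deriv j (derivs js f)) x"
    using partial_deriv_commute[OF assms(1) smooth_on_derivs[OF assms(2)] Cons.prems] by simp
  also have "\<dots> = partial_deriv i (derivs js (partial_deriv j f)) x"
    by (rule partial_deriv_cong[OF assms(1) Cons.prems]) (rule Cons.IH)
  finally show ?case by simp
qed simp

lemma derivs_perm:
  assumes "open U" "smooth_on U f" "mset js = mset ks" "x \<in> U"
  shows "derivs js f x = derivs ks f x"
  using assms(3,4)
proof (induction js arbitrary: ks x)
  case (Cons j js)
  obtain as bs where ks: "ks = as @ j # bs" 
    using mset_eq_setD[OF Cons.prems(1)] split_list[of j ks] by auto
  have m: "mset js = mset (as @ bs)" using Cons.prems(1) ks by simp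
  have "derivs (j # js) f x = partial_deriv j (derivs (as @ bs) f) x"
    using partial_deriv_cong[OF assms(1) Cons.prems(2) Cons.IH[OF m]] by simp
  also have "\<dots> = partial_deriv j (derivs as (derivs bs f)) x" by simp
  also have "\<dots> = derivs as (partial_deriv j (derivs bs f)) x"
    by (rule partial_deriv_derivs_commute[OF assms(1) smooth_on_derivs[OF assms(2)] Cons.prems(2)])
  also have "\<dots> = derivs ks f x" by (simp add: ks)
  finally show ?case .
qed simp

subsection \<open>Multi-indices\<close>

lemma index_enum: "distinct (index_enum :: 'n::finite list)" "set (index_enum :: 'n list) = UNIV"
proof -
  have "\<exists>js. distinct js \<and> set js = (UNIV :: 'n set)"
    using finite_distinct_list[of "UNIV :: 'n set"] by auto
  then have "distinct (index_enum :: 'n list) \<and> set (index_enum :: 'n list) = UNIV"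
    unfolding index_enum_def by (rule someI_ex)
  then show "distinct (index_enum :: 'n::finite list)" "set (index_enum :: 'n list) = UNIV" by auto
qed

definition index_list :: "('n::finite \<Rightarrow> nat) \<Rightarrow> 'n list" where
  "index_list \<alpha> = concat (map (\<lambda>j. replicate (\<alpha> j) j) index_enum)"

lemma foldr_replicate: "foldr T (replicate k j) x = (T j ^^ k) x"
  by (induction k) auto

lemma multi_power_index_list: "multi_power T \<alpha> x = foldr T (index_list \<alpha>) x"
proof -
  have "foldr (\<lambda>j. T j ^^ \<alpha> j) js x = foldr T (concat (map (\<lambda>j. replicate (\<alpha> j) j) js)) x" for js
    by (induction js) (simp_all add: foldr_replicate)
  then show ?thesis by (simp add: multi_power_def index_list_def)
qed

lemma multi_deriv_index_list: "multi_deriv \<alpha> f = derivs (index_list \<alpha>) f"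
  by (simp add: multi_deriv_def multi_power_index_list)

lemma count_index_list: "count (mset (index_list \<alpha>)) i = \<alpha> i"
proof -
  have "distinct js \<Longrightarrow> count (mset (concat (map (\<lambda>j. replicate (\<alpha> j) j) js))) i = (if i \<in> set js then \<alpha> i else 0)" for js
    by (induction js) auto
  then show ?thesis by (simp add: index_list_def index_enum)
qed

lemma length_index_list: "length (index_list \<alpha>) = sum \<alpha> UNIV"
proof -
  have "length (index_list \<alpha>) = sum_list (map \<alpha> index_enum)"
    by (simp add: index_list_def length_concat comp_def)
  also have "\<dots> = sum \<alpha> UNIV" using index_enum by (metis sum_list_distinct_conv_sum_set)
  finally show ?thesis .
qed

lemma derivs_eq_multi_deriv:
  assumes "open U" "smooth_on U f" "x \<in> U"
  shows "derivs js f x = multi_deriv (count (mset js)) f x"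
proof -
  have "mset js = mset (index_list (count (mset js)))"
    by (rule multiset_eqI) (simp add: count_index_list)
  then show ?thesis unfolding multi_deriv_index_list by (rule derivs_perm[OF assms(1,2) _ assms(3)])
qed

lemma sum_count_mset: "sum (count (mset js)) (UNIV::'n::finite set) = length js"
proof -
  have "mset js = mset (index_list (count (mset js)))"
    by (rule multiset_eqI) (simp add: count_index_list)
  then show ?thesis by (metis length_index_list size_mset)
qed

lemma finite_bounded_multi_indices: "finite {\<alpha> :: 'n::finite \<Rightarrow> nat. sum \<alpha> UNIV \<le> N}"
proof -
  have "{\<alpha> :: 'n \<Rightarrow> nat. sum \<alpha> UNIV \<le> N} \<subseteq> UNIV \<rightarrow>\<^sub>E {..N}"
    using member_le_sum[of _ UNIV "_ :: 'n \<Rightarrow> nat"] by (auto simp: PiE_def intro: order_trans)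
  then show ?thesis by (rule finite_subset) (auto intro: finite_PiE)
qed

section \<open>Test functions\<close>

lemma fun_supportI: "f x \<noteq> 0 \<Longrightarrow> x \<in> fun_support f"
  unfolding fun_support_def by (rule subsetD[OF closure_subset]) simp

lemma fun_support_zero: "x \<notin> fun_support f \<Longrightarrow> f x = 0"
  using fun_supportI by metis

lemma closed_fun_support: "closed (fun_support f)"
  by (simp add: fun_support_def)

lemma open_compl_support: "open (- fun_support f)"
  by (simp add: closed_fun_support open_Compl)

lemma fun_support_subset:
  assumes "closed S" "\<And>x. x \<notin> S \<Longrightarrow> f x = 0"
  shows "fun_support f \<subseteq> S"
  unfolding fun_support_def using assms by (intro closure_minimal) auto

lemma derivs_zero_off_support: "x \<notin> fun_support f \<Longrightarrow> derivs js f x = 0"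
  using derivs_cong[OF open_compl_support[of f], of x f "\<lambda>x. 0" js]
  by (simp add: derivs_zero fun_support_zero)

lemma fun_support_mult: "fun_support (\<lambda>x. a x * f x) \<subseteq> fun_support f \<inter> fun_support a"
  using fun_support_subset[OF closed_fun_support[of f], of "\<lambda>x. a x * f x"]
    fun_support_subset[OF closed_fun_support[of a], of "\<lambda>x. a x * f x"]
  by (auto simp: fun_support_zero)

lemma testI:
  assumes "smooth_on UNIV f" "compact S" "\<And>x. x \<notin> S \<Longrightarrow> f x = 0"
  shows "f \<in> test_functions"
proof -
  have "fun_support f \<subseteq> S" by (rule fun_support_subset[OF compact_imp_closed[OF assms(2)] assms(3)])
  then have "compact (fun_support f)"
    using compact_Int_closed[OF assms(2) closed_fun_support[of f]] by (simp add: inf.absorb2)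
  then show ?thesis using assms(1) by (simp add: test_functions_def)
qed

lemma test_smooth: "f \<in> test_functions \<Longrightarrow> smooth_on UNIV f"
  and test_compact: "f \<in> test_functions \<Longrightarrow> compact (fun_support f)"
  by (auto simp: test_functions_def)

lemma test_derivs: "f \<in> test_functions \<Longrightarrow> derivs js f \<in> test_functions"
  by (rule testI[of _ "fun_support f"])
    (auto simp: test_smooth test_compact smooth_on_derivs derivs_zero_off_support)

lemma test_partial_deriv: "f \<in> test_functions \<Longrightarrow> partial_deriv j f \<in> test_functions"
  using test_derivs[of f "[j]"] by simp

lemma test_mult: "smooth_on UNIV a \<Longrightarrow> f \<in> test_functions \<Longrightarrow> (\<lambda>x. a x * f x) \<in> test_functions"
  by (rule testI[of _ "fun_support f"])
    (auto simp: test_smooth test_compact smooth_on_mult fun_support_zero)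

lemma test_cmult: "f \<in> test_functions \<Longrightarrow> (\<lambda>x. c * f x) \<in> test_functions"
  by (rule test_mult) auto

lemma test_add: "f \<in> test_functions \<Longrightarrow> g \<in> test_functions \<Longrightarrow> (\<lambda>x. f x + g x) \<in> test_functions"
  by (rule testI[of _ "fun_support f \<union> fun_support g"])
    (auto simp: test_smooth test_compact smooth_on_add fun_support_zero)

lemma test_diff: "f \<in> test_functions \<Longrightarrow> g \<in> test_functions \<Longrightarrow> (\<lambda>x. f x - g x) \<in> test_functions"
  by (rule testI[of _ "fun_support f \<union> fun_support g"])
    (auto simp: test_smooth test_compact smooth_on_diff fun_support_zero)

lemma test_zero: "(\<lambda>x. 0) \<in> test_functions"
  by (rule testI[of _ "{}"]) auto

lemma test_sum: "(\<And>i. i \<in> I \<Longrightarrow> f i \<in> test_functions) \<Longrightarrow> (\<lambda>x. \<Sum>i\<in>I. f i x) \<in> test_functions"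
  by (induction I rule: infinite_finite_induct) (auto intro: test_add test_zero)

text \<open>Cutting off a function that is smooth only on \<open>U\<close>: outside \<open>U\<close> the product is locally zero,
  whatever the values of \<open>g\<close> are there.\<close>

lemma smooth_on_cutoff:
  assumes "smooth_on UNIV a" "open U" "smooth_on U g" "fun_support a \<subseteq> U"
  shows "smooth_on UNIV (\<lambda>x. a x * g x)"
proof -
  have 1: "smooth_on U (\<lambda>x. a x * g x)"
    by (rule smooth_on_mult) (use assms smooth_on_subset[OF assms(1)] in auto)
  have 2: "smooth_on (- fun_support a) (\<lambda>x. a x * g x)"
    by (rule smooth_on_cong[OF open_compl_support, of _ "\<lambda>x. 0"]) (auto simp: fun_support_zero)
  have "U \<union> - fun_support a = UNIV" using assms(4) by auto
  with smooth_on_union[OF assms(2) open_compl_support 1 2] show ?thesis by simp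
qed

lemma test_cutoff:
  assumes "a \<in> test_functions" "open U" "smooth_on U g" "fun_support a \<subseteq> U"
  shows "(\<lambda>x. a x * g x) \<in> test_functions"
  by (rule testI[of _ "fun_support a"])
    (use assms smooth_on_cutoff[OF test_smooth] in \<open>auto simp: test_compact fun_support_zero\<close>)

subsection \<open>Bounds on test functions\<close>

lemma test_continuous: "f \<in> test_functions \<Longrightarrow> continuous_on UNIV f"
  by (simp add: smooth_on_continuous test_smooth)

lemma test_bounded:
  assumes "f \<in> test_functions"
  obtains B where "B \<ge> 0" "\<And>x. cmod (f x) \<le> B"
proof -
  have "bounded (f ` fun_support f)"
    using compact_imp_bounded compact_continuous_image test_compact[OF assms]
      continuous_on_subset[OF test_continuous[OF assms]] by blast
  then obtain B where "\<And>x. x \<in> fun_support f \<Longrightarrow> cmod (f x) \<le> B"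
    unfolding bounded_iff by blast
  then have "cmod (f x) \<le> max B 0" for x
    using fun_supportI[of f x] by (cases "f x = 0") force+
  then show ?thesis using that[of "max B 0"] by simp
qed

lemma frechet_derivative_expand:
  fixes f :: "real^'n::finite \<Rightarrow> complex"
  assumes "f differentiable at x"
  shows "frechet_derivative f (at x) v = (\<Sum>j\<in>UNIV. of_real (v $ j) * partial_deriv j f x)"
proof -
  let ?L = "frechet_derivative f (at x)"
  have L: "linear ?L" using assms by (rule linear_frechet_derivative)
  have "v = (\<Sum>j\<in>UNIV. (v $ j) *\<^sub>R axis j 1)"
    using basis_expansion[of v] by (simp add: scalar_mult_eq_scaleR)
  then have "?L v = (\<Sum>j\<in>UNIV. ?L ((v $ j) *\<^sub>R axis j 1))"
    using linear_sum[OF L] by metis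
  also have "\<dots> = (\<Sum>j\<in>UNIV. (v $ j) *\<^sub>R ?L (axis j 1))"
    by (simp only: linear_scale[OF L])
  finally show ?thesis
    by (simp only: partial_deriv_def scaleR_conv_of_real[where 'a=complex])
qed

lemma test_lipschitz:
  assumes "f \<in> test_functions"
  obtains C where "C \<ge> 0" "\<And>x y. cmod (f x - f y) \<le> C * norm (x - y)"
proof -
  have "\<forall>j. \<exists>B. \<forall>x. cmod (partial_deriv j f x) \<le> B"
    using test_bounded[OF test_partial_deriv[OF assms]] by metis
  then obtain B where B: "\<And>j x. cmod (partial_deriv j f x) \<le> B j" by metis
  have B0: "B j \<ge> 0" for j using B[of j 0] norm_ge_zero order_trans by blast
  have d: "f differentiable_on UNIV" using assms test_smooth smooth_on_imp_differentiable by blast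
  have on: "onorm (frechet_derivative f (at x)) \<le> sum B UNIV" for x
  proof (rule onorm_bound)
    show "0 \<le> sum B UNIV" by (simp add: sum_nonneg B0)
    fix v :: "real^'a"
    have dx: "f differentiable at x" using d by (simp add: differentiable_on_def)
    have "norm (frechet_derivative f (at x) v) \<le> (\<Sum>j\<in>UNIV. \<bar>v $ j\<bar> * cmod (partial_deriv j f x))"
      unfolding frechet_derivative_expand[OF dx] by (rule order_trans[OF norm_sum]) (simp add: norm_mult)
    also have "\<dots> \<le> (\<Sum>j\<in>UNIV. norm v * B j)"
      by (intro sum_mono mult_mono B component_le_norm_cart) auto
    finally show "norm (frechet_derivative f (at x) v) \<le> sum B UNIV * norm v"
      by (simp add: sum_distrib_left mult.commute)
  qed
  have "cmod (f x - f y) \<le> sum B UNIV * norm (x - y)" for x y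
    by (rule differentiable_bound[of UNIV f "\<lambda>x. frechet_derivative f (at x)"])
      (use on has_derivative_frechet[OF d] in auto)
  then show ?thesis using that[of "sum B UNIV"] by (simp add: sum_nonneg B0)
qed

lemma test_first_order_taylor:
  fixes f :: "real^'n::finite \<Rightarrow> complex"
  assumes "f \<in> test_functions"
  obtains C where "C \<ge> 0"
    "\<And>x v. cmod (f (x + v) - f x - (\<Sum>j\<in>UNIV. of_real (v $ j) * partial_deriv j f x)) \<le> C * (norm v)\<^sup>2"
proof -
  have "\<forall>j. \<exists>B. B \<ge> 0 \<and> (\<forall>x y. cmod (partial_deriv j f x - partial_deriv j f y) \<le> B * norm (x - y))"
    using test_lipschitz[OF test_partial_deriv[OF assms]] by metis
  then obtain B where B0: "\<And>j. B j \<ge> 0"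
    and B: "\<And>j x y. cmod (partial_deriv j f x - partial_deriv j f y) \<le> B j * norm (x - y)" by metis
  have d: "f differentiable_on UNIV" using assms test_smooth smooth_on_imp_differentiable by blast
  then have dx: "f differentiable at x" for x by (simp add: differentiable_on_def)
  have "cmod (f (x + v) - f x - frechet_derivative f (at x) v) \<le> sum B UNIV * (norm v)\<^sup>2" for x v
  proof -
    have "cmod (f (x + v) - f x - frechet_derivative f (at x) (x + v - x)) \<le> norm (x + v - x) * (sum B UNIV * norm v)"
    proof (rule differentiable_bound_linearization[of x "x + v" "cball x (norm v)" f "\<lambda>x. frechet_derivative f (at x)" x])
      show "x + t *\<^sub>R (x + v - x) \<in> cball x (norm v)" if "t \<in> {0..1}" for t
        using that by (simp add: dist_norm mult_left_le_one_le)
      show "(f has_derivative frechet_derivative f (at z)) (at z within cball x (norm v))" for z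
        using has_derivative_frechet[OF d open_UNIV] has_derivative_at_withinI by blast
      show "onorm (frechet_derivative f (at z) - frechet_derivative f (at x)) \<le> sum B UNIV * norm v"
        if "z \<in> cball x (norm v)" for z
        unfolding fun_diff_def
      proof (rule onorm_bound)
        show "0 \<le> sum B UNIV * norm v" by (simp add: sum_nonneg B0)
        fix w :: "real^'n"
        have "norm (frechet_derivative f (at z) w - frechet_derivative f (at x) w)
          = norm (\<Sum>j\<in>UNIV. of_real (w $ j) * (partial_deriv j f z - partial_deriv j f x))"
          by (simp add: frechet_derivative_expand[OF dx] sum_subtractf right_diff_distrib)
        also have "\<dots> \<le> (\<Sum>j\<in>UNIV. \<bar>w $ j\<bar> * cmod (partial_deriv j f z - partial_deriv j f x))"
          by (rule order_trans[OF norm_sum]) (simp add: norm_mult)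
        also have "\<dots> \<le> (\<Sum>j\<in>UNIV. norm w * (B j * norm v))"
        proof (intro sum_mono mult_mono component_le_norm_cart)
          show "cmod (partial_deriv j f z - partial_deriv j f x) \<le> B j * norm v" for j
            using order_trans[OF B[of j z x] mult_left_mono[OF _ B0[of j], of "norm (z - x)" "norm v"]] that
            by (simp add: dist_norm norm_minus_commute)
        qed auto
        finally show "norm (frechet_derivative f (at z) w - frechet_derivative f (at x) w) \<le> sum B UNIV * norm v * norm w"
          by (simp add: sum_distrib_left sum_distrib_right mult_ac)
      qed
    qed auto
    then show ?thesis by (simp add: power2_eq_square mult_ac)
  qed
  then show ?thesis using that[of "sum B UNIV"] by (simp add: sum_nonneg B0 frechet_derivative_expand[OF dx])
qed

section \<open>Integrals against translates of a test function\<close>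

text \<open>All operators of the proof that are given by integrals (convolutions with functions, and
  integrals along half lines) have the form \<open>x \<mapsto> \<integral> k(y) \<phi>(x + m(y)) dM(y)\<close>. The only requirement
  is integrability of \<open>k\<close> over the set where \<open>m\<close> takes values in a given compact set.\<close>

definition translation_kernel :: "'m measure \<Rightarrow> ('m \<Rightarrow> real^'n::finite) \<Rightarrow> ('m \<Rightarrow> complex) \<Rightarrow> bool" where
  "translation_kernel M m k \<longleftrightarrow> m \<in> borel_measurable M \<and> k \<in> borel_measurable M \<and>
     (\<forall>K. compact K \<longrightarrow> integrable M (\<lambda>y. indicator K (m y) * cmod (k y)))"

definition translation_integral ::
  "'m measure \<Rightarrow> ('m \<Rightarrow> real^'n::finite) \<Rightarrow> ('m \<Rightarrow> complex) \<Rightarrow> (real^'n \<Rightarrow> complex) \<Rightarrow> real^'n \<Rightarrow> complex" where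
  "translation_integral M m k \<phi> x = (LINT y|M. k y * \<phi> (x + m y))"

lemma translation_kernel_integrable_bounded:
  fixes m :: "'m \<Rightarrow> real^'n::finite"
  assumes M: "translation_kernel M m k" and g: "g \<in> borel_measurable borel" and K: "compact K"
    and supp: "\<And>z. z \<notin> K \<Longrightarrow> g z = 0" and B: "\<And>z. cmod (g z) \<le> B"
  shows "integrable M (\<lambda>y. k y * g (m y))"
    and "cmod (LINT y|M. k y * g (m y)) \<le> B * (LINT y|M. indicator K (m y) * cmod (k y))"
proof -
  have meas[measurable]: "m \<in> borel_measurable M" "k \<in> borel_measurable M"
    using M by (auto simp: translation_kernel_def)
  have int: "integrable M (\<lambda>y. B * (indicator K (m y) * cmod (k y)))"
    using M K by (auto simp: translation_kernel_def)
  have bd: "norm (k y * g (m y)) \<le> B * (indicator K (m y) * cmod (k y))" for y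
    using supp[of "m y"] B[of "m y"]
    by (cases "m y \<in> K") (auto simp: norm_mult mult.commute[of "cmod (k y)"] intro!: mult_right_mono)
  note [measurable] = g
  show 1: "integrable M (\<lambda>y. k y * g (m y))"
    by (rule Bochner_Integration.integrable_bound[OF int]) (use bd in \<open>auto intro: order_trans[OF _ abs_ge_self]\<close>)
  have "cmod (LINT y|M. k y * g (m y)) \<le> (LINT y|M. cmod (k y * g (m y)))"
    by (rule integral_norm_bound)
  also have "\<dots> \<le> (LINT y|M. B * (indicator K (m y) * cmod (k y)))"
    by (rule integral_mono[OF _ int bd]) (use 1 in auto)
  finally show "cmod (LINT y|M. k y * g (m y)) \<le> B * (LINT y|M. indicator K (m y) * cmod (k y))"
    by simp
qed

lemma test_borel [measurable]: "f \<in> test_functions \<Longrightarrow> f \<in> borel_measurable borel"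
  by (simp add: borel_measurable_continuous_onI test_continuous)

lemma translation_integrable:
  assumes "translation_kernel M m k" "\<phi> \<in> test_functions"
  shows "integrable M (\<lambda>y. k y * \<phi> (x + m y))"
proof -
  obtain B where B: "\<And>x. cmod (\<phi> x) \<le> B" using test_bounded[OF assms(2)] by metis
  have [measurable]: "\<phi> \<in> borel_measurable borel" using assms(2) by (rule test_borel)
  show ?thesis
  proof (rule translation_kernel_integrable_bounded(1)[OF assms(1), of "\<lambda>z. \<phi> (x + z)" "(\<lambda>z. z - x) ` fun_support \<phi>" B])
    show "compact ((\<lambda>z. z - x) ` fun_support \<phi>)"
      by (intro compact_continuous_image test_compact assms continuous_intros)
    show "\<phi> (x + z) = 0" if "z \<notin> (\<lambda>z. z - x) ` fun_support \<phi>" for z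
      using that fun_supportI[of \<phi> "x + z"] by (force simp: image_iff)
  qed (auto simp: B)
qed

lemma translation_integral_has_derivative:
  fixes \<phi> :: "real^'n::finite \<Rightarrow> complex"
  assumes M: "translation_kernel M m k" and \<phi>: "\<phi> \<in> test_functions"
  shows "(translation_integral M m k \<phi> has_derivative
    (\<lambda>v. \<Sum>j\<in>UNIV. of_real (v $ j) * translation_integral M m k (partial_deriv j \<phi>) x)) (at x)"
  unfolding has_derivative_at_alt
proof (intro conjI allI impI)
  let ?T = "translation_integral M m k"
  let ?L = "\<lambda>v::real^'n. \<Sum>j\<in>UNIV. of_real (v $ j) * ?T (partial_deriv j \<phi>) x"
  show "bounded_linear ?L"
    by (intro bounded_linear_sum bounded_linear_mult_const bounded_linear_compose[OF bounded_linear_of_real]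
        bounded_linear_vec_nth)
  fix e :: real assume e: "e > 0"
  obtain C where C: "C \<ge> 0"
    "\<And>x v. cmod (\<phi> (x + v) - \<phi> x - (\<Sum>j\<in>UNIV. of_real (v $ j) * partial_deriv j \<phi> x)) \<le> C * (norm v)\<^sup>2"
    using test_first_order_taylor[OF \<phi>] by metis
  \<comment> \<open>All remainders of increments of length at most one are supported in one compact set.\<close>
  define K where "K = {a - b | a b. a \<in> fun_support \<phi> \<and> b \<in> cball x 1}"
  have K: "compact K" unfolding K_def by (intro compact_differences test_compact \<phi> compact_cball)
  define I where "I = (LINT y|M. indicator K (m y) * cmod (k y))"
  have I: "I \<ge> 0" unfolding I_def by (intro integral_nonneg_AE) auto
  have [measurable]: "\<phi> \<in> borel_measurable borel" "partial_deriv j \<phi> \<in> borel_measurable borel" for j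
    using \<phi> test_borel test_partial_deriv by auto
  define d where "d = min 1 (e / (C * I + 1))"
  have CI: "C * I \<ge> 0" using C I by simp
  have d: "d > 0" "d \<le> 1" "C * I * d \<le> e"
  proof -
    show "d > 0" "d \<le> 1" using e CI by (auto simp: d_def)
    have "C * I * d \<le> (C * I + 1) * (e / (C * I + 1))"
      using CI e by (intro mult_mono) (auto simp: d_def)
    then show "C * I * d \<le> e" using CI by simp
  qed
  have "norm (?T \<phi> y - ?T \<phi> x - ?L (y - x)) \<le> e * norm (y - x)" if y: "norm (y - x) < d" for y
  proof -
    define v where "v = y - x"
    define g where "g z = \<phi> (x + v + z) - \<phi> (x + z) - (\<Sum>j\<in>UNIV. of_real (v $ j) * partial_deriv j \<phi> (x + z))" for z
    have v: "norm v \<le> 1" "norm v \<le> d" "y = x + v" using y d by (auto simp: v_def)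
    have g0: "g z = 0" if "z \<notin> K" for z
    proof -
      have 1: "x + z \<notin> fun_support \<phi>"
      proof
        assume "x + z \<in> fun_support \<phi>"
        moreover have "x \<in> cball x 1" by simp
        moreover have "z = x + z - x" by simp
        ultimately show False using that unfolding K_def by blast
      qed
      have 2: "x + v + z \<notin> fun_support \<phi>"
      proof
        assume "x + v + z \<in> fun_support \<phi>"
        moreover have "x + v \<in> cball x 1" using v by (simp add: dist_norm)
        moreover have "z = x + v + z - (x + v)" by simp
        ultimately show False using that unfolding K_def by blast
      qed
      show ?thesis
        using 1 2 derivs_zero_off_support[OF 1, of "[_]"] by (simp add: g_def fun_support_zero)
    qed
    have gB: "cmod (g z) \<le> C * (norm v)\<^sup>2" for z
      using C(2)[of "x + z" v] by (simp add: g_def add.commute add.left_commute)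
    have "?T \<phi> y - ?T \<phi> x - ?L v = (LINT y|M. k y * g (m y))"
    proof -
      have *: "integrable M (\<lambda>y. k y * (of_real (v $ j) * partial_deriv j \<phi> (x + m y)))" for j
        using integrable_mult_right[OF translation_integrable[OF M test_partial_deriv[OF \<phi>], of j x], of "of_real (v $ j)"]
        by (simp add: algebra_simps)
      have "(LINT y|M. k y * g (m y)) = (LINT y|M. k y * \<phi> (x + v + m y) - k y * \<phi> (x + m y)
         - (\<Sum>j\<in>UNIV. k y * (of_real (v $ j) * partial_deriv j \<phi> (x + m y))))"
        by (simp add: g_def right_diff_distrib sum_distrib_left)
      also have "\<dots> = ?T \<phi> y - ?T \<phi> x - (\<Sum>j\<in>UNIV. (LINT y|M. k y * (of_real (v $ j) * partial_deriv j \<phi> (x + m y))))"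
        using translation_integrable[OF M \<phi>] *
        by (simp add: translation_integral_def v(3) Bochner_Integration.integral_sum)
      also have "(\<Sum>j\<in>UNIV. (LINT y|M. k y * (of_real (v $ j) * partial_deriv j \<phi> (x + m y)))) = ?L v"
        by (simp add: translation_integral_def mult.left_commute[of "k _"])
      finally show ?thesis by simp
    qed
    also have "cmod \<dots> \<le> C * (norm v)\<^sup>2 * I"
      unfolding I_def
      by (rule translation_kernel_integrable_bounded(2)[OF M _ K g0 gB]) (simp add: g_def[abs_def])
    also have "\<dots> = C * I * norm v * norm v" by (simp add: power2_eq_square)
    also have "\<dots> \<le> e * norm v"
      using mult_left_mono[OF v(2) CI] d(3) by (intro mult_right_mono) auto
    finally show ?thesis by (simp add: v_def)
  qed
  then show "\<exists>d>0. \<forall>y. norm (y - x) < d \<longrightarrow> norm (?T \<phi> y - ?T \<phi> x - ?L (y - x)) \<le> e * norm (y - x)"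
    using d(1) by blast
qed

lemma partial_deriv_translation_integral:
  assumes M: "translation_kernel M m k" and \<phi>: "\<phi> \<in> test_functions"
  shows "partial_deriv j (translation_integral M m k \<phi>) = translation_integral M m k (partial_deriv j \<phi>)"
proof
  fix x
  show "partial_deriv j (translation_integral M m k \<phi>) x = translation_integral M m k (partial_deriv j \<phi>) x"
    using partial_deriv_eq[OF translation_integral_has_derivative[OF assms, of x], of j]
    by (simp add: axis_def if_distrib[of complex_of_real] if_distrib[of "\<lambda>z. z * _"] cong: if_cong)
qed

lemma derivs_translation_integral:
  assumes M: "translation_kernel M m k" and \<phi>: "\<phi> \<in> test_functions"
  shows "derivs js (translation_integral M m k \<phi>) = translation_integral M m k (derivs js \<phi>)"
  by (induction js) (simp_all add: partial_deriv_translation_integral[OF M test_derivs[OF \<phi>]])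

lemma smooth_translation_integral:
  assumes M: "translation_kernel M m k" and \<phi>: "\<phi> \<in> test_functions"
  shows "smooth_on UNIV (translation_integral M m k \<phi>)"
  unfolding smooth_on_def differentiable_on_def differentiable_def derivs_translation_integral[OF assms]
  using translation_integral_has_derivative[OF M test_derivs[OF \<phi>]] has_derivative_at_withinI by blast

lemma translation_integral_add:
  assumes "translation_kernel M m k" "\<phi> \<in> test_functions" "\<psi> \<in> test_functions"
  shows "translation_integral M m k (\<lambda>x. a * \<phi> x + b * \<psi> x) x
    = a * translation_integral M m k \<phi> x + b * translation_integral M m k \<psi> x"
proof -
  have "(LINT y|M. k y * (a * \<phi> (x + m y) + b * \<psi> (x + m y)))
    = (LINT y|M. a * (k y * \<phi> (x + m y)) + b * (k y * \<psi> (x + m y)))"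
    by (simp add: algebra_simps)
  then show ?thesis
    using translation_integrable[OF assms(1,2), of x] translation_integrable[OF assms(1,3), of x]
    by (simp add: translation_integral_def)
qed

subsection \<open>Invariance of Lebesgue measure and integration by parts\<close>

lemma distr_lborel_translate_reflect:
  assumes "c = 1 \<or> c = -1"
  shows "distr lborel borel (\<lambda>x. a + c *\<^sub>R x) = (lborel :: 'a::euclidean_space measure)"
  using assms by (subst lborel_affine[of c a]) (auto simp: density_1)

lemma lborel_integral_translate_reflect:
  fixes f :: "'a::euclidean_space \<Rightarrow> complex"
  assumes c: "c = 1 \<or> c = -1" and [measurable]: "f \<in> borel_measurable borel"
  shows "(LINT x|lborel. f (a + c *\<^sub>R x)) = (LINT x|lborel. f x)"
    and "integrable lborel (\<lambda>x. f (a + c *\<^sub>R x)) \<longleftrightarrow> integrable lborel f"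
proof -
  have "(LINT x|distr lborel borel (\<lambda>x. a + c *\<^sub>R x). f x) = (LINT x|lborel. f (a + c *\<^sub>R x))"
    by (rule integral_distr) auto
  then show "(LINT x|lborel. f (a + c *\<^sub>R x)) = (LINT x|lborel. f x)"
    by (simp add: distr_lborel_translate_reflect[OF c])
  have "integrable (distr lborel borel (\<lambda>x. a + c *\<^sub>R x)) f \<longleftrightarrow> integrable lborel (\<lambda>x. f (a + c *\<^sub>R x))"
    by (rule integrable_distr_eq) auto
  then show "integrable lborel (\<lambda>x. f (a + c *\<^sub>R x)) \<longleftrightarrow> integrable lborel f"
    by (simp add: distr_lborel_translate_reflect[OF c])
qed

lemma kernel_lborel:
  fixes k :: "real^'n::finite \<Rightarrow> complex"
  assumes "c = 1 \<or> c = -1" and [measurable]: "k \<in> borel_measurable borel"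
    and "\<And>K. compact K \<Longrightarrow> integrable lborel (\<lambda>y. indicator K y * cmod (k y))"
  shows "translation_kernel lborel (\<lambda>y. c *\<^sub>R y) k"
  unfolding translation_kernel_def
proof (intro conjI allI impI)
  fix K :: "(real^'n) set" assume K: "compact K"
  have cK: "compact ((\<lambda>y. c *\<^sub>R y) ` K)" by (intro compact_continuous_image continuous_intros K)
  have eq: "indicator ((\<lambda>y. c *\<^sub>R y) ` K) y = (indicator K (c *\<^sub>R y) :: real)" for y
    using assms(1) by (auto simp: indicator_def image_iff) (metis minus_minus)+
  show "integrable lborel (\<lambda>y. indicator K (c *\<^sub>R y) * cmod (k y))"
    using assms(3)[OF cK] unfolding eq .
qed auto

lemma integrable_continuous_compact:
  fixes f :: "real^'n::finite \<Rightarrow> real"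
  assumes "compact K" "continuous_on K f"
  shows "integrable lborel (\<lambda>y. indicator K y * f y)"
  using borel_integrable_compact[OF assms] by (simp add: set_integrable_def mult.commute cong: if_cong)

lemma kernel_continuous:
  fixes k :: "real^'n::finite \<Rightarrow> complex"
  assumes "c = 1 \<or> c = -1" "continuous_on UNIV k"
  shows "translation_kernel lborel (\<lambda>y. c *\<^sub>R y) k"
proof (rule kernel_lborel[OF assms(1)])
  show "k \<in> borel_measurable borel" using assms(2) by (rule borel_measurable_continuous_onI)
  show "integrable lborel (\<lambda>y. indicator K y * cmod (k y))" if "compact K" for K
    using that by (intro integrable_continuous_compact continuous_on_norm continuous_on_subset[OF assms(2)]) auto
qed

lemma integrable_test: "\<phi> \<in> test_functions \<Longrightarrow> integrable lborel \<phi>"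
  using translation_integrable[OF kernel_continuous[of 1 "\<lambda>_. 1"], of \<phi> 0] by simp

text \<open>The integral of \<open>\<phi>(x + \<cdot>)\<close> does not depend on \<open>x\<close>, and it may be differentiated under the
  integral sign.\<close>

lemma integral_partial_deriv_test:
  assumes "\<phi> \<in> test_functions"
  shows "(LINT y|lborel. partial_deriv j \<phi> y) = 0"
proof -
  let ?T = "translation_integral lborel (\<lambda>y. 1 *\<^sub>R y) (\<lambda>_. 1)"
  have const: "?T \<psi> = (\<lambda>x. LINT y|lborel. \<psi> y)" if "\<psi> \<in> test_functions" for \<psi> :: "real^'a \<Rightarrow> complex"
    using lborel_integral_translate_reflect(1)[of 1 \<psi>] test_borel[OF that] by (simp add: translation_integral_def fun_eq_iff)
  have kern: "translation_kernel lborel (\<lambda>y::real^'a. 1 *\<^sub>R y) (\<lambda>_. 1)" by (rule kernel_continuous) auto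
  have "?T (partial_deriv j \<phi>) 0 = partial_deriv j (?T \<phi>) 0"
    by (simp only: partial_deriv_translation_integral[OF kern assms])
  then show ?thesis
    by (simp only: const[OF assms] const[OF test_partial_deriv[OF assms]] partial_deriv_const)
qed

lemma integration_by_parts:
  assumes "smooth_on UNIV f" "\<phi> \<in> test_functions"
  shows "(LINT y|lborel. f y * partial_deriv j \<phi> y) = - (LINT y|lborel. partial_deriv j f y * \<phi> y)"
proof -
  have t: "(\<lambda>y. f y * partial_deriv j \<phi> y) \<in> test_functions" "(\<lambda>y. partial_deriv j f y * \<phi> y) \<in> test_functions"
    using assms by (auto intro!: test_mult test_partial_deriv smooth_on_partial_deriv)
  have "partial_deriv j (\<lambda>y. f y * \<phi> y) = (\<lambda>y. partial_deriv j f y * \<phi> y + f y * partial_deriv j \<phi> y)"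
    by (rule ext, rule partial_deriv_mult[of UNIV])
      (use assms smooth_on_imp_differentiable test_smooth in auto)
  then have "(LINT y|lborel. partial_deriv j f y * \<phi> y + f y * partial_deriv j \<phi> y) = 0"
    using integral_partial_deriv_test[OF test_mult[OF assms], of j] by simp
  then show ?thesis
    using integrable_test[OF t(1)] integrable_test[OF t(2)] by (simp add: add_eq_0_iff)
qed

section \<open>Bump and cut-off functions\<close>

text \<open>The functions \<open>p(1/t) exp(-1/t)\<close>, extended by zero to \<open>t \<le> 0\<close>. With an arbitrary polynomial \<open>p\<close>
  the class is closed under differentiation, also at \<open>t = 0\<close>.\<close>

definition exp_recip :: "real poly \<Rightarrow> real \<Rightarrow> real" where
  "exp_recip p t = (if t > 0 then poly p (1 / t) * exp (- (1 / t)) else 0)"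

lemma tendsto_poly_exp_recip: "((\<lambda>t. poly p (1 / t) * exp (- (1 / t))) \<longlongrightarrow> 0) (at_right (0::real))"
proof -
  have "((\<lambda>x. poly p x * exp (- x)) \<longlongrightarrow> 0) (at_top :: real filter)"
  proof -
    have "((\<lambda>x. \<Sum>i\<le>degree p. coeff p i * (x ^ i / exp x)) \<longlongrightarrow> (\<Sum>i\<le>degree p. coeff p i * 0)) (at_top :: real filter)"
      by (intro tendsto_sum tendsto_mult tendsto_const tendsto_power_div_exp_0)
    moreover have "(\<lambda>x. \<Sum>i\<le>degree p. coeff p i * (x ^ i / exp x)) = (\<lambda>x. poly p x * exp (- x))"
      by (simp add: poly_altdef sum_distrib_right exp_minus divide_inverse mult.assoc)
    ultimately show ?thesis by simp
  qed
  then have "((\<lambda>t. poly p (inverse t) * exp (- inverse t)) \<longlongrightarrow> 0) (at_right (0::real))"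
    by (rule filterlim_compose[OF _ filterlim_inverse_at_top_right])
  then show ?thesis by (simp add: inverse_eq_divide)
qed

lemma exp_recip_has_derivative:
  "(exp_recip p has_real_derivative exp_recip ((p - pderiv p) * [:0, 0, 1:]) t) (at t)"
proof -
  consider "t > 0" | "t < 0" | "t = 0" by linarith
  then show ?thesis
  proof cases
    case 1
    have "((\<lambda>t. poly p (1 / t) * exp (- (1 / t))) has_real_derivative
      exp_recip ((p - pderiv p) * [:0, 0, 1:]) t) (at t)"
      using 1 by (auto intro!: derivative_eq_intros DERIV_chain2[OF poly_DERIV] simp: exp_recip_def field_simps power2_eq_square)
    then show ?thesis
      by (rule has_field_derivative_transform_within_open[of _ _ _ "{0<..}"]) (use 1 in \<open>auto simp: exp_recip_def\<close>)
  next
    case 2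
    have "((\<lambda>t. 0) has_real_derivative 0) (at t)" by simp
    then have "(exp_recip p has_real_derivative 0) (at t)"
      by (rule has_field_derivative_transform_within_open[of _ _ _ "{..<0}"]) (use 2 in \<open>auto simp: exp_recip_def\<close>)
    then show ?thesis using 2 by (simp add: exp_recip_def)
  next
    case 3
    have "((\<lambda>t. exp_recip p t / t) \<longlongrightarrow> 0) (at_right 0)"
    proof (rule Lim_transform_eventually[OF tendsto_poly_exp_recip[of "p * [:0, 1:]"]])
      show "\<forall>\<^sub>F t in at_right 0. poly (p * [:0, 1:]) (1 / t) * exp (- (1 / t)) = exp_recip p t / t"
        by (auto simp: eventually_at_filter exp_recip_def)
    qed
    moreover have "((\<lambda>t. exp_recip p t / t) \<longlongrightarrow> 0) (at_left 0)"
      by (rule Lim_transform_eventually[OF tendsto_const]) (auto simp: eventually_at_filter exp_recip_def)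
    ultimately have "((\<lambda>t. exp_recip p t / t) \<longlongrightarrow> 0) (at 0)"
      by (simp add: filterlim_split_at)
    then show ?thesis using 3 by (simp add: has_field_derivative_iff exp_recip_def)
  qed
qed

definition bump :: "real^'n::finite \<Rightarrow> real \<Rightarrow> real^'n \<Rightarrow> complex" where
  "bump a r x = of_real (exp_recip 1 (r\<^sup>2 - (norm (x - a))\<^sup>2))"

lemma bump_nonneg: "bump a r x = of_real (Re (bump a r x))" "Re (bump a r x) \<ge> 0"
  by (auto simp: bump_def exp_recip_def)

lemma bump_eq_0_iff: "r > 0 \<Longrightarrow> bump a r x = 0 \<longleftrightarrow> x \<notin> ball a r"
proof -
  assume r: "r > 0"
  have "r\<^sup>2 - (norm (x - a))\<^sup>2 > 0 \<longleftrightarrow> norm (x - a) < r"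
    using r power_strict_mono[of "norm (x - a)" r 2] power2_less_imp_less[of "norm (x - a)" r] by auto
  then show ?thesis by (simp add: bump_def exp_recip_def dist_norm norm_minus_commute)
qed

lemma bump_test: 
  assumes "r > 0"
  shows "bump a r \<in> test_functions"
proof (rule testI[of _ "cball a r"])
  have cl: "\<exists>G'\<in>range exp_recip. \<forall>t\<in>UNIV. (G has_real_derivative G' t) (at t)" if "G \<in> range exp_recip" for G
    using that exp_recip_has_derivative by blast
  have eq: "complex_of_real (r\<^sup>2 - (norm (x - a))\<^sup>2) = of_real (r\<^sup>2) - of_real ((norm (x - a))\<^sup>2)" for x
    by simp
  have "smooth_on UNIV (\<lambda>x. complex_of_real (r\<^sup>2 - (norm (x - a))\<^sup>2))"
    unfolding eq by (intro smooth_on_diff smooth_on_const smooth_on_norm_sq) auto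
  from smooth_on_compose[OF open_UNIV this _ cl, of "exp_recip 1"]
  show "smooth_on UNIV (bump a r)" by (simp add: bump_def[abs_def])
  show "bump a r x = 0" if "x \<notin> cball a r" for x
    using that bump_eq_0_iff[OF assms, of a x] by simp
qed simp

lemma bump_integral_pos:
  assumes "r > 0"
  shows "(LINT x|lborel. bump a r x) = of_real (LINT x|lborel. Re (bump a r x))"
    and "(LINT x|lborel. Re (bump a r x)) > 0"
proof -
  have int: "integrable lborel (bump a r)" by (rule integrable_test[OF bump_test[OF assms]])
  have "(LINT x|lborel. bump a r x) = (LINT x|lborel. complex_of_real (Re (bump a r x)))"
    using bump_nonneg(1) by (intro Bochner_Integration.integral_cong) auto
  then show "(LINT x|lborel. bump a r x) = of_real (LINT x|lborel. Re (bump a r x))"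
    by simp
  have iR: "integrable lborel (\<lambda>x. Re (bump a r x))" using int by simp
  have "(LINT x|lborel. Re (bump a r x)) \<noteq> 0"
  proof
    assume "(LINT x|lborel. Re (bump a r x)) = 0"
    then have "AE x in lborel. Re (bump a r x) = 0"
      using integral_nonneg_eq_0_iff_AE[OF iR AE_I2] bump_nonneg(2) by blast
    then have "AE x in lborel. x \<notin> ball a r"
      by eventually_elim (use bump_eq_0_iff[OF assms, of a] in \<open>simp add: bump_def\<close>)
    then have "ball a r \<in> null_sets lborel" by (subst AE_iff_null_sets) auto
    then show False
      using assms open_not_negligible[of "ball a r"]
      by (auto simp: negligible_iff_null_sets null_sets_completionI)
  qed
  then show "(LINT x|lborel. Re (bump a r x)) > 0"
    using Bochner_Integration.integral_nonneg[of lborel "\<lambda>x. Re (bump a r x)", OF bump_nonneg(2)]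
    by linarith
qed

text \<open>The cut-off function is the indicator function of a neighbourhood of \<open>K\<close>, mollified.\<close>

lemma cutoff_exists:
  fixes K U :: "(real^'n::finite) set"
  assumes "compact K" "open U" "K \<subseteq> U"
  obtains \<kappa> W where "\<kappa> \<in> test_functions" "fun_support \<kappa> \<subseteq> U" "open W" "K \<subseteq> W" "\<And>x. x \<in> W \<Longrightarrow> \<kappa> x = 1"
proof (cases "K = {}")
  case True
  then show ?thesis using that[of "\<lambda>x. 0" "{}"] test_zero by (simp add: fun_support_def)
next
  case ne: False
  obtain e where e: "e > 0" "(\<Union>x\<in>K. ball x e) \<subseteq> U"
    using compact_subset_open_imp_ball_epsilon_subset[OF assms] by blast
  define A where "A r = {x. infdist x K \<le> r}" for r
  have clA: "closed (A r)" for r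
    unfolding A_def by (intro closed_Collect_le continuous_intros)
  have near: "\<exists>z\<in>K. dist x z \<le> r" if "x \<in> A r" for x r
  proof -
    obtain z where "z \<in> K" "infdist x K = dist x z"
      by (rule infdist_attains_inf[OF compact_imp_closed[OF assms(1)] ne])
    then show ?thesis using that by (auto simp: A_def)
  qed
  have cA: "compact (A r)" for r
  proof -
    obtain R where R: "\<And>z. z \<in> K \<Longrightarrow> norm z \<le> R"
      using compact_imp_bounded[OF assms(1)] unfolding bounded_iff by blast
    have "norm x \<le> R + r" if xA: "x \<in> A r" for x
    proof -
      obtain z where "z \<in> K" "dist x z \<le> r" using near[OF xA] by blast
      then show ?thesis using R[of z] norm_triangle_ineq[of "x - z" z] by (simp add: dist_norm)
    qed
    then have "bounded (A r)" unfolding bounded_iff by blast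
    then show ?thesis using clA[of r] compact_eq_bounded_closed by blast
  qed
  define b where "b = bump (0::real^'n) (e/4)"
  have b: "b \<in> test_functions" using e by (simp add: b_def bump_test)
  have b0: "b x = 0" if "norm x \<ge> e/4" for x
    using that e bump_eq_0_iff[of "e/4" 0 x] by (simp add: b_def)
  define c where "c = (LINT x|lborel. b x)"
  have c: "c \<noteq> 0" using bump_integral_pos[of "e/4" "0::real^'n"] e by (auto simp: c_def b_def)
  define k where "k y = indicator (A (e/2)) y / c" for y
  have kern: "translation_kernel lborel (\<lambda>y. (-1) *\<^sub>R y) k"
  proof (rule kernel_lborel)
    have [measurable]: "A (e/2) \<in> sets borel" using clA by auto
    show "k \<in> borel_measurable borel" unfolding k_def by measurable
    fix K :: "(real^'n) set" assume K: "compact K"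
    have "integrable lborel (\<lambda>y. indicator (K \<inter> A (e/2)) y * (1 / cmod c))"
      by (rule integrable_continuous_compact) (auto intro: compact_Int_closed K clA)
    then show "integrable lborel (\<lambda>y. indicator K y * cmod (k y))"
      by (rule Bochner_Integration.integrable_cong[THEN iffD1, rotated 2])
        (auto simp: k_def norm_divide indicator_def)
  qed auto
  define \<kappa> where "\<kappa> = translation_integral lborel (\<lambda>y. (-1) *\<^sub>R y) k b"
  have sm: "smooth_on UNIV \<kappa>" unfolding \<kappa>_def by (rule smooth_translation_integral[OF kern b])
  have lip: "infdist x K \<le> infdist y K + norm (x - y)" for x y
    using infdist_triangle[of x K y] by (simp add: dist_norm)
  have z: "\<kappa> x = 0" if "x \<notin> A (3*e/4)" for x
  proof -
    have "k y * b (x + (-1) *\<^sub>R y) = 0" for y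
    proof (cases "y \<in> A (e/2)")
      case True
      then have "norm (x - y) \<ge> e/4" using that lip[of x y] by (auto simp: A_def)
      then show ?thesis using b0 by simp
    qed (simp add: k_def)
    then show ?thesis by (simp only: \<kappa>_def translation_integral_def Bochner_Integration.integral_zero)
  qed
  have one: "\<kappa> x = 1" if "infdist x K < e/4" for x
  proof -
    have "k y * b (x + (-1) *\<^sub>R y) = b (x + (-1) *\<^sub>R y) / c" for y
    proof (cases "y \<in> A (e/2)")
      case False
      then have "norm (x - y) \<ge> e/4" using that lip[of y x] by (auto simp: A_def norm_minus_commute)
      then show ?thesis using b0 by simp
    qed (simp add: k_def)
    then have "\<kappa> x = (LINT y|lborel. b (x + (-1) *\<^sub>R y) / c)"
      by (simp only: \<kappa>_def translation_integral_def)
    also have "\<dots> = (LINT y|lborel. b (x + (-1) *\<^sub>R y)) / c" by (rule integral_divide_zero)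
    also have "\<dots> = 1" 
      using lborel_integral_translate_reflect(1)[of "-1" b x] test_borel[OF b] c by (simp add: c_def)
    finally show ?thesis .
  qed
  show ?thesis
  proof (rule that[of \<kappa> "{x. infdist x K < e/4}"])
    show "\<kappa> \<in> test_functions" by (rule testI[OF sm cA z])
    have "A (3*e/4) \<subseteq> U"
    proof
      fix x assume "x \<in> A (3*e/4)"
      then obtain z where "z \<in> K" "dist x z \<le> 3*e/4" using near by blast
      then have "x \<in> ball z e" using e(1) by (simp add: dist_commute)
      then show "x \<in> U" using e(2) \<open>z \<in> K\<close> by blast
    qed
    moreover have "fun_support \<kappa> \<subseteq> A (3*e/4)" by (rule fun_support_subset[OF clA]) (rule z)
    ultimately show "fun_support \<kappa> \<subseteq> U" by blast
    show "open {x. infdist x K < e/4}" by (intro open_Collect_less continuous_intros)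
    show "K \<subseteq> {x. infdist x K < e/4}" using e by auto
  qed (use one in auto)
qed

section \<open>Compactly supported distributions as functionals on smooth functions\<close>

text \<open>A distribution on \<open>U\<close> with support in a compact subset \<open>K\<close> of \<open>U\<close>, as a continuous linear
  functional on the functions that are smooth on \<open>U\<close>. Continuity is expressed by bounds \<open>B\<close> for
  all derivatives up to some order on \<open>K\<close> instead of by a seminorm. Allowing \<open>U\<close> to be a proper
  subset makes it possible to evaluate on functions that are singular away from the support.\<close>

definition smooth_functional :: "(real^'n::finite) set \<Rightarrow> (real^'n) set \<Rightarrow> 'n functional \<Rightarrow> bool" where
  "smooth_functional U K T \<longleftrightarrow> compact K \<and> K \<subseteq> U \<and>
     (\<forall>f g a b. smooth_on U f \<longrightarrow> smooth_on U g \<longrightarrow> T (\<lambda>x. a * f x + b * g x) = a * T f + b * T g) \<and>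
     (\<exists>C N. C \<ge> 0 \<and> (\<forall>f B. smooth_on U f \<longrightarrow> B \<ge> 0 \<longrightarrow>
        (\<forall>js x. length js \<le> N \<longrightarrow> x \<in> K \<longrightarrow> cmod (derivs js f x) \<le> B) \<longrightarrow> cmod (T f) \<le> C * B))"

lemma smooth_functionalI:
  assumes "compact K" "K \<subseteq> U"
    and "\<And>f g a b. smooth_on U f \<Longrightarrow> smooth_on U g \<Longrightarrow> T (\<lambda>x. a * f x + b * g x) = a * T f + b * T g"
    and "C \<ge> 0" "\<And>f B. smooth_on U f \<Longrightarrow> B \<ge> 0 \<Longrightarrow>
        (\<And>js x. length js \<le> N \<Longrightarrow> x \<in> K \<Longrightarrow> cmod (derivs js f x) \<le> B) \<Longrightarrow> cmod (T f) \<le> C * B"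
  shows "smooth_functional U K T"
  unfolding smooth_functional_def using assms(1-4) by (intro conjI exI[of _ C] exI[of _ N]) (auto intro: assms(5))

lemma smooth_functional_compact: "smooth_functional U K T \<Longrightarrow> compact K"
  and smooth_functional_subset: "smooth_functional U K T \<Longrightarrow> K \<subseteq> U"
  by (auto simp: smooth_functional_def)

lemma smooth_functional_bound:
  assumes "smooth_functional U K T"
  obtains C N where "C \<ge> 0" "\<And>f B. smooth_on U f \<Longrightarrow> B \<ge> 0 \<Longrightarrow>
        (\<And>js x. length js \<le> N \<Longrightarrow> x \<in> K \<Longrightarrow> cmod (derivs js f x) \<le> B) \<Longrightarrow> cmod (T f) \<le> C * B"
proof -
  from assms obtain C N where C: "C \<ge> 0" and b: "\<forall>f B. smooth_on U f \<longrightarrow> B \<ge> 0 \<longrightarrow>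
        (\<forall>js x. length js \<le> N \<longrightarrow> x \<in> K \<longrightarrow> cmod (derivs js f x) \<le> B) \<longrightarrow> cmod (T f) \<le> C * B"
    unfolding smooth_functional_def by (elim conjE exE)
  show ?thesis by (rule that[OF C, of N]) (use b in simp)
qed

lemma smooth_functional_linear:
  assumes "smooth_functional U K T" "smooth_on U f" "smooth_on U g"
  shows "T (\<lambda>x. a * f x + b * g x) = a * T f + b * T g"
  using assms unfolding smooth_functional_def by simp

lemma smooth_functional_add:
  assumes "smooth_functional U K T" "smooth_on U f" "smooth_on U g"
  shows "T (\<lambda>x. f x + g x) = T f + T g"
  using smooth_functional_linear[OF assms, of 1 1] by simp

lemma smooth_functional_diff:
  assumes "smooth_functional U K T" "smooth_on U f" "smooth_on U g"
  shows "T (\<lambda>x. f x - g x) = T f - T g"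
  using smooth_functional_linear[OF assms, of 1 "-1"] by simp

lemma smooth_functional_zero: "smooth_functional U K T \<Longrightarrow> T (\<lambda>x. 0) = 0"
  using smooth_functional_linear[of U K T "\<lambda>x. 0" "\<lambda>x. 0" 0 0] by simp

lemma smooth_functional_cmult:
  assumes "smooth_functional U K T" "smooth_on U f"
  shows "T (\<lambda>x. c * f x) = c * T f"
  using smooth_functional_linear[OF assms(1,2) smooth_on_const[of _ 0], of c 0] by simp

lemma smooth_functional_sum:
  assumes T: "smooth_functional U K T" and U: "open U" and "\<And>i. i \<in> I \<Longrightarrow> smooth_on U (f i)"
  shows "T (\<lambda>x. \<Sum>i\<in>I. f i x) = (\<Sum>i\<in>I. T (f i))"
  using assms(3)
proof (induction I rule: infinite_finite_induct)
  case (insert i I)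
  then show ?case
    using smooth_functional_add[OF T, of "f i" "\<lambda>x. \<Sum>i\<in>I. f i x"] smooth_on_sum[OF U, of I f] by simp
qed (simp_all add: smooth_functional_zero[OF T])

lemma smooth_functional_cong:
  assumes T: "smooth_functional U K T" and U: "open U" and fg: "smooth_on U f" "smooth_on U g"
    and W: "open W" "K \<subseteq> W" "\<And>x. x \<in> W \<Longrightarrow> f x = g x"
  shows "T f = T g"
proof -
  obtain C N where C: "C \<ge> 0" "\<And>f B. smooth_on U f \<Longrightarrow> B \<ge> 0 \<Longrightarrow>
        (\<And>js x. length js \<le> N \<Longrightarrow> x \<in> K \<Longrightarrow> cmod (derivs js f x) \<le> B) \<Longrightarrow> cmod (T f) \<le> C * B"
    using smooth_functional_bound[OF T] by metis
  have "cmod (T (\<lambda>x. f x - g x)) \<le> C * 0"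
  proof (rule C(2))
    show "smooth_on U (\<lambda>x. f x - g x)" using fg U by (simp add: smooth_on_diff)
    show "cmod (derivs js (\<lambda>x. f x - g x) x) \<le> 0" if "x \<in> K" for js x
      using derivs_cong[OF W(1), of x "\<lambda>x. f x - g x" "\<lambda>x. 0" js] W that by (auto simp: derivs_zero)
  qed simp
  then show ?thesis using smooth_functional_diff[OF T fg] by simp
qed

lemma smooth_functional_tendsto:
  assumes T: "smooth_functional U K T" and U: "open U" and f: "\<And>m. smooth_on U (f m)" "smooth_on U g"
    and lim: "\<And>js e. e > 0 \<Longrightarrow> \<forall>\<^sub>F m in sequentially. \<forall>x\<in>K. cmod (derivs js (f m) x - derivs js g x) \<le> e"
  shows "(\<lambda>m. T (f m)) \<longlonglongrightarrow> T g"
proof -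
  obtain C N where C: "C \<ge> 0" "\<And>f B. smooth_on U f \<Longrightarrow> B \<ge> 0 \<Longrightarrow>
        (\<And>js x. length js \<le> N \<Longrightarrow> x \<in> K \<Longrightarrow> cmod (derivs js f x) \<le> B) \<Longrightarrow> cmod (T f) \<le> C * B"
    using smooth_functional_bound[OF T] by metis
  have fin: "finite {js :: 'a list. length js \<le> N}"
    using finite_lists_length_le[of "UNIV :: 'a set" N] by simp
  show ?thesis
    unfolding tendsto_iff dist_norm
  proof (intro allI impI)
    fix e :: real assume e: "e > 0"
    define d where "d = e / (C + 1)"
    have d: "d > 0" "C * d < e"
    proof -
      show "d > 0" using e C by (simp add: d_def)
      have "C * d < (C + 1) * d" using \<open>d > 0\<close> by (simp add: algebra_simps)
      then show "C * d < e" using C by (simp add: d_def)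
    qed
    have "\<forall>\<^sub>F m in sequentially. \<forall>js\<in>{js. length js \<le> N}. \<forall>x\<in>K. cmod (derivs js (f m) x - derivs js g x) \<le> d"
      using lim[OF d(1)] by (intro eventually_ball_finite[OF fin]) blast
    then show "\<forall>\<^sub>F m in sequentially. cmod (T (f m) - T g) < e"
    proof eventually_elim
      case (elim m)
      have "cmod (T (\<lambda>x. f m x - g x)) \<le> C * d"
      proof (rule C(2))
        show "smooth_on U (\<lambda>x. f m x - g x)" using f U by (simp add: smooth_on_diff)
        show "cmod (derivs js (\<lambda>x. f m x - g x) x) \<le> d" if "length js \<le> N" "x \<in> K" for js x
          using that elim derivs_diff[OF U f(1)[of m] f(2), of x js] smooth_functional_subset[OF T] by auto
      qed (use d in simp)
      then show ?case using d smooth_functional_diff[OF T f(1)[of m] f(2)] by simp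
    qed
  qed
qed

lemma smooth_functional_partial_deriv:
  assumes T: "smooth_functional U K T" and U: "open U"
  shows "smooth_functional U K (\<lambda>f. T (partial_deriv j f))"
proof -
  obtain C N where C: "C \<ge> 0" "\<And>f B. smooth_on U f \<Longrightarrow> B \<ge> 0 \<Longrightarrow>
        (\<And>js x. length js \<le> N \<Longrightarrow> x \<in> K \<Longrightarrow> cmod (derivs js f x) \<le> B) \<Longrightarrow> cmod (T f) \<le> C * B"
    using smooth_functional_bound[OF T] by metis
  show ?thesis
  proof (rule smooth_functionalI[OF smooth_functional_compact[OF T] smooth_functional_subset[OF T] _ C(1)])
    fix f g a b assume fg: "smooth_on U f" "smooth_on U g"
    have "T (partial_deriv j (\<lambda>x. a * f x + b * g x)) = T (\<lambda>x. a * partial_deriv j f x + b * partial_deriv j g x)"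
    proof (rule smooth_functional_cong[OF T U _ _ U smooth_functional_subset[OF T]])
      show "smooth_on U (partial_deriv j (\<lambda>x. a * f x + b * g x))"
        using fg U by (intro smooth_on_partial_deriv smooth_on_add smooth_on_cmult) auto
      show "smooth_on U (\<lambda>x. a * partial_deriv j f x + b * partial_deriv j g x)"
        using fg U by (intro smooth_on_partial_deriv smooth_on_add smooth_on_cmult) auto
      show "partial_deriv j (\<lambda>x. a * f x + b * g x) x = a * partial_deriv j f x + b * partial_deriv j g x"
        if "x \<in> U" for x
        using derivs_add[OF U smooth_on_cmult[OF U fg(1)] smooth_on_cmult[OF U fg(2)] that, of "[j]"]
          derivs_cmult[OF U fg(1) that, of "[j]"] derivs_cmult[OF U fg(2) that, of "[j]"] by simp
    qed
    then show "T (partial_deriv j (\<lambda>x. a * f x + b * g x)) = a * T (partial_deriv j f) + b * T (partial_deriv j g)"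
      using smooth_functional_linear[OF T smooth_on_partial_deriv[OF fg(1)] smooth_on_partial_deriv[OF fg(2)]] by simp
  next
    fix f B assume f: "smooth_on U f" "B \<ge> 0" "\<And>js x. length js \<le> Suc N \<Longrightarrow> x \<in> K \<Longrightarrow> cmod (derivs js f x) \<le> B"
    show "cmod (T (partial_deriv j f)) \<le> C * B"
      by (rule C(2)[OF smooth_on_partial_deriv[OF f(1)] f(2)]) (use f(3)[of "_ @ [j]"] in simp)
  qed
qed

lemma smooth_functional_derivs:
  assumes "smooth_functional U K T" "open U"
  shows "smooth_functional U K (\<lambda>f. T (derivs js f))"
  using assms(1)
proof (induction js arbitrary: T)
  case (Cons j js)
  show ?case using Cons.IH[OF smooth_functional_partial_deriv[OF Cons.prems assms(2), of j]] by simp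
qed simp

lemma smooth_functional_combination:
  assumes T: "smooth_functional U K T" and S: "smooth_functional U L S"
  shows "smooth_functional U (K \<union> L) (\<lambda>f. a * T f + b * S f)"
proof -
  obtain C N where C: "C \<ge> 0" "\<And>f B. smooth_on U f \<Longrightarrow> B \<ge> 0 \<Longrightarrow>
        (\<And>js x. length js \<le> N \<Longrightarrow> x \<in> K \<Longrightarrow> cmod (derivs js f x) \<le> B) \<Longrightarrow> cmod (T f) \<le> C * B"
    using smooth_functional_bound[OF T] by metis
  obtain D M where D: "D \<ge> 0" "\<And>f B. smooth_on U f \<Longrightarrow> B \<ge> 0 \<Longrightarrow>
        (\<And>js x. length js \<le> M \<Longrightarrow> x \<in> L \<Longrightarrow> cmod (derivs js f x) \<le> B) \<Longrightarrow> cmod (S f) \<le> D * B"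
    using smooth_functional_bound[OF S] by metis
  show ?thesis
  proof (rule smooth_functionalI[of _ _ _ "cmod a * C + cmod b * D" "max M N"])
    fix f g c d assume fg: "smooth_on U f" "smooth_on U g"
    show "a * T (\<lambda>x. c * f x + d * g x) + b * S (\<lambda>x. c * f x + d * g x) =
        c * (a * T f + b * S f) + d * (a * T g + b * S g)"
      by (simp add: smooth_functional_linear[OF T fg] smooth_functional_linear[OF S fg] algebra_simps)
  next
    fix f B assume f: "smooth_on U f" "B \<ge> 0" "\<And>js x. length js \<le> max M N \<Longrightarrow> x \<in> K \<union> L \<Longrightarrow> cmod (derivs js f x) \<le> B"
    have "cmod (a * T f + b * S f) \<le> cmod a * cmod (T f) + cmod b * cmod (S f)"
      by (rule order_trans[OF norm_triangle_ineq]) (simp add: norm_mult)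
    also have "\<dots> \<le> cmod a * (C * B) + cmod b * (D * B)"
      by (intro add_mono mult_left_mono C(2)[OF f(1,2)] D(2)[OF f(1,2)] f(3)) auto
    finally show "cmod (a * T f + b * S f) \<le> (cmod a * C + cmod b * D) * B"
      by (simp add: algebra_simps)
  qed (use smooth_functional_compact[OF T] smooth_functional_compact[OF S]
      smooth_functional_subset[OF T] smooth_functional_subset[OF S] C D in auto)
qed

lemma smooth_functional_0: "smooth_functional U {} (\<lambda>f. 0)"
  by (rule smooth_functionalI[of _ _ _ 0 0]) auto

lemma smooth_functional_finite_sum:
  assumes "\<And>i. i \<in> I \<Longrightarrow> smooth_functional U (K i) (T i)" "finite I"
  shows "smooth_functional U (\<Union>i\<in>I. K i) (\<lambda>f. \<Sum>i\<in>I. c i * T i f)"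
  using assms(2,1)
proof (induction I rule: finite_induct)
  case (insert i I)
  then show ?case using smooth_functional_combination[of U "K i" "T i" "\<Union>i\<in>I. K i" "\<lambda>f. \<Sum>i\<in>I. c i * T i f" "c i" 1] by simp
qed (simp add: smooth_functional_0)

subsection \<open>Multiplication by smooth functions\<close>

lemma leibniz_bound:
  fixes a :: "real^'n::finite \<Rightarrow> complex"
  assumes W: "open W" and K: "compact K" "K \<subseteq> W" and a: "smooth_on W a"
  shows "\<exists>C\<ge>0. \<forall>f B. smooth_on W f \<longrightarrow> B \<ge> 0 \<longrightarrow> (\<forall>js x. length js \<le> N \<longrightarrow> x \<in> K \<longrightarrow> cmod (derivs js f x) \<le> B) \<longrightarrow>
     (\<forall>js x. length js \<le> N \<longrightarrow> x \<in> K \<longrightarrow> cmod (derivs js (\<lambda>x. a x * f x) x) \<le> C * B)"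
  using a
proof (induction N arbitrary: a)
  case 0
  have "compact (a ` K)"
    using continuous_on_subset[OF smooth_on_continuous[OF 0] K(2)] K(1) by (rule compact_continuous_image)
  from compact_imp_bounded[OF this] obtain A where A: "\<And>x. x \<in> K \<Longrightarrow> cmod (a x) \<le> A"
    unfolding bounded_iff by blast
  have "cmod (a x * f x) \<le> max A 0 * B" if "x \<in> K" "B \<ge> 0" "cmod (f x) \<le> B" for x f B
    unfolding norm_mult using A[OF that(1)] that by (intro mult_mono) auto
  then show ?case by (intro exI[of _ "max A 0"]) auto
next
  case (Suc N)
  obtain C where C: "C \<ge> 0" "\<And>f B js x. smooth_on W f \<Longrightarrow> B \<ge> 0 \<Longrightarrow>
      (\<And>js x. length js \<le> N \<Longrightarrow> x \<in> K \<Longrightarrow> cmod (derivs js f x) \<le> B) \<Longrightarrow>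
      length js \<le> N \<Longrightarrow> x \<in> K \<Longrightarrow> cmod (derivs js (\<lambda>x. a x * f x) x) \<le> C * B"
    using Suc.IH[OF Suc.prems] by meson
  have "\<forall>j. \<exists>C\<ge>0. \<forall>f B. smooth_on W f \<longrightarrow> B \<ge> 0 \<longrightarrow>
      (\<forall>js x. length js \<le> N \<longrightarrow> x \<in> K \<longrightarrow> cmod (derivs js f x) \<le> B) \<longrightarrow>
      (\<forall>js x. length js \<le> N \<longrightarrow> x \<in> K \<longrightarrow> cmod (derivs js (\<lambda>x. partial_deriv j a x * f x) x) \<le> C * B)"
    using Suc.IH[OF smooth_on_partial_deriv[OF Suc.prems]] by blast
  from choice[OF this] obtain D where D: "\<And>j. D j \<ge> 0" "\<And>j f B js x. smooth_on W f \<Longrightarrow> B \<ge> 0 \<Longrightarrow>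
      (\<And>js x. length js \<le> N \<Longrightarrow> x \<in> K \<Longrightarrow> cmod (derivs js f x) \<le> B) \<Longrightarrow>
      length js \<le> N \<Longrightarrow> x \<in> K \<Longrightarrow> cmod (derivs js (\<lambda>x. partial_deriv j a x * f x) x) \<le> D j * B"
    by meson
  have S0: "sum D UNIV \<ge> 0" and DS: "D j \<le> sum D UNIV" for j
    using D(1) by (auto intro: sum_nonneg member_le_sum)
  show ?case
  proof (intro exI[of _ "C + sum D UNIV"] conjI allI impI)
    show "0 \<le> C + sum D UNIV" using C(1) S0 by simp
    fix f :: "real^'n \<Rightarrow> complex" and B and js :: "'n list" and x
    assume f: "smooth_on W f" "0 \<le> B"
      "\<forall>js x. length js \<le> Suc N \<longrightarrow> x \<in> K \<longrightarrow> cmod (derivs js f x) \<le> B"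
      and js: "length js \<le> Suc N" and x: "x \<in> K"
    show "cmod (derivs js (\<lambda>x. a x * f x) x) \<le> (C + sum D UNIV) * B"
    proof (cases js rule: rev_cases)
      case Nil
      have "cmod (derivs js (\<lambda>x. a x * f x) x) \<le> C * B" by (rule C(2)) (use f js x Nil in auto)
      also have "\<dots> \<le> (C + sum D UNIV) * B" using S0 f by (intro mult_right_mono) auto
      finally show ?thesis .
    next
      case (snoc ks j)
      have xW: "x \<in> W" using x K by auto
      have ks: "length ks \<le> N" using js snoc by simp
      have s: "smooth_on W (\<lambda>x. partial_deriv j a x * f x)" "smooth_on W (\<lambda>x. a x * partial_deriv j f x)"
        using f(1) Suc.prems by (auto intro!: smooth_on_mult W smooth_on_partial_deriv)
      have "derivs js (\<lambda>x. a x * f x) x = derivs ks (\<lambda>x. partial_deriv j a x * f x + a x * partial_deriv j f x) x"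
        unfolding snoc derivs_snoc
        by (rule derivs_cong[OF W xW], rule partial_deriv_mult[OF W])
          (use f(1) Suc.prems smooth_on_imp_differentiable in auto)
      also have "\<dots> = derivs ks (\<lambda>x. partial_deriv j a x * f x) x + derivs ks (\<lambda>x. a x * partial_deriv j f x) x"
        by (rule derivs_add[OF W s xW])
      also have "cmod \<dots> \<le> D j * B + C * B"
      proof (rule order_trans[OF norm_triangle_ineq add_mono])
        show "cmod (derivs ks (\<lambda>x. partial_deriv j a x * f x) x) \<le> D j * B"
          by (rule D(2)[OF f(1,2) _ ks x]) (use f(3) in auto)
        have "cmod (derivs ls (partial_deriv j f) y) \<le> B" if "length ls \<le> N" "y \<in> K" for ls y
          using f(3)[rule_format, of "ls @ [j]" y] that by simp
        then show "cmod (derivs ks (\<lambda>x. a x * partial_deriv j f x) x) \<le> C * B"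
          by (rule C(2)[OF smooth_on_partial_deriv[OF f(1)] f(2) _ ks x])
      qed
      also have "\<dots> \<le> (C + sum D UNIV) * B"
        using mult_right_mono[OF DS[of j] f(2)] by (simp add: algebra_simps)
      finally show ?thesis .
    qed
  qed
qed

lemma smooth_on_mult_cutoff:
  assumes "open U" "open V" "smooth_on U a" "fun_support a \<inter> U \<subseteq> V" "smooth_on V f"
  shows "smooth_on U (\<lambda>x. a x * f x)"
proof -
  have 1: "smooth_on (U \<inter> V) (\<lambda>x. a x * f x)"
    by (rule smooth_on_mult) (use assms smooth_on_subset[OF assms(3)] smooth_on_subset[OF assms(5)] in auto)
  have 2: "smooth_on (- fun_support a) (\<lambda>x. a x * f x)"
    by (rule smooth_on_cong[OF open_compl_support, of _ "\<lambda>x. 0"]) (auto simp: fun_support_zero)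
  have "U \<subseteq> U \<inter> V \<union> - fun_support a" using assms(4) by auto
  then show ?thesis
    using smooth_on_union[OF _ open_compl_support 1 2] assms(1,2) smooth_on_subset by blast
qed

lemma smooth_functional_mult:
  assumes T: "smooth_functional U K T" and U: "open U" and V: "open V" and a: "smooth_on U a"
    and s: "fun_support a \<inter> U \<subseteq> V"
  shows "smooth_functional V (K \<inter> fun_support a) (\<lambda>f. T (\<lambda>x. a x * f x))"
proof -
  obtain C N where C: "C \<ge> 0" "\<And>f B. smooth_on U f \<Longrightarrow> B \<ge> 0 \<Longrightarrow>
        (\<And>js x. length js \<le> N \<Longrightarrow> x \<in> K \<Longrightarrow> cmod (derivs js f x) \<le> B) \<Longrightarrow> cmod (T f) \<le> C * B"
    using smooth_functional_bound[OF T] by metis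
  note KU = smooth_functional_subset[OF T]
  have K': "compact (K \<inter> fun_support a)" "K \<inter> fun_support a \<subseteq> U \<inter> V" and W: "open (U \<inter> V)"
    using smooth_functional_compact[OF T] KU s U V by (auto intro: compact_Int_closed closed_fun_support)
  have "smooth_on (U \<inter> V) a" using a by (rule smooth_on_subset) auto
  from leibniz_bound[OF W K' this, of N] obtain D where D: "D \<ge> 0" "\<And>f B js x. smooth_on (U \<inter> V) f \<Longrightarrow> B \<ge> 0 \<Longrightarrow>
      (\<And>js x. length js \<le> N \<Longrightarrow> x \<in> K \<inter> fun_support a \<Longrightarrow> cmod (derivs js f x) \<le> B) \<Longrightarrow>
      length js \<le> N \<Longrightarrow> x \<in> K \<inter> fun_support a \<Longrightarrow> cmod (derivs js (\<lambda>x. a x * f x) x) \<le> D * B"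
    by meson
  show ?thesis
  proof (rule smooth_functionalI[of _ _ _ "C * D" N])
    show "compact (K \<inter> fun_support a)" by (rule K')
    show "K \<inter> fun_support a \<subseteq> V" using K' by auto
    show "C * D \<ge> 0" using C D by simp
    fix f g c d assume fg: "smooth_on V f" "smooth_on V g"
    have "(\<lambda>x. a x * (c * f x + d * g x)) = (\<lambda>x. c * (a x * f x) + d * (a x * g x))"
      by (simp add: algebra_simps)
    then show "T (\<lambda>x. a x * (c * f x + d * g x)) = c * T (\<lambda>x. a x * f x) + d * T (\<lambda>x. a x * g x)"
      using smooth_functional_linear[OF T smooth_on_mult_cutoff[OF U V a s fg(1)] smooth_on_mult_cutoff[OF U V a s fg(2)]] by simp
  next
    fix f B assume f: "smooth_on V f" "B \<ge> 0"
      "\<And>js x. length js \<le> N \<Longrightarrow> x \<in> K \<inter> fun_support a \<Longrightarrow> cmod (derivs js f x) \<le> B"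
    have fW: "smooth_on (U \<inter> V) f" using f(1) by (rule smooth_on_subset) auto
    have "cmod (T (\<lambda>x. a x * f x)) \<le> C * (D * B)"
    proof (rule C(2)[OF smooth_on_mult_cutoff[OF U V a s f(1)]])
      show "0 \<le> D * B" using D f by simp
      fix js :: "'a list" and x assume js: "length js \<le> N" and x: "x \<in> K"
      show "cmod (derivs js (\<lambda>x. a x * f x) x) \<le> D * B"
      proof (cases "x \<in> fun_support a")
        case True
        then show ?thesis using x by (intro D(2)[OF fW f(2) f(3) js]) auto
      next
        case False
        then have "x \<notin> fun_support (\<lambda>x. a x * f x)" using fun_support_mult[of a f] by auto
        then show ?thesis using derivs_zero_off_support[of x "\<lambda>x. a x * f x" js] D(1) f(2) by simp
      qed
    qed
    then show "cmod (T (\<lambda>x. a x * f x)) \<le> C * D * B" by (simp add: mult.assoc)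
  qed
qed

text \<open>A functional on all smooth functions only depends on what happens near its support, where
  every smooth function agrees with a test function.\<close>

lemma smooth_functional_eq_0_if_test:
  assumes T: "smooth_functional UNIV K T" and "\<And>\<phi>. \<phi> \<in> test_functions \<Longrightarrow> T \<phi> = 0" and f: "smooth_on UNIV f"
  shows "T f = 0"
proof -
  obtain \<kappa> W where k: "\<kappa> \<in> test_functions" "open W" "K \<subseteq> W" "\<And>x. x \<in> W \<Longrightarrow> \<kappa> x = 1"
    using cutoff_exists[OF smooth_functional_compact[OF T] open_UNIV subset_UNIV] by metis
  have t: "(\<lambda>x. f x * \<kappa> x) \<in> test_functions" by (rule test_mult[OF f k(1)])
  have "T f = T (\<lambda>x. f x * \<kappa> x)"
    by (rule smooth_functional_cong[OF T open_UNIV f test_smooth[OF t] k(2,3)]) (simp add: k(4))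
  then show ?thesis using assms(2)[OF t] by simp
qed

subsection \<open>The pairing with a compactly supported distribution\<close>

lemma distribution_linear:
  assumes "u \<in> distributions" "\<phi> \<in> test_functions" "\<psi> \<in> test_functions"
  shows "u (\<lambda>x. a * \<phi> x + b * \<psi> x) = a * u \<phi> + b * u \<psi>"
  using assms unfolding distributions_def linear_functional_on_def by simp

lemma distribution_diff:
  assumes "u \<in> distributions" "\<phi> \<in> test_functions" "\<psi> \<in> test_functions"
  shows "u (\<lambda>x. \<phi> x - \<psi> x) = u \<phi> - u \<psi>"
  using distribution_linear[OF assms, of 1 "-1"] by simp

lemma distribution_zero: "u \<in> distributions \<Longrightarrow> u (\<lambda>x. 0) = 0"
  using distribution_linear[of u "\<lambda>x. 0" "\<lambda>x. 0" 0 0] test_zero by simp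

text \<open>The support is defined by open sets on which \<open>u\<close> vanishes one at a time. That \<open>u\<close> vanishes
  on their union needs a decomposition of \<open>\<phi>\<close>: with cut-offs \<open>\<kappa>\<^sub>i\<close> supported in the single
  sets and such that every point of the support of \<open>\<phi>\<close> has some \<open>\<kappa>\<^sub>i = 1\<close>, the product
  \<open>\<phi> \<Prod>(1 - \<kappa>\<^sub>i)\<close> is zero, and adding one factor changes \<open>\<phi> \<Prod>(1 - \<kappa>\<^sub>i)\<close> by a
  function supported in a single set.\<close>

lemma distribution_zero_off_support:
  assumes u: "u \<in> distributions" and \<phi>: "\<phi> \<in> test_functions" and disj: "fun_support \<phi> \<inter> dist_support u = {}"
  shows "u \<phi> = 0"
proof -
  define \<W> where "\<W> = {W. open W \<and> dist_eq_on W u (\<lambda>_. 0)}"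
  define G where "G = (\<lambda>(\<kappa>, X). \<kappa> \<in> test_functions \<and> (\<exists>W\<in>\<W>. fun_support \<kappa> \<subseteq> W) \<and> open X \<and> (\<forall>x\<in>X. \<kappa> x = (1::complex)))"
  have "\<exists>p. G p \<and> x \<in> snd p" if "x \<in> fun_support \<phi>" for x
  proof -
    have "x \<notin> dist_support u" using that disj by auto
    then obtain W where W: "W \<in> \<W>" "x \<in> W" unfolding dist_support_def \<W>_def by auto
    have "compact {x}" "open W" "{x} \<subseteq> W" using W by (auto simp: \<W>_def)
    from cutoff_exists[OF this] obtain \<kappa> X where "\<kappa> \<in> test_functions" "fun_support \<kappa> \<subseteq> W" "open X" "{x} \<subseteq> X"
      "\<And>x. x \<in> X \<Longrightarrow> \<kappa> x = 1" by metis
    then have "G (\<kappa>, X) \<and> x \<in> snd (\<kappa>, X)" using W(1) by (auto simp: G_def)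
    then show ?thesis by blast
  qed
  then have cover: "fun_support \<phi> \<subseteq> (\<Union>p\<in>Collect G. snd p)" by fast
  have opn: "\<And>p. p \<in> Collect G \<Longrightarrow> open (snd p)" by (auto simp: G_def)
  obtain \<C> where \<C>: "\<C> \<subseteq> Collect G" "finite \<C>" "fun_support \<phi> \<subseteq> (\<Union>p\<in>\<C>. snd p)"
    by (rule compactE_image[OF test_compact[OF \<phi>] opn cover])
  have sm: "smooth_on UNIV (\<lambda>x. \<Prod>p\<in>\<D>. (1 - fst p x))" if "\<D> \<subseteq> Collect G" for \<D>
    by (rule smooth_on_prod, simp, rule smooth_on_diff) (use that in \<open>auto simp: G_def test_smooth\<close>)
  have "u (\<lambda>x. (\<Prod>p\<in>\<D>. (1 - fst p x)) * \<phi> x) = u \<phi>" if "finite \<D>" "\<D> \<subseteq> Collect G" for \<D>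
    using that
  proof (induction \<D> rule: finite_induct)
    case (insert p \<D>)
    let ?P = "\<lambda>x. \<Prod>p\<in>\<D>. (1 - fst p x)"
    have Gp: "G p" and DG: "\<D> \<subseteq> Collect G" using insert.prems by auto
    have t1: "(\<lambda>x. ?P x * \<phi> x) \<in> test_functions" by (rule test_mult[OF sm[OF DG] \<phi>])
    have pt: "fst p \<in> test_functions" using Gp by (auto simp: G_def)
    have t2: "(\<lambda>x. fst p x * (?P x * \<phi> x)) \<in> test_functions" by (rule test_mult[OF test_smooth[OF pt] t1])
    obtain W where W: "W \<in> \<W>" "fun_support (fst p) \<subseteq> W" using Gp by (auto simp: G_def)
    have "fun_support (\<lambda>x. fst p x * (?P x * \<phi> x)) \<subseteq> W"
      using fun_support_mult[of "fst p" "\<lambda>x. ?P x * \<phi> x"] W(2) by auto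
    then have z: "u (\<lambda>x. fst p x * (?P x * \<phi> x)) = 0"
      using W(1) t2 by (auto simp: \<W>_def dist_eq_on_def)
    have eq: "(\<lambda>x. (\<Prod>p\<in>insert p \<D>. (1 - fst p x)) * \<phi> x) = (\<lambda>x. 1 * (?P x * \<phi> x) + (-1) * (fst p x * (?P x * \<phi> x)))"
      using insert.hyps by (simp add: algebra_simps)
    show ?case
      unfolding eq distribution_linear[OF u t1 t2] using z insert.IH[OF DG] by simp
  qed simp
  from this[OF \<C>(2,1)] have "u \<phi> = u (\<lambda>x. (\<Prod>p\<in>\<C>. (1 - fst p x)) * \<phi> x)" by simp
  also have "(\<lambda>x. (\<Prod>p\<in>\<C>. (1 - fst p x)) * \<phi> x) = (\<lambda>x. 0)"
  proof
    fix x
    show "(\<Prod>p\<in>\<C>. (1 - fst p x)) * \<phi> x = 0"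
    proof (cases "x \<in> fun_support \<phi>")
      case True
      then obtain p where p: "p \<in> \<C>" "x \<in> snd p" using \<C>(3) by auto
      then have "1 - fst p x = 0" using \<C>(1) by (auto simp: G_def)
      then have "(\<Prod>p\<in>\<C>. (1 - fst p x)) = 0" using p(1) \<C>(2) prod_zero[of \<C> "\<lambda>p. 1 - fst p x"] by blast
      then show ?thesis by simp
    qed (simp add: fun_support_zero)
  qed
  finally show ?thesis using distribution_zero[OF u] by simp
qed

lemma closed_dist_support: "closed (dist_support u)"
  unfolding dist_support_def closed_def by auto

lemma compact_pairing_eq:
  assumes u: "u \<in> compact_distributions" and \<kappa>: "\<kappa> \<in> test_functions"
    and W: "open W" "dist_support u \<subseteq> W" "\<And>x. x \<in> W \<Longrightarrow> \<kappa> x = 1" and g: "smooth_on UNIV g"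
  shows "compact_pairing u g = u (\<lambda>x. \<kappa> x * g x)"
proof -
  have ud: "u \<in> distributions" using u by (simp add: compact_distributions_def)
  have eq: "u (\<lambda>x. \<kappa>' x * g x) = u (\<lambda>x. \<kappa> x * g x)"
    if \<kappa>': "\<kappa>' \<in> test_functions" "open W'" "dist_support u \<subseteq> W'" "\<forall>x\<in>W'. \<kappa>' x = 1" for \<kappa>' W'
  proof -
    have t: "(\<lambda>x. \<kappa>' x * g x) \<in> test_functions" "(\<lambda>x. \<kappa> x * g x) \<in> test_functions"
      using test_mult[OF g \<kappa>'(1)] test_mult[OF g \<kappa>] by (simp_all add: mult.commute)
    have d: "(\<lambda>x. \<kappa>' x * g x - \<kappa> x * g x) \<in> test_functions" by (rule test_diff[OF t])
    have "fun_support (\<lambda>x. \<kappa>' x * g x - \<kappa> x * g x) \<subseteq> - (W \<inter> W')"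
      using \<kappa>'(2,4) W(1,3) by (intro fun_support_subset) (auto simp: open_Int)
    then have "u (\<lambda>x. \<kappa>' x * g x - \<kappa> x * g x) = 0"
      by (intro distribution_zero_off_support[OF ud d]) (use W(2) \<kappa>'(3) in auto)
    then show ?thesis using distribution_diff[OF ud t] by simp
  qed
  show ?thesis
    unfolding compact_pairing_def
  proof (rule the_equality)
    show "\<forall>\<kappa>'\<in>test_functions. (\<exists>W. open W \<and> dist_support u \<subseteq> W \<and> (\<forall>x\<in>W. \<kappa>' x = 1)) \<longrightarrow>
        u (\<lambda>x. \<kappa>' x * g x) = u (\<lambda>x. \<kappa> x * g x)"
      using eq by blast
    fix c assume "\<forall>\<kappa>\<in>test_functions. (\<exists>W. open W \<and> dist_support u \<subseteq> W \<and> (\<forall>x\<in>W. \<kappa> x = 1)) \<longrightarrow>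
        u (\<lambda>x. \<kappa> x * g x) = c"
    then show "c = u (\<lambda>x. \<kappa> x * g x)" using \<kappa> W by metis
  qed
qed

lemma distribution_bound:
  assumes u: "u \<in> distributions" and K: "compact K"
  obtains C N where "C \<ge> 0" "\<And>\<phi> B. \<phi> \<in> test_functions \<Longrightarrow> fun_support \<phi> \<subseteq> K \<Longrightarrow> B \<ge> 0 \<Longrightarrow>
    (\<And>js x. length js \<le> N \<Longrightarrow> cmod (derivs js \<phi> x) \<le> B) \<Longrightarrow> cmod (u \<phi>) \<le> C * B"
proof -
  obtain C N where C: "\<forall>\<phi>\<in>test_functions. fun_support \<phi> \<subseteq> K \<longrightarrow>
      cmod (u \<phi>) \<le> C * (\<Sum>\<alpha> | sum \<alpha> UNIV \<le> N. SUP x. cmod (multi_deriv \<alpha> \<phi> x))"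
    using u K unfolding distributions_def by blast
  define M where "M = card {\<alpha> :: 'a \<Rightarrow> nat. sum \<alpha> UNIV \<le> N}"
  have "cmod (u \<phi>) \<le> (\<bar>C\<bar> * real M) * B"
    if \<phi>: "\<phi> \<in> test_functions" "fun_support \<phi> \<subseteq> K" "B \<ge> 0" "\<And>js x. length js \<le> N \<Longrightarrow> cmod (derivs js \<phi> x) \<le> B" for \<phi> B
  proof -
    let ?S = "\<lambda>\<alpha>. SUP x. cmod (multi_deriv \<alpha> \<phi> x)"
    have S: "0 \<le> ?S \<alpha>" "?S \<alpha> \<le> B" if "sum \<alpha> UNIV \<le> N" for \<alpha> :: "'a \<Rightarrow> nat"
    proof -
      have b: "cmod (multi_deriv \<alpha> \<phi> x) \<le> B" for x
        using \<phi>(4) that by (simp add: multi_deriv_index_list length_index_list)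
      then show "?S \<alpha> \<le> B" by (intro cSUP_least) auto
      have "cmod (multi_deriv \<alpha> \<phi> 0) \<le> ?S \<alpha>"
        by (rule cSUP_upper) (use b in \<open>auto simp: bdd_above_def\<close>)
      then show "0 \<le> ?S \<alpha>" using norm_ge_zero order_trans by blast
    qed
    have "cmod (u \<phi>) \<le> C * (\<Sum>\<alpha> | sum \<alpha> UNIV \<le> N. ?S \<alpha>)" using C \<phi>(1,2) by blast
    also have "\<dots> \<le> \<bar>C\<bar> * (\<Sum>\<alpha> | sum \<alpha> UNIV \<le> N. ?S \<alpha>)"
      by (intro mult_right_mono sum_nonneg) (use S in auto)
    also have "\<dots> \<le> \<bar>C\<bar> * (\<Sum>\<alpha> :: 'a \<Rightarrow> nat | sum \<alpha> UNIV \<le> N. B)"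
      by (intro mult_left_mono sum_mono) (use S in auto)
    also have "\<dots> = (\<bar>C\<bar> * real M) * B" by (simp add: M_def)
    finally show ?thesis .
  qed
  then show ?thesis using that[of "\<bar>C\<bar> * real M" N] by simp
qed

lemma smooth_functional_compact_pairing:
  fixes u :: "'n::finite functional"
  assumes u: "u \<in> compact_distributions"
  obtains K where "smooth_functional UNIV K (compact_pairing u)"
proof -
  have ud: "u \<in> distributions" and c: "compact (dist_support u)"
    using u by (auto simp: compact_distributions_def)
  obtain \<kappa> W where \<kappa>: "\<kappa> \<in> test_functions" "open W" "dist_support u \<subseteq> W" "\<And>x. x \<in> W \<Longrightarrow> \<kappa> x = 1"
    using cutoff_exists[OF c open_UNIV subset_UNIV] by metis
  have eq: "compact_pairing u f = u (\<lambda>x. \<kappa> x * f x)" if "smooth_on UNIV f" for f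
    by (rule compact_pairing_eq[OF u \<kappa> that])
  let ?K = "fun_support \<kappa>"
  have K: "compact ?K" by (rule test_compact[OF \<kappa>(1)])
  have t: "(\<lambda>x. \<kappa> x * f x) \<in> test_functions" if "smooth_on UNIV f" for f
    using test_mult[OF that \<kappa>(1)] by (simp add: mult.commute)
  obtain C N where C: "C \<ge> 0" "\<And>\<phi> B. \<phi> \<in> test_functions \<Longrightarrow> fun_support \<phi> \<subseteq> ?K \<Longrightarrow> B \<ge> 0 \<Longrightarrow>
    (\<And>js x. length js \<le> N \<Longrightarrow> cmod (derivs js \<phi> x) \<le> B) \<Longrightarrow> cmod (u \<phi>) \<le> C * B"
    using distribution_bound[OF ud K] by metis
  from leibniz_bound[OF open_UNIV K subset_UNIV test_smooth[OF \<kappa>(1)], of N]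
  obtain D where D: "D \<ge> 0" "\<And>f B js x. smooth_on UNIV f \<Longrightarrow> B \<ge> 0 \<Longrightarrow>
      (\<And>js x. length js \<le> N \<Longrightarrow> x \<in> ?K \<Longrightarrow> cmod (derivs js f x) \<le> B) \<Longrightarrow>
      length js \<le> N \<Longrightarrow> x \<in> ?K \<Longrightarrow> cmod (derivs js (\<lambda>x. \<kappa> x * f x) x) \<le> D * B"
    by meson
  have "smooth_functional UNIV ?K (compact_pairing u)"
  proof (rule smooth_functionalI[OF K subset_UNIV, of _ "C * D" N])
    show "C * D \<ge> 0" using C D by simp
    fix f g :: "real^'n \<Rightarrow> complex" and a b assume fg: "smooth_on UNIV f" "smooth_on UNIV g"
    have "(\<lambda>x. \<kappa> x * (a * f x + b * g x)) = (\<lambda>x. a * (\<kappa> x * f x) + b * (\<kappa> x * g x))"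
      by (simp add: algebra_simps)
    moreover have "smooth_on UNIV (\<lambda>x. a * f x + b * g x)" using fg by (intro smooth_on_add smooth_on_cmult) auto
    ultimately show "compact_pairing u (\<lambda>x. a * f x + b * g x) = a * compact_pairing u f + b * compact_pairing u g"
      using eq fg distribution_linear[OF ud t[OF fg(1)] t[OF fg(2)]] by simp
  next
    fix f B assume f: "smooth_on UNIV f" "B \<ge> 0" "\<And>js x. length js \<le> N \<Longrightarrow> x \<in> ?K \<Longrightarrow> cmod (derivs js f x) \<le> B"
    have sub: "fun_support (\<lambda>x. \<kappa> x * f x) \<subseteq> ?K" using fun_support_mult[of \<kappa> f] by auto
    have "cmod (u (\<lambda>x. \<kappa> x * f x)) \<le> C * (D * B)"
    proof (rule C(2)[OF t[OF f(1)] sub])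
      show "0 \<le> D * B" using D f by simp
      show "cmod (derivs js (\<lambda>x. \<kappa> x * f x) x) \<le> D * B" if js: "length js \<le> N" for js x
      proof (cases "x \<in> ?K")
        case True
        then show ?thesis by (intro D(2)[OF f js]) auto
      next
        case False
        then have "x \<notin> fun_support (\<lambda>x. \<kappa> x * f x)" using sub by blast
        from derivs_zero_off_support[OF this, of js] show ?thesis using D(1) f(2) by simp
      qed
    qed
    then show "cmod (compact_pairing u f) \<le> C * D * B" using eq[OF f(1)] by (simp add: mult.assoc)
  qed
  then show ?thesis by (rule that)
qed

lemma compact_pairing_test:
  assumes u: "u \<in> compact_distributions" and \<phi>: "\<phi> \<in> test_functions"
  shows "compact_pairing u \<phi> = u \<phi>"
proof -
  have ud: "u \<in> distributions" and c: "compact (dist_support u)"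
    using u by (auto simp: compact_distributions_def)
  have c2: "compact (dist_support u \<union> fun_support \<phi>)" using c test_compact[OF \<phi>] by auto
  obtain \<kappa> W where \<kappa>: "\<kappa> \<in> test_functions" "open W" "dist_support u \<union> fun_support \<phi> \<subseteq> W" "\<And>x. x \<in> W \<Longrightarrow> \<kappa> x = 1"
    using cutoff_exists[OF c2 open_UNIV subset_UNIV] by metis
  have "compact_pairing u \<phi> = u (\<lambda>x. \<kappa> x * \<phi> x)"
    by (rule compact_pairing_eq[OF u \<kappa>(1,2) _ \<kappa>(4) test_smooth[OF \<phi>]]) (use \<kappa>(3) in auto)
  also have "(\<lambda>x. \<kappa> x * \<phi> x) = \<phi>"
  proof
    show "\<kappa> x * \<phi> x = \<phi> x" for x
      using \<kappa>(3,4) by (cases "x \<in> fun_support \<phi>") (auto simp: fun_support_zero)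
  qed
  finally show ?thesis .
qed

section \<open>A Poincare lemma with compact supports\<close>

text \<open>The antiderivative in direction \<open>i\<close> that vanishes towards \<open>-\<infinity>\<close>, see
  \<open>ray_integral_partial_deriv\<close>.\<close>

definition ray_integral :: "'n::finite \<Rightarrow> (real^'n \<Rightarrow> complex) \<Rightarrow> real^'n \<Rightarrow> complex" where
  "ray_integral i = translation_integral lborel (\<lambda>t. - (t *\<^sub>R axis i 1)) (indicator {0..})"

lemma ray_kernel: "translation_kernel lborel (\<lambda>t::real. - (t *\<^sub>R axis i 1) :: real^'n::finite) (indicator {0..})"
  unfolding translation_kernel_def
proof (intro conjI allI impI)
  have m [measurable]: "(\<lambda>t. - (t *\<^sub>R axis i 1) :: real^'n) \<in> borel_measurable borel"
    by (intro borel_measurable_continuous_onI continuous_intros)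
  show "(\<lambda>t. - (t *\<^sub>R axis i 1) :: real^'n) \<in> borel_measurable lborel" using m by simp
  fix K :: "(real^'n) set" assume K: "compact K"
  obtain r where r: "\<And>x. x \<in> K \<Longrightarrow> norm x \<le> r"
    using compact_imp_bounded[OF K] unfolding bounded_iff by blast
  have [measurable]: "K \<in> sets borel" using K by (simp add: borel_compact)
  have [measurable]: "(\<lambda>t. - (t *\<^sub>R axis i 1) :: real^'n) \<in> borel_measurable borel"
    by (intro borel_measurable_continuous_onI continuous_intros)
  show "integrable lborel (\<lambda>t. indicator K (- (t *\<^sub>R axis i 1)) * cmod (indicator {0..} t))"
  proof (rule Bochner_Integration.integrable_bound[of _ "indicator {0..r} :: real \<Rightarrow> real"])
    show "integrable lborel (indicator {0..r} :: real \<Rightarrow> real)"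
      by (cases "0 \<le> r") (auto simp: integrable_indicator_iff)
    show "AE t in lborel. norm (indicator K (- (t *\<^sub>R axis i 1)) * cmod (indicator {0..} t)) \<le> norm (indicator {0..r} t :: real)"
      using r by (intro AE_I2) (force simp: indicator_def)
  qed measurable
qed (auto)

lemma smooth_ray_integral: "\<eta> \<in> test_functions \<Longrightarrow> smooth_on UNIV (ray_integral i \<eta>)"
  unfolding ray_integral_def by (rule smooth_translation_integral[OF ray_kernel])

lemma derivs_ray_integral:
  "\<eta> \<in> test_functions \<Longrightarrow> derivs js (ray_integral i \<eta>) = ray_integral i (derivs js \<eta>)"
  unfolding ray_integral_def by (rule derivs_translation_integral[OF ray_kernel])

lemma partial_deriv_ray_integral:
  "\<eta> \<in> test_functions \<Longrightarrow> partial_deriv j (ray_integral i \<eta>) = ray_integral i (partial_deriv j \<eta>)"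
  unfolding ray_integral_def by (rule partial_deriv_translation_integral[OF ray_kernel])

lemma ray_integral_partial_deriv:
  fixes \<eta> :: "real^'n::finite \<Rightarrow> complex"
  assumes \<eta>: "\<eta> \<in> test_functions"
  shows "ray_integral i (partial_deriv i \<eta>) = \<eta>"
proof
  fix x :: "real^'n"
  obtain r where r: "\<And>x. x \<in> fun_support \<eta> \<Longrightarrow> norm x \<le> r"
    using compact_imp_bounded[OF test_compact[OF \<eta>]] unfolding bounded_iff by blast
  define s where "s = \<bar>r\<bar> + norm x + 1"
  have s: "s > 0" by (simp add: s_def add_nonneg_pos)
  have off: "x - t *\<^sub>R axis i 1 \<notin> fun_support \<eta>" if "t \<ge> s" for t
  proof
    assume "x - t *\<^sub>R axis i 1 \<in> fun_support \<eta>"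
    then have "norm (x - t *\<^sub>R axis i 1) \<le> r" by (rule r)
    moreover have "norm (t *\<^sub>R axis i (1::real)) \<le> norm x + norm (x - t *\<^sub>R axis i 1)"
      using norm_triangle_ineq4[of x "x - t *\<^sub>R axis i 1"] by simp
    ultimately show False using that by (simp add: s_def)
  qed
  have "((\<lambda>t. - \<eta> (x - t *\<^sub>R axis i 1)) has_vector_derivative partial_deriv i \<eta> (x - t *\<^sub>R axis i 1)) (at t within {0..s})" for t
  proof -
    have d: "\<eta> differentiable_on UNIV" by (rule smooth_on_imp_differentiable[OF test_smooth[OF \<eta>]])
    have "((\<lambda>t. \<eta> (x + t *\<^sub>R axis i 1)) has_vector_derivative partial_deriv i \<eta> (x + (-t) *\<^sub>R axis i 1)) (at (-t))"
      by (rule has_vector_derivative_along_axis[OF open_UNIV d]) simp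
    moreover have "(uminus has_vector_derivative -1) (at t)"
      by (auto intro!: derivative_eq_intros)
    ultimately have "(((\<lambda>t. \<eta> (x + t *\<^sub>R axis i 1)) \<circ> uminus) has_vector_derivative (-1) *\<^sub>R partial_deriv i \<eta> (x + (-t) *\<^sub>R axis i 1)) (at t)"
      by (intro vector_diff_chain_at) auto
    then have "((\<lambda>t. - \<eta> (x - t *\<^sub>R axis i 1)) has_vector_derivative - ((-1) *\<^sub>R partial_deriv i \<eta> (x - t *\<^sub>R axis i 1))) (at t)"
      by (intro has_vector_derivative_minus) (simp add: comp_def)
    then show ?thesis by (simp add: has_vector_derivative_at_within)
  qed
  then have "(LINT t|lborel. indicator {0..s} t *\<^sub>R partial_deriv i \<eta> (x - t *\<^sub>R axis i 1))
      = - \<eta> (x - s *\<^sub>R axis i 1) - - \<eta> (x - 0 *\<^sub>R axis i 1)"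
    by (rule integral_FTC_atLeastAtMost[rotated])
      (use s in \<open>auto intro!: continuous_on_compose2[OF test_continuous[OF test_partial_deriv[OF \<eta>]]] continuous_intros\<close>)
  also have "\<dots> = \<eta> x" using fun_support_zero[OF off[of s]] by simp
  also have "(LINT t|lborel. indicator {0..s} t *\<^sub>R partial_deriv i \<eta> (x - t *\<^sub>R axis i 1))
     = ray_integral i (partial_deriv i \<eta>) x"
    unfolding ray_integral_def translation_integral_def
  proof (rule Bochner_Integration.integral_cong[OF refl])
    show "indicator {0..s} t *\<^sub>R partial_deriv i \<eta> (x - t *\<^sub>R axis i 1) =
      indicator {0..} t * partial_deriv i \<eta> (x + - (t *\<^sub>R axis i 1))" for t :: real
      using derivs_zero_off_support[OF off[of t], of "[i]"] by (auto simp: indicator_def)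
  qed
  finally show "ray_integral i (partial_deriv i \<eta>) x = \<eta> x" .
qed

text \<open>Composition with \<open>freeze i c\<close> restricts a function to the hyperplane \<open>x\<^sub>i = c\<close> and extends the
  restriction by functions that are constant in direction \<open>i\<close>.\<close>

definition freeze :: "'n::finite \<Rightarrow> real \<Rightarrow> real^'n \<Rightarrow> real^'n" where
  "freeze i c x = x + (c - x $ i) *\<^sub>R axis i 1"

lemma partial_deriv_freeze:
  assumes "f differentiable_on UNIV"
  shows "partial_deriv j (\<lambda>x. f (freeze i c x)) = (\<lambda>x. if j = i then 0 else partial_deriv j f (freeze i c x))"
proof
  fix x
  let ?L = "frechet_derivative f (at (freeze i c x))"
  have L: "(f has_derivative ?L) (at (freeze i c x))"
    by (rule has_derivative_frechet[OF assms]) auto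
  have "(freeze i c has_derivative (\<lambda>h. h - (h $ i) *\<^sub>R axis i 1)) (at x)"
    unfolding freeze_def
    by (auto intro!: derivative_eq_intros bounded_linear_imp_has_derivative bounded_linear_vec_nth)
  from has_derivative_compose[OF this L]
  have "((\<lambda>x. f (freeze i c x)) has_derivative (\<lambda>h. ?L (h - (h $ i) *\<^sub>R axis i 1))) (at x)" .
  from partial_deriv_eq[OF this, of j]
  show "partial_deriv j (\<lambda>x. f (freeze i c x)) x = (if j = i then 0 else partial_deriv j f (freeze i c x))"
    using linear_0[OF has_derivative_linear[OF L]] by (auto simp: axis_def partial_deriv_def)
qed

lemma smooth_on_freeze:
  assumes "smooth_on UNIV f"
  shows "smooth_on UNIV (\<lambda>x. f (freeze i c x))"
proof -
  have d: "(\<lambda>x. f (freeze i c x)) differentiable_on UNIV" if "f differentiable_on UNIV" for f :: "real^'a \<Rightarrow> complex"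
  proof -
    have "(freeze i c has_derivative (\<lambda>h. h - (h $ i) *\<^sub>R axis i 1)) (at x)" for x
      unfolding freeze_def
      by (auto intro!: derivative_eq_intros bounded_linear_imp_has_derivative bounded_linear_vec_nth)
    then have "\<And>x. freeze i c differentiable (at x)" unfolding differentiable_def by blast
    then show ?thesis using that differentiable_chain_at[of "freeze i c" _ f]
      unfolding differentiable_on_def by (simp add: comp_def)
  qed
  have "smooth_upto k UNIV (\<lambda>x. f (freeze i c x))" if "smooth_on UNIV f" for k f
    using that
  proof (induction k arbitrary: f)
    case 0
    then show ?case by (simp add: smooth_upto_0 d smooth_on_imp_differentiable)
  next
    case (Suc k)
    have "smooth_upto k UNIV (partial_deriv j (\<lambda>x. f (freeze i c x)))" for j
      using Suc.IH[OF smooth_on_partial_deriv[OF Suc.prems], of j] smooth_upto_const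
      by (cases "j = i") (simp_all add: partial_deriv_freeze[OF smooth_on_imp_differentiable[OF Suc.prems]])
    then show ?case using d[OF smooth_on_imp_differentiable[OF Suc.prems]] by (simp add: smooth_upto_Suc)
  qed
  then show ?thesis using assms by (simp add: smooth_on_iff_upto)
qed

text \<open>For closed \<open>F\<close> the potential is \<open>\<phi>(x) = - \<integral>\<^sub>0\<^sup>\<infinity> F\<^sub>1(x + t e\<^sub>1) dt\<close>, read as a distribution: the
  integration is moved to the test function, where it becomes \<open>ray_integral\<close>. Its support is
  compact because there is a second coordinate direction: if \<open>\<eta>\<close> vanishes on a cube around the
  supports of all \<open>F\<^sub>i\<close>, then \<open>ray_integral\<close> of \<open>\<eta>\<close> is on that cube a function that does not
  depend on \<open>x\<^sub>1\<close>, hence of the form \<open>\<partial>\<^sub>2 b\<close> with \<open>\<partial>\<^sub>1 b = 0\<close>, and \<open>F\<^sub>1(\<partial>\<^sub>2 b) = F\<^sub>2(\<partial>\<^sub>1 b) = 0\<close>.\<close>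

lemma exact_if_closed:
  fixes F :: "'n::finite \<Rightarrow> 'n functional"
  assumes n: "CARD('n) \<ge> 2" and F: "\<And>i. F i \<in> compact_distributions"
    and closed: "\<And>i j f. smooth_on UNIV f \<Longrightarrow>
      compact_pairing (F i) (partial_deriv j f) = compact_pairing (F j) (partial_deriv i f)"
  shows "\<exists>\<phi>\<in>compact_distributions. \<forall>i. dist_eq_on UNIV (F i) (dist_deriv i \<phi>)"
proof -
  obtain e1 e2 :: 'n where ne: "e1 \<noteq> e2"
    using n card_2_iff'[of "UNIV :: 'n set"] by (metis UNIV_I card_le_Suc0_iff_eq finite_class.finite_UNIV not_less_eq_eq numeral_2_eq_2)
  have "\<exists>K. smooth_functional UNIV K (compact_pairing (F i))" for i
    using smooth_functional_compact_pairing[OF F[of i]] by blast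
  then obtain K where K: "\<And>i. smooth_functional UNIV (K i) (compact_pairing (F i))" by metis
  have "bounded (\<Union>i. K i)"
    by (intro bounded_UN ballI compact_imp_bounded) (use smooth_functional_compact[OF K] in auto)
  then obtain R0 where R0: "\<And>x i. x \<in> K i \<Longrightarrow> norm x \<le> R0" unfolding bounded_iff by blast
  define R where "R = \<bar>R0\<bar> + 1"
  define Q where "Q = {x :: real^'n. \<forall>j. \<bar>x $ j\<bar> \<le> R}"
  define Q' where "Q' = {x :: real^'n. \<forall>j. \<bar>x $ j\<bar> < R}"
  have R: "R > 0" by (simp add: R_def)
  have KQ: "K i \<subseteq> Q'" for i
  proof
    fix x assume "x \<in> K i"
    then have "norm x < R" using R0[of x i] by (simp add: R_def)
    then show "x \<in> Q'" using component_le_norm_cart[of x] by (auto simp: Q'_def intro: le_less_trans)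
  qed
  have "Q' = (\<Inter>j. {x. \<bar>x $ j\<bar> < R})" "Q = (\<Inter>j. {x. \<bar>x $ j\<bar> \<le> R})" by (auto simp: Q'_def Q_def)
  then have openQ': "open Q'" and closedQ: "closed Q"
    by (auto intro!: open_INT closed_INT open_Collect_less closed_Collect_le continuous_intros)
  have Qeq: "Q = cbox (- (\<Sum>j\<in>UNIV. R *\<^sub>R axis j 1)) (\<Sum>j\<in>UNIV. R *\<^sub>R axis j 1)"
    by (auto simp: Q_def mem_box_cart axis_def abs_le_iff if_distrib[of "\<lambda>z. R * z"] minus_le_iff cong: if_cong)
  have compQ: "compact Q" unfolding Qeq by (rule compact_cbox)
  let ?J = "ray_integral e1"
  define \<phi> where "\<phi> \<eta> = - compact_pairing (F e1) (?J \<eta>)" for \<eta>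
  have lin: "linear_functional_on test_functions \<phi>"
    unfolding linear_functional_on_def
  proof (intro ballI allI)
    fix \<eta> \<zeta> :: "real^'n \<Rightarrow> complex" and a b assume t: "\<eta> \<in> test_functions" "\<zeta> \<in> test_functions"
    have "?J (\<lambda>x. a * \<eta> x + b * \<zeta> x) = (\<lambda>x. a * ?J \<eta> x + b * ?J \<zeta> x)"
      unfolding ray_integral_def by (rule ext) (rule translation_integral_add[OF ray_kernel t])
    then show "\<phi> (\<lambda>x. a * \<eta> x + b * \<zeta> x) = a * \<phi> \<eta> + b * \<phi> \<zeta>"
      using smooth_functional_linear[OF K[of e1] smooth_ray_integral[OF t(1)] smooth_ray_integral[OF t(2)], of a e1 b e1]
      by (simp add: \<phi>_def)
  qed
  have bound: "\<exists>C N. \<forall>\<eta>\<in>test_functions. fun_support \<eta> \<subseteq> L \<longrightarrow>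
        cmod (\<phi> \<eta>) \<le> C * (\<Sum>\<alpha> | sum \<alpha> UNIV \<le> N. SUP x. cmod (multi_deriv \<alpha> \<eta> x))"
    if L: "compact L" for L
  proof -
    obtain C N where C: "C \<ge> 0" "\<And>f B. smooth_on UNIV f \<Longrightarrow> B \<ge> 0 \<Longrightarrow>
        (\<And>js x. length js \<le> N \<Longrightarrow> x \<in> K e1 \<Longrightarrow> cmod (derivs js f x) \<le> B) \<Longrightarrow>
        cmod (compact_pairing (F e1) f) \<le> C * B"
      using smooth_functional_bound[OF K[of e1]] by metis
    define L' where "L' = {a - b | a b. a \<in> L \<and> b \<in> K e1}"
    have L': "compact L'" unfolding L'_def by (intro compact_differences L smooth_functional_compact[OF K])
    define I where "I = (LINT t|lborel. indicator L' (- (t *\<^sub>R axis e1 (1::real))) * cmod (indicator {0..} t))"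
    have "cmod (\<phi> \<eta>) \<le> (C * I) * (\<Sum>\<alpha> | sum \<alpha> UNIV \<le> N. SUP x. cmod (multi_deriv \<alpha> \<eta> x))"
      if \<eta>: "\<eta> \<in> test_functions" "fun_support \<eta> \<subseteq> L" for \<eta>
    proof -
      let ?S = "\<lambda>\<alpha>. SUP x. cmod (multi_deriv \<alpha> \<eta> x)"
      define B where "B = (\<Sum>\<alpha> | sum \<alpha> UNIV \<le> N. ?S \<alpha>)"
      have S: "cmod (multi_deriv \<alpha> \<eta> x) \<le> ?S \<alpha>" for \<alpha> x
      proof (rule cSUP_upper)
        obtain b where "\<And>x. cmod (derivs (index_list \<alpha>) \<eta> x) \<le> b"
          using test_bounded[OF test_derivs[OF \<eta>(1), of "index_list \<alpha>"]] by metis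
        then show "bdd_above (range (\<lambda>x. cmod (multi_deriv \<alpha> \<eta> x)))"
          unfolding multi_deriv_index_list by (intro bdd_aboveI2)
      qed simp
      have S0: "?S \<alpha> \<ge> 0" for \<alpha> using S[of \<alpha> 0] norm_ge_zero order_trans by blast
      have DB: "cmod (derivs js \<eta> x) \<le> B" if "length js \<le> N" for js x
      proof -
        have "cmod (derivs js \<eta> x) = cmod (multi_deriv (count (mset js)) \<eta> x)"
          by (simp add: derivs_eq_multi_deriv[OF open_UNIV test_smooth[OF \<eta>(1)]])
        also have "\<dots> \<le> ?S (count (mset js))" by (rule S)
        also have "\<dots> \<le> B" unfolding B_def
          by (rule member_le_sum) (use that S0 in \<open>auto simp: sum_count_mset finite_bounded_multi_indices\<close>)
        finally show ?thesis .
      qed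
      have B0: "B \<ge> 0" unfolding B_def by (intro sum_nonneg S0)
      have I0: "I \<ge> 0" unfolding I_def by (intro Bochner_Integration.integral_nonneg) auto
      have "cmod (compact_pairing (F e1) (?J \<eta>)) \<le> C * (B * I)"
      proof (rule C(2)[OF smooth_ray_integral[OF \<eta>(1)]])
        show "0 \<le> B * I" using B0 I0 by simp
        fix js :: "'n list" and x assume js: "length js \<le> N" and x: "x \<in> K e1"
        have [measurable]: "derivs js \<eta> \<in> borel_measurable borel" by (rule test_borel[OF test_derivs[OF \<eta>(1)]])
        have "cmod (LINT t|lborel. indicator {0..} t * derivs js \<eta> (x + - (t *\<^sub>R axis e1 1))) \<le> B * I"
          unfolding I_def
        proof (rule translation_kernel_integrable_bounded(2)[OF ray_kernel _ L', of "\<lambda>z. derivs js \<eta> (x + z)"])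
          show "derivs js \<eta> (x + z) = 0" if "z \<notin> L'" for z
          proof (rule derivs_zero_off_support, rule)
            assume "x + z \<in> fun_support \<eta>"
            then have "x + z \<in> L" using \<eta>(2) by auto
            moreover have "z = x + z - x" by simp
            ultimately show False using that x unfolding L'_def by blast
          qed
        qed (use DB[OF js] in auto)
        then show "cmod (derivs js (?J \<eta>) x) \<le> B * I"
          by (simp add: derivs_ray_integral[OF \<eta>(1)]) (simp add: ray_integral_def translation_integral_def)
      qed
      then show ?thesis by (simp add: \<phi>_def B_def mult_ac)
    qed
    then show ?thesis by blast
  qed
  have dist: "\<phi> \<in> distributions" unfolding distributions_def using lin bound by blast
  have "dist_eq_on (- Q) \<phi> (\<lambda>_. 0)"
    unfolding dist_eq_on_def
  proof (intro ballI impI)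
    fix \<eta> assume \<eta>: "\<eta> \<in> test_functions" and off: "fun_support \<eta> \<subseteq> - Q"
    note sJ = smooth_ray_integral[OF \<eta>, of e1]
    obtain \<kappa> W where \<kappa>: "\<kappa> \<in> test_functions" "open W" "Q \<subseteq> W" "\<And>x. x \<in> W \<Longrightarrow> \<kappa> x = 1"
      using cutoff_exists[OF compQ open_UNIV subset_UNIV] by metis
    have t: "(\<lambda>x. ?J \<eta> x * \<kappa> x) \<in> test_functions" by (rule test_mult[OF sJ \<kappa>(1)])
    define b' where "b' = ray_integral e2 (\<lambda>x. ?J \<eta> x * \<kappa> x)"
    have sb': "smooth_on UNIV b'" unfolding b'_def by (rule smooth_ray_integral[OF t])
    have db': "partial_deriv e2 b' = (\<lambda>x. ?J \<eta> x * \<kappa> x)"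
      unfolding b'_def by (simp only: partial_deriv_ray_integral[OF t] ray_integral_partial_deriv[OF t])
    define b where "b x = b' (freeze e1 (- R) x)" for x
    have sb: "smooth_on UNIV b" unfolding b_def by (rule smooth_on_freeze[OF sb'])
    have pd_b: "partial_deriv j b = (\<lambda>x. if j = e1 then 0 else partial_deriv j b' (freeze e1 (- R) x))" for j
      unfolding b_def by (rule partial_deriv_freeze[OF smooth_on_imp_differentiable[OF sb']])
    have inQ: "x + t *\<^sub>R axis e1 1 \<in> Q" if "x \<in> Q'" "t \<in> {- R - x $ e1..0}" for x t
    proof -
      have "\<bar>(x + t *\<^sub>R axis e1 1) $ j\<bar> \<le> R" for j
        using that by (cases "j = e1") (auto simp: Q'_def axis_def abs_less_iff abs_le_iff less_imp_le dest: spec[of _ j])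
      then show ?thesis by (simp add: Q_def)
    qed
    have Jconst: "?J \<eta> x = ?J \<eta> (freeze e1 (- R) x)" if x: "x \<in> Q'" for x
    proof -
      let ?S = "{- R - x $ e1..0}"
      have "((\<lambda>t. ?J \<eta> (x + t *\<^sub>R axis e1 1)) has_vector_derivative 0) (at t within ?S)" if "t \<in> ?S" for t
      proof -
        have "((\<lambda>t. ?J \<eta> (x + t *\<^sub>R axis e1 1)) has_vector_derivative partial_deriv e1 (?J \<eta>) (x + t *\<^sub>R axis e1 1)) (at t)"
          by (rule has_vector_derivative_along_axis[OF open_UNIV smooth_on_imp_differentiable[OF sJ]]) simp
        moreover have "partial_deriv e1 (?J \<eta>) (x + t *\<^sub>R axis e1 1) = \<eta> (x + t *\<^sub>R axis e1 1)"
          by (simp only: partial_deriv_ray_integral[OF \<eta>] ray_integral_partial_deriv[OF \<eta>])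
        moreover have "\<eta> (x + t *\<^sub>R axis e1 1) = 0"
          using inQ[OF x that] off by (intro fun_support_zero) auto
        ultimately show ?thesis by (simp add: has_vector_derivative_at_within)
      qed
      then obtain c where c: "\<And>t. t \<in> ?S \<Longrightarrow> ?J \<eta> (x + t *\<^sub>R axis e1 1) = c"
        using has_vector_derivative_zero_constant[of ?S "\<lambda>t. ?J \<eta> (x + t *\<^sub>R axis e1 1)"] by (auto)
      have "- R - x $ e1 \<le> 0" using x by (auto simp: Q'_def abs_less_iff dest!: spec[of _ e1])
      then show ?thesis using c[of 0] c[of "- R - x $ e1"] by (simp add: freeze_def)
    qed
    have "compact_pairing (F e1) (?J \<eta>) = compact_pairing (F e1) (partial_deriv e2 b)"
    proof (rule smooth_functional_cong[OF K open_UNIV sJ smooth_on_partial_deriv[OF sb] openQ' KQ])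
      fix x assume x: "x \<in> Q'"
      have "- R - x $ e1 \<le> 0" using x by (auto simp: Q'_def abs_less_iff dest!: spec[of _ e1])
      then have "freeze e1 (- R) x \<in> Q" using inQ[OF x, of "- R - x $ e1"] by (simp add: freeze_def)
      then have "\<kappa> (freeze e1 (- R) x) = 1" using \<kappa>(3,4) by blast
      then show "?J \<eta> x = partial_deriv e2 b x"
        using Jconst[OF x] ne by (simp add: pd_b db')
    qed
    also have "\<dots> = compact_pairing (F e2) (partial_deriv e1 b)" by (rule closed[OF sb])
    also have "\<dots> = 0" using smooth_functional_zero[OF K[of e2]] by (simp add: pd_b)
    finally show "\<phi> \<eta> = 0" by (simp add: \<phi>_def)
  qed
  then have "dist_support \<phi> \<subseteq> Q" unfolding dist_support_def using closedQ by auto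
  then have "compact (dist_support \<phi>)"
    using compact_Int_closed[OF compQ closed_dist_support[of \<phi>]] by (simp add: inf.absorb2)
  then have comp: "\<phi> \<in> compact_distributions" using dist by (simp add: compact_distributions_def)
  have "dist_eq_on UNIV (F i) (dist_deriv i \<phi>)" for i
    unfolding dist_eq_on_def
  proof (intro ballI impI)
    fix \<eta> :: "real^'n \<Rightarrow> complex" assume \<eta>: "\<eta> \<in> test_functions"
    have "dist_deriv i \<phi> \<eta> = compact_pairing (F e1) (?J (partial_deriv i \<eta>))"
      by (simp add: dist_deriv_def \<phi>_def)
    also have "?J (partial_deriv i \<eta>) = partial_deriv i (?J \<eta>)"
      by (rule partial_deriv_ray_integral[OF \<eta>, symmetric])
    also have "compact_pairing (F e1) (partial_deriv i (?J \<eta>)) = compact_pairing (F i) (partial_deriv e1 (?J \<eta>))"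
      by (rule closed[OF smooth_ray_integral[OF \<eta>]])
    also have "partial_deriv e1 (?J \<eta>) = \<eta>"
      by (simp only: partial_deriv_ray_integral[OF \<eta>] ray_integral_partial_deriv[OF \<eta>])
    also have "compact_pairing (F i) \<eta> = F i \<eta>" by (rule compact_pairing_test[OF F \<eta>])
    finally show "F i \<eta> = dist_deriv i \<phi> \<eta>" ..
  qed
  with comp show ?thesis by blast
qed

section \<open>Monomials and constant coefficient operators\<close>

definition monomial :: "real^'n::finite \<Rightarrow> ('n \<Rightarrow> nat) \<Rightarrow> real^'n \<Rightarrow> complex" where
  "monomial a \<beta> x = (\<Prod>j\<in>UNIV. of_real (x $ j - a $ j) ^ \<beta> j)"

lemma smooth_monomial: "open U \<Longrightarrow> smooth_on U (monomial a \<beta>)"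
  unfolding monomial_def by (intro smooth_on_prod smooth_on_power smooth_on_coord)

lemma monomial_remove:
  "monomial a \<beta> x = of_real (x $ j - a $ j) ^ \<beta> j * (\<Prod>i\<in>UNIV - {j}. of_real (x $ i - a $ i) ^ \<beta> i)"
  unfolding monomial_def by (rule prod.remove) auto

lemma monomial_upd:
  "monomial a (\<beta>(j := m)) x = of_real (x $ j - a $ j) ^ m * (\<Prod>i\<in>UNIV - {j}. of_real (x $ i - a $ i) ^ \<beta> i)"
  unfolding monomial_remove[of a _ x j] by (auto intro!: prod.cong)

lemma monomial_Suc: "monomial a (\<beta>(j := Suc (\<beta> j))) x = of_real (x $ j - a $ j) * monomial a \<beta> x"
  unfolding monomial_upd monomial_remove[of a \<beta> x j] by simp

lemma partial_deriv_coord_power: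
  "partial_deriv j (\<lambda>x. of_real (x $ i - c) ^ m) x = (if i = j then of_nat m * of_real (x $ i - c) ^ (m - 1) else 0)"
proof (induction m)
  case 0
  then show ?case by (simp add: partial_deriv_const)
next
  case (Suc m)
  have "partial_deriv j (\<lambda>x. complex_of_real (x $ i - c) ^ Suc m) x
    = partial_deriv j (\<lambda>x. complex_of_real (x $ i - c)) x * of_real (x $ i - c) ^ m
      + of_real (x $ i - c) * partial_deriv j (\<lambda>x. of_real (x $ i - c) ^ m) x"
    unfolding power_Suc
    by (rule partial_deriv_mult[OF open_UNIV])
      (auto intro!: smooth_on_imp_differentiable smooth_on_power smooth_on_coord simp del: of_real_diff)
  then show ?case unfolding Suc.IH partial_deriv_coord by (cases m) (auto simp: algebra_simps)
qed

lemma partial_deriv_monomial: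
  "partial_deriv j (monomial a \<beta>) x = of_nat (\<beta> j) * monomial a (\<beta>(j := \<beta> j - 1)) x"
proof -
  let ?r = "\<lambda>I x. \<Prod>i\<in>I. complex_of_real (x $ i - a $ i) ^ \<beta> i"
  have s: "smooth_on UNIV (?r I)" for I
    by (intro smooth_on_prod smooth_on_power smooth_on_coord) auto
  have z: "partial_deriv j (?r I) x = 0" if "j \<notin> I" "finite I" for I
    using that(2,1)
  proof (induction I rule: finite_induct)
    case (insert i I)
    have "partial_deriv j (\<lambda>x. complex_of_real (x $ i - a $ i) ^ \<beta> i * ?r I x) x
       = partial_deriv j (\<lambda>x. complex_of_real (x $ i - a $ i) ^ \<beta> i) x * ?r I x
         + complex_of_real (x $ i - a $ i) ^ \<beta> i * partial_deriv j (?r I) x"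
      by (rule partial_deriv_mult[OF open_UNIV])
        (auto intro!: smooth_on_imp_differentiable smooth_on_power smooth_on_coord s simp del: of_real_diff)
    also have "\<dots> = 0" using insert by (auto simp: partial_deriv_coord_power simp del: of_real_diff)
    finally show ?case using insert.hyps by simp
  qed (simp add: partial_deriv_const)
  have "partial_deriv j (monomial a \<beta>) x = partial_deriv j (\<lambda>x. of_real (x $ j - a $ j) ^ \<beta> j * ?r (UNIV - {j}) x) x"
    by (rule partial_deriv_cong[OF open_UNIV]) (auto simp: monomial_remove[of a \<beta> _ j])
  also have "\<dots> = partial_deriv j (\<lambda>x. complex_of_real (x $ j - a $ j) ^ \<beta> j) x * ?r (UNIV - {j}) x
      + complex_of_real (x $ j - a $ j) ^ \<beta> j * partial_deriv j (?r (UNIV - {j})) x"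
    by (rule partial_deriv_mult[OF open_UNIV])
      (auto intro!: smooth_on_imp_differentiable smooth_on_power smooth_on_coord s simp del: of_real_diff)
  also have "\<dots> = of_nat (\<beta> j) * monomial a (\<beta>(j := \<beta> j - 1)) x"
    using z[of "UNIV - {j}"] by (simp add: monomial_upd partial_deriv_coord_power del: of_real_diff)
  finally show ?thesis .
qed

text \<open>The constant is a product of falling factorials; what matters is when it is zero.\<close>

lemma derivs_monomial:
  "\<exists>c. (\<forall>x. derivs js (monomial a \<beta>) x = c * monomial a (\<lambda>j. \<beta> j - count (mset js) j) x) \<and>
     (c \<noteq> 0 \<longleftrightarrow> (\<forall>j. count (mset js) j \<le> \<beta> j))"
proof (induction js)
  case Nil
  then show ?case by (intro exI[of _ 1]) simp
next
  case (Cons j js)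
  let ?\<gamma> = "\<lambda>j. \<beta> j - count (mset js) j"
  obtain c where c: "\<And>x. derivs js (monomial a \<beta>) x = c * monomial a ?\<gamma> x"
    "c \<noteq> 0 \<longleftrightarrow> (\<forall>j. count (mset js) j \<le> \<beta> j)" using Cons.IH by auto
  have "derivs (j # js) (monomial a \<beta>) x = (c * of_nat (?\<gamma> j)) * monomial a (\<lambda>i. \<beta> i - count (mset (j # js)) i) x" for x
  proof -
    have "derivs (j # js) (monomial a \<beta>) x = partial_deriv j (\<lambda>x. c * monomial a ?\<gamma> x) x"
      using partial_deriv_cong[OF open_UNIV, of x "derivs js (monomial a \<beta>)"] c(1) by simp
    also have "\<dots> = c * (of_nat (?\<gamma> j) * monomial a (?\<gamma>(j := ?\<gamma> j - 1)) x)"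
      by (simp add: partial_deriv_cmult[OF open_UNIV smooth_on_imp_differentiable[OF smooth_monomial]]
          partial_deriv_monomial)
    also have "?\<gamma>(j := ?\<gamma> j - 1) = (\<lambda>i. \<beta> i - count (mset (j # js)) i)" by (auto simp: fun_eq_iff)
    finally show ?thesis by (simp add: mult.assoc)
  qed
  moreover have "c * of_nat (?\<gamma> j) \<noteq> 0 \<longleftrightarrow> (\<forall>i. count (mset (j # js)) i \<le> \<beta> i)"
  proof -
    have "c * of_nat (?\<gamma> j) \<noteq> 0 \<longleftrightarrow> (\<forall>i. count (mset js) i \<le> \<beta> i) \<and> count (mset js) j < \<beta> j"
      using c(2) by auto
    also have "\<dots> \<longleftrightarrow> (\<forall>i. count (mset (j # js)) i \<le> \<beta> i)"
    proof (intro iffI allI conjI)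
      fix i assume "(\<forall>i. count (mset js) i \<le> \<beta> i) \<and> count (mset js) j < \<beta> j"
      then show "count (mset (j # js)) i \<le> \<beta> i" by (cases "i = j") auto
    next
      assume le: "\<forall>i. count (mset (j # js)) i \<le> \<beta> i"
      show "count (mset js) i \<le> \<beta> i" for i using le[rule_format, of i] by (cases "i = j") auto
      show "count (mset js) j < \<beta> j" using le[rule_format, of j] by simp
    qed
    finally show ?thesis .
  qed
  ultimately show ?case by (intro exI[of _ "c * of_nat (?\<gamma> j)"]) simp
qed

text \<open>The formal transpose of \<open>P(D)\<close>: the transpose of \<open>D\<^sub>j = - i \<partial>\<^sub>j\<close> is \<open>i \<partial>\<^sub>j\<close>, and transposition
  reverses the order of the factors.\<close>

definition transposed_op :: "(('n::finite \<Rightarrow> nat) \<Rightarrow>\<^sub>0 complex) \<Rightarrow> (real^'n \<Rightarrow> complex) \<Rightarrow> real^'n \<Rightarrow> complex" where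
  "transposed_op P \<psi> x = (\<Sum>\<alpha>\<in>Poly_Mapping.keys P.
     Poly_Mapping.lookup P \<alpha> * \<i> ^ sum \<alpha> UNIV * derivs (rev (index_list \<alpha>)) \<psi> x)"

lemma foldr_dist_D: "foldr dist_D js u \<phi> = \<i> ^ length js * u (derivs (rev js) \<phi>)"
  by (induction js arbitrary: \<phi>) (simp_all add: dist_D_def dist_deriv_def)

lemma poly_D_transposed:
  assumes lin: "\<And>\<phi> \<psi> a b. \<phi> \<in> test_functions \<Longrightarrow> \<psi> \<in> test_functions \<Longrightarrow> u (\<lambda>x. a * \<phi> x + b * \<psi> x) = a * u \<phi> + b * u \<psi>"
    and \<phi>: "\<phi> \<in> test_functions"
  shows "poly_D P u \<phi> = u (transposed_op P \<phi>)"
proof -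
  have z: "u (\<lambda>x. 0) = 0" using lin[OF test_zero test_zero, of 0 0] by simp
  have "u (\<lambda>x. \<Sum>\<alpha>\<in>I. c \<alpha> * derivs (l \<alpha>) \<phi> x) = (\<Sum>\<alpha>\<in>I. c \<alpha> * u (derivs (l \<alpha>) \<phi>))"
    if "finite I" for I :: "('a \<Rightarrow> nat) set" and c l
    using that
  proof (induction I rule: finite_induct)
    case (insert \<alpha> I)
    have "(\<lambda>x. \<Sum>\<alpha>\<in>I. c \<alpha> * derivs (l \<alpha>) \<phi> x) \<in> test_functions"
      by (intro test_sum test_cmult test_derivs \<phi>)
    from lin[OF test_derivs[OF \<phi>, of "l \<alpha>"] this, of "c \<alpha>" 1] show ?case
      using insert by simp
  qed (simp add: z)
  then show ?thesis
    by (simp add: poly_D_def transposed_op_def[abs_def] multi_power_index_list foldr_dist_D length_index_list mult.assoc[symmetric])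
qed

lemma test_transposed_op: "\<psi> \<in> test_functions \<Longrightarrow> transposed_op P \<psi> \<in> test_functions"
  unfolding transposed_op_def[abs_def] by (intro test_sum test_cmult test_derivs)

lemma smooth_functional_eqI:
  assumes S: "smooth_functional U K S" and U: "open U" and eq: "\<And>f. smooth_on U f \<Longrightarrow> T f = S f"
  shows "smooth_functional U K T"
proof -
  obtain C N where C: "C \<ge> 0" "\<And>f B. smooth_on U f \<Longrightarrow> B \<ge> 0 \<Longrightarrow>
        (\<And>js x. length js \<le> N \<Longrightarrow> x \<in> K \<Longrightarrow> cmod (derivs js f x) \<le> B) \<Longrightarrow> cmod (S f) \<le> C * B"
    using smooth_functional_bound[OF S] by metis
  show ?thesis
  proof (rule smooth_functionalI[OF smooth_functional_compact[OF S] smooth_functional_subset[OF S] _ C(1)])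
    show "T (\<lambda>x. a * f x + b * g x) = a * T f + b * T g" if "smooth_on U f" "smooth_on U g" for f g a b
    proof -
      have "smooth_on U (\<lambda>x. a * f x + b * g x)" using that U by (intro smooth_on_add smooth_on_cmult)
      then show ?thesis using smooth_functional_linear[OF S that, of a b] eq that by simp
    qed
    show "cmod (T f) \<le> C * B" if "smooth_on U f" "0 \<le> B"
      "\<And>js x. length js \<le> N \<Longrightarrow> x \<in> K \<Longrightarrow> cmod (derivs js f x) \<le> B" for f B
      unfolding eq[OF that(1)] by (rule C(2)[OF that])
  qed
qed

lemma smooth_functional_transposed_op:
  assumes T: "smooth_functional U K T" and U: "open U"
  shows "\<exists>L. smooth_functional U L (\<lambda>\<psi>. T (transposed_op P \<psi>))"
proof -
  let ?c = "\<lambda>\<alpha>. Poly_Mapping.lookup P \<alpha> * \<i> ^ sum \<alpha> UNIV"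
  let ?S = "\<lambda>\<psi>. \<Sum>\<alpha>\<in>Poly_Mapping.keys P. ?c \<alpha> * T (derivs (rev (index_list \<alpha>)) \<psi>)"
  have S: "smooth_functional U (\<Union>\<alpha>\<in>Poly_Mapping.keys P. K) ?S"
    by (rule smooth_functional_finite_sum) (auto intro: smooth_functional_derivs[OF T U])
  have eq: "T (transposed_op P \<psi>) = ?S \<psi>" if "smooth_on U \<psi>" for \<psi>
  proof -
    have "T (transposed_op P \<psi>) = (\<Sum>\<alpha>\<in>Poly_Mapping.keys P. T (\<lambda>x. ?c \<alpha> * derivs (rev (index_list \<alpha>)) \<psi> x))"
      unfolding transposed_op_def[abs_def]
      by (rule smooth_functional_sum[OF T U]) (intro smooth_on_cmult U smooth_on_derivs that)
    also have "\<dots> = ?S \<psi>"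
      by (intro sum.cong refl smooth_functional_cmult[OF T] smooth_on_derivs that)
    finally show ?thesis .
  qed
  show ?thesis using smooth_functional_eqI[OF S U eq] by blast
qed

lemma horner_sum_add: "horner_sum (\<lambda>j. f j + g j) (B::nat) js = horner_sum f B js + horner_sum g B js"
  by (induction js) (simp_all add: algebra_simps)

lemma horner_sum_inj:
  assumes "horner_sum f B js = horner_sum g B js" "\<And>j. j \<in> set js \<Longrightarrow> f j < B" "\<And>j. j \<in> set js \<Longrightarrow> g j < (B::nat)"
    and "j \<in> set js"
  shows "f j = g j"
  using assms
proof (induction js)
  case (Cons i js)
  have eq: "f i + B * horner_sum f B js = g i + B * horner_sum g B js" using Cons.prems(1) by simp
  have lt: "f i < B" "g i < B" using Cons.prems by auto
  have i: "f i = g i" using arg_cong[OF eq, of "\<lambda>n. n mod B"] lt by simp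
  then have "horner_sum f B js = horner_sum g B js" using eq lt by auto
  then show ?case using Cons i by auto
qed simp

text \<open>The transpose \<open>P(-D)\<close> of \<open>P(D)\<close> maps polynomials onto polynomials, so a functional that
  vanishes on its range vanishes on all polynomials. The weight \<open>L\<close> is additive and takes different
  values at the exponents of \<open>P\<close> (as a number with these digits), so \<open>P\<close> has a unique term of least
  weight \<open>\<alpha>\<^sub>0\<close>, and \<open>P(-D)\<close> maps the monomial of exponent \<open>\<beta> + \<alpha>\<^sub>0\<close> to a nonzero multiple of
  that of exponent \<open>\<beta>\<close> plus monomials of smaller weight.\<close>

lemma vanishes_on_monomials:
  fixes P :: "('n::finite \<Rightarrow> nat) \<Rightarrow>\<^sub>0 complex"
  assumes T: "smooth_functional UNIV K T" and P: "P \<noteq> 0"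
    and z: "\<And>\<psi>. smooth_on UNIV \<psi> \<Longrightarrow> T (transposed_op P \<psi>) = 0"
  shows "T (monomial a \<beta>) = 0"
proof -
  define B where "B = Suc (\<Sum>\<alpha>\<in>Poly_Mapping.keys P. sum \<alpha> UNIV)"
  define L where "L \<alpha> = horner_sum \<alpha> B (index_enum :: 'n list)" for \<alpha> :: "'n \<Rightarrow> nat"
  have ltB: "\<alpha> j < B" if "\<alpha> \<in> Poly_Mapping.keys P" for \<alpha> j
  proof -
    have "\<alpha> j \<le> sum \<alpha> UNIV" by (rule member_le_sum) auto
    also have "\<dots> \<le> (\<Sum>\<alpha>\<in>Poly_Mapping.keys P. sum \<alpha> UNIV)" by (rule member_le_sum) (use that in auto)
    finally show ?thesis by (simp add: B_def)
  qed
  have Linj: "\<alpha> = \<alpha>'" if "\<alpha> \<in> Poly_Mapping.keys P" "\<alpha>' \<in> Poly_Mapping.keys P" "L \<alpha> = L \<alpha>'" for \<alpha> \<alpha>'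
    using horner_sum_inj[of \<alpha> B index_enum \<alpha>'] that ltB by (auto simp: L_def index_enum)
  have "Poly_Mapping.keys P \<noteq> {}" using P by simp
  then obtain \<alpha>0 where \<alpha>0: "\<alpha>0 \<in> Poly_Mapping.keys P" "\<And>\<alpha>. \<alpha> \<in> Poly_Mapping.keys P \<Longrightarrow> L \<alpha>0 \<le> L \<alpha>"
    using arg_min_if_finite[OF finite_keys, of P L] by (metis not_le)
  show ?thesis
  proof (induction "L \<beta>" arbitrary: \<beta> rule: less_induct)
    case less
    let ?\<psi> = "monomial a (\<lambda>j. \<beta> j + \<alpha>0 j)"
    have "\<forall>\<alpha>. \<exists>c. (\<forall>x. derivs (rev (index_list \<alpha>)) ?\<psi> x = c * monomial a (\<lambda>j. \<beta> j + \<alpha>0 j - \<alpha> j) x) \<and>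
        (c \<noteq> 0 \<longleftrightarrow> (\<forall>j. \<alpha> j \<le> \<beta> j + \<alpha>0 j))"
      using derivs_monomial[of "rev (index_list _)" a "\<lambda>j. \<beta> j + \<alpha>0 j"] by (simp add: count_index_list)
    then obtain c where c: "\<And>\<alpha> x. derivs (rev (index_list \<alpha>)) ?\<psi> x = c \<alpha> * monomial a (\<lambda>j. \<beta> j + \<alpha>0 j - \<alpha> j) x"
        "\<And>\<alpha>. c \<alpha> \<noteq> 0 \<longleftrightarrow> (\<forall>j. \<alpha> j \<le> \<beta> j + \<alpha>0 j)"
      by metis
    let ?k = "\<lambda>\<alpha>. Poly_Mapping.lookup P \<alpha> * \<i> ^ sum \<alpha> UNIV * c \<alpha>"
    have eq: "transposed_op P ?\<psi> = (\<lambda>x. \<Sum>\<alpha>\<in>Poly_Mapping.keys P. ?k \<alpha> * monomial a (\<lambda>j. \<beta> j + \<alpha>0 j - \<alpha> j) x)"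
      by (simp add: transposed_op_def[abs_def] c(1) mult.assoc)
    have "0 = T (transposed_op P ?\<psi>)" using z[OF smooth_monomial[OF open_UNIV]] by simp
    also have "\<dots> = (\<Sum>\<alpha>\<in>Poly_Mapping.keys P. T (\<lambda>x. ?k \<alpha> * monomial a (\<lambda>j. \<beta> j + \<alpha>0 j - \<alpha> j) x))"
      unfolding eq by (rule smooth_functional_sum[OF T open_UNIV]) (intro smooth_on_cmult smooth_monomial open_UNIV)
    also have "\<dots> = (\<Sum>\<alpha>\<in>Poly_Mapping.keys P. ?k \<alpha> * T (monomial a (\<lambda>j. \<beta> j + \<alpha>0 j - \<alpha> j)))"
      by (intro sum.cong refl smooth_functional_cmult[OF T] smooth_monomial open_UNIV)
    finally have sum0: "(\<Sum>\<alpha>\<in>Poly_Mapping.keys P. ?k \<alpha> * T (monomial a (\<lambda>j. \<beta> j + \<alpha>0 j - \<alpha> j))) = 0" ..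
    have rest: "?k \<alpha> * T (monomial a (\<lambda>j. \<beta> j + \<alpha>0 j - \<alpha> j)) = 0"
      if \<alpha>: "\<alpha> \<in> Poly_Mapping.keys P - {\<alpha>0}" for \<alpha>
    proof (cases "c \<alpha> = 0")
      case False
      then have le: "\<alpha> j \<le> \<beta> j + \<alpha>0 j" for j using c(2) by auto
      have "L (\<lambda>j. \<beta> j + \<alpha>0 j - \<alpha> j) + L \<alpha> = L (\<lambda>j. (\<beta> j + \<alpha>0 j - \<alpha> j) + \<alpha> j)"
        unfolding L_def by (rule horner_sum_add[symmetric])
      also have "\<dots> = L (\<lambda>j. \<beta> j + \<alpha>0 j)" using le by simp
      also have "\<dots> = L \<beta> + L \<alpha>0" unfolding L_def by (rule horner_sum_add)
      finally have "L (\<lambda>j. \<beta> j + \<alpha>0 j - \<alpha> j) + L \<alpha> = L \<beta> + L \<alpha>0" .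
      moreover have "L \<alpha>0 < L \<alpha>" using \<alpha> \<alpha>0 Linj[of \<alpha> \<alpha>0] by (metis DiffE le_neq_implies_less singletonI)
      ultimately show ?thesis using less[of "\<lambda>j. \<beta> j + \<alpha>0 j - \<alpha> j"] by simp
    qed simp
    have "(\<Sum>\<alpha>\<in>Poly_Mapping.keys P. ?k \<alpha> * T (monomial a (\<lambda>j. \<beta> j + \<alpha>0 j - \<alpha> j)))
       = ?k \<alpha>0 * T (monomial a (\<lambda>j. \<beta> j + \<alpha>0 j - \<alpha>0 j))
        + (\<Sum>\<alpha>\<in>Poly_Mapping.keys P - {\<alpha>0}. ?k \<alpha> * T (monomial a (\<lambda>j. \<beta> j + \<alpha>0 j - \<alpha> j)))"
      by (rule sum.remove) (use \<alpha>0 in auto)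
    also have "(\<Sum>\<alpha>\<in>Poly_Mapping.keys P - {\<alpha>0}. ?k \<alpha> * T (monomial a (\<lambda>j. \<beta> j + \<alpha>0 j - \<alpha> j))) = 0"
      by (rule sum.neutral) (use rest in blast)
    finally have "?k \<alpha>0 * T (monomial a \<beta>) = 0" using sum0 by simp
    moreover have "?k \<alpha>0 \<noteq> 0" using \<alpha>0(1) c(2)[of \<alpha>0] by (simp add: in_keys_iff)
    ultimately show ?case by simp
  qed
qed

section \<open>Density of polynomials with all derivatives\<close>

definition landau_kernel :: "real \<Rightarrow> nat \<Rightarrow> real^'n::finite \<Rightarrow> real" where
  "landau_kernel R m y = (1 - (norm y)\<^sup>2 / R\<^sup>2) ^ m"

lemma landau_translation_kernel:
  "translation_kernel lborel (\<lambda>y. 1 *\<^sub>R y) (\<lambda>y::real^'n::finite. complex_of_real (landau_kernel R m y))"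
  unfolding landau_kernel_def divide_inverse by (intro kernel_continuous continuous_intros) auto

abbreviation landau_integral :: "real \<Rightarrow> nat \<Rightarrow> (real^'n::finite \<Rightarrow> complex) \<Rightarrow> real^'n \<Rightarrow> complex" where
  "landau_integral R m \<equiv> translation_integral lborel (\<lambda>y. 1 *\<^sub>R y) (\<lambda>y. complex_of_real (landau_kernel R m y))"

lemma smooth_landau_integral: "\<phi> \<in> test_functions \<Longrightarrow> smooth_on UNIV (landau_integral R m \<phi>)"
  by (rule smooth_translation_integral[OF landau_translation_kernel])

lemma landau_integrable:
  assumes "\<phi> \<in> test_functions"
  shows "integrable lborel (\<lambda>y. complex_of_real (landau_kernel R m y) * \<phi> (x + y))"
  using translation_integrable[OF landau_translation_kernel assms, of R m x] by simp

lemma landau_integral_Suc: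
  fixes \<phi> :: "real^'n::finite \<Rightarrow> complex" and a x :: "real^'n"
  assumes \<phi>: "\<phi> \<in> test_functions"
  defines "u \<equiv> \<lambda>j z. complex_of_real (z $ j - a $ j)"
  shows "landau_integral R (Suc m) \<phi> x = landau_integral R m \<phi> x - (\<Sum>j\<in>UNIV. 1 / of_real (R\<^sup>2) *
     (landau_integral R m (\<lambda>z. u j z ^ 2 * \<phi> z) x - 2 * u j x * landau_integral R m (\<lambda>z. u j z * \<phi> z) x
       + u j x ^ 2 * landau_integral R m \<phi> x))"
proof -
  let ?k = "\<lambda>y. complex_of_real (landau_kernel R m y)"
  have t1: "(\<lambda>z. u j z * \<phi> z) \<in> test_functions" and t2: "(\<lambda>z. u j z ^ 2 * \<phi> z) \<in> test_functions" for j
    unfolding u_def by (intro test_mult \<phi> smooth_on_power smooth_on_coord open_UNIV)+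
  note i0 = landau_integrable[OF \<phi>, of R m x]
  note i1 = landau_integrable[OF t1, of R m _ x]
  note i2 = landau_integrable[OF t2, of R m _ x]
  have pt: "of_real (landau_kernel R (Suc m) y) * \<phi> (x + y) = ?k y * \<phi> (x + y) - (\<Sum>j\<in>UNIV. 1 / of_real (R\<^sup>2) *
     (?k y * (u j (x + y) ^ 2 * \<phi> (x + y)) - 2 * u j x * (?k y * (u j (x + y) * \<phi> (x + y)))
       + u j x ^ 2 * (?k y * \<phi> (x + y))))" for y
  proof -
    have "complex_of_real ((norm y)\<^sup>2) = (\<Sum>j\<in>UNIV. of_real ((y $ j)\<^sup>2))"
      by (simp add: norm_vec_def L2_set_def sum_nonneg flip: of_real_power of_real_sum)
    also have "\<dots> = (\<Sum>j\<in>UNIV. (u j (x + y) - u j x)\<^sup>2)" by (simp add: u_def flip: of_real_diff of_real_power)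
    finally have n: "complex_of_real ((norm y)\<^sup>2) = (\<Sum>j\<in>UNIV. (u j (x + y) - u j x)\<^sup>2)" .
    have "of_real (landau_kernel R (Suc m) y) = ?k y - of_real ((norm y)\<^sup>2) * (1 / of_real (R\<^sup>2) * ?k y)"
      by (simp add: landau_kernel_def algebra_simps)
    then have "of_real (landau_kernel R (Suc m) y) * \<phi> (x + y)
       = ?k y * \<phi> (x + y) - (\<Sum>j\<in>UNIV. (u j (x + y) - u j x)\<^sup>2 * (1 / of_real (R\<^sup>2) * ?k y * \<phi> (x + y)))"
      unfolding n by (simp add: left_diff_distrib sum_distrib_right sum_divide_distrib mult.assoc)
    then show ?thesis
      by (simp add: power2_diff algebra_simps power2_eq_square)
  qed
  have int: "integrable lborel (\<lambda>y. 1 / of_real (R\<^sup>2) *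
     (?k y * (u j (x + y) ^ 2 * \<phi> (x + y)) - 2 * u j x * (?k y * (u j (x + y) * \<phi> (x + y)))
       + u j x ^ 2 * (?k y * \<phi> (x + y))))" for j
    by (intro integrable_mult_right Bochner_Integration.integrable_add Bochner_Integration.integrable_diff i0 i1 i2)
  have "landau_integral R (Suc m) \<phi> x = (LINT y|lborel. ?k y * \<phi> (x + y) - (\<Sum>j\<in>UNIV. 1 / of_real (R\<^sup>2) *
     (?k y * (u j (x + y) ^ 2 * \<phi> (x + y)) - 2 * u j x * (?k y * (u j (x + y) * \<phi> (x + y)))
       + u j x ^ 2 * (?k y * \<phi> (x + y)))))"
    unfolding translation_integral_def scaleR_one by (intro Bochner_Integration.integral_cong refl pt)
  also have "\<dots> = (LINT y|lborel. ?k y * \<phi> (x + y)) - (\<Sum>j\<in>UNIV. LINT y|lborel. 1 / of_real (R\<^sup>2) *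
     (?k y * (u j (x + y) ^ 2 * \<phi> (x + y)) - 2 * u j x * (?k y * (u j (x + y) * \<phi> (x + y)))
       + u j x ^ 2 * (?k y * \<phi> (x + y))))"
    by (subst Bochner_Integration.integral_diff[OF i0]) (intro Bochner_Integration.integrable_sum int,
        subst Bochner_Integration.integral_sum[OF int], rule refl)
  also have "(\<lambda>j. LINT y|lborel. 1 / of_real (R\<^sup>2) *
     (?k y * (u j (x + y) ^ 2 * \<phi> (x + y)) - 2 * u j x * (?k y * (u j (x + y) * \<phi> (x + y)))
       + u j x ^ 2 * (?k y * \<phi> (x + y)))) = (\<lambda>j. 1 / of_real (R\<^sup>2) *
     ((LINT y|lborel. ?k y * (u j (x + y) ^ 2 * \<phi> (x + y))) - 2 * u j x * (LINT y|lborel. ?k y * (u j (x + y) * \<phi> (x + y)))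
       + u j x ^ 2 * (LINT y|lborel. ?k y * \<phi> (x + y))))"
  proof
    fix j
    show "(LINT y|lborel. 1 / of_real (R\<^sup>2) *
       (?k y * (u j (x + y) ^ 2 * \<phi> (x + y)) - 2 * u j x * (?k y * (u j (x + y) * \<phi> (x + y)))
         + u j x ^ 2 * (?k y * \<phi> (x + y)))) = 1 / of_real (R\<^sup>2) *
       ((LINT y|lborel. ?k y * (u j (x + y) ^ 2 * \<phi> (x + y))) - 2 * u j x * (LINT y|lborel. ?k y * (u j (x + y) * \<phi> (x + y)))
         + u j x ^ 2 * (LINT y|lborel. ?k y * \<phi> (x + y)))"
      by (simp only: integral_mult_right_zero
          Bochner_Integration.integral_add[OF Bochner_Integration.integrable_diff[OF i2 integrable_mult_right[OF i1]] integrable_mult_right[OF i0]]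
          Bochner_Integration.integral_diff[OF i2 integrable_mult_right[OF i1]])
  qed
  finally show ?thesis unfolding translation_integral_def scaleR_one .
qed

text \<open>Convolution with the polynomial \<open>landau_kernel R m\<close> yields polynomials; instead of expanding
  them, the kernels are built up one factor at a time.\<close>

lemma vanishes_on_landau_integral:
  fixes T :: "'n::finite functional"
  assumes T: "smooth_functional UNIV K T" and z: "\<And>\<beta>. T (monomial a \<beta>) = 0" and \<phi>: "\<phi> \<in> test_functions"
  shows "T (\<lambda>x. monomial a \<beta> x * landau_integral R m \<phi> x) = 0"
  using \<phi>
proof (induction m arbitrary: \<beta> \<phi>)
  case 0
  have "landau_integral R 0 \<phi> x = (LINT y|lborel. \<phi> y)" for x
    using lborel_integral_translate_reflect(1)[of 1 \<phi> x] test_borel[OF 0]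
    by (simp add: translation_integral_def landau_kernel_def)
  then have "(\<lambda>x. monomial a \<beta> x * landau_integral R 0 \<phi> x) = (\<lambda>x. (LINT y|lborel. \<phi> y) * monomial a \<beta> x)"
    by (simp add: mult.commute)
  then show ?case using smooth_functional_cmult[OF T smooth_monomial[OF open_UNIV]] z by simp
next
  case (Suc m)
  let ?u = "\<lambda>j z. complex_of_real (z $ j - a $ j)"
  let ?I = "\<lambda>\<phi>. landau_integral R m \<phi>"
  have t1: "(\<lambda>z. ?u j z * \<phi> z) \<in> test_functions" and t2: "(\<lambda>z. ?u j z ^ 2 * \<phi> z) \<in> test_functions" for j
    by (intro test_mult Suc.prems smooth_on_power smooth_on_coord open_UNIV)+
  have up: "monomial a \<beta> x * ?u j x = monomial a (\<beta>(j := Suc (\<beta> j))) x" for \<beta> j x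
    by (simp only: monomial_Suc mult.commute)
  define g where "g j x = monomial a \<beta> x * ?I (\<lambda>z. ?u j z ^ 2 * \<phi> z) x
      - 2 * (monomial a (\<beta>(j := Suc (\<beta> j))) x * ?I (\<lambda>z. ?u j z * \<phi> z) x)
      + monomial a (\<beta>(j := Suc (Suc (\<beta> j)))) x * ?I \<phi> x" for j x
  have up2: "monomial a \<beta> x * ?u j x ^ 2 = monomial a (\<beta>(j := Suc (Suc (\<beta> j)))) x" for j x
    using up[of \<beta> x j] up[of "\<beta>(j := Suc (\<beta> j))" x j] by (simp add: power2_eq_square mult.assoc[symmetric] del: of_real_diff)
  have s: "smooth_on UNIV (\<lambda>x. monomial a \<gamma> x * ?I \<psi> x)" if "\<psi> \<in> test_functions" for \<gamma> \<psi>
    by (intro smooth_on_mult smooth_monomial smooth_landau_integral that open_UNIV)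
  have sg: "smooth_on UNIV (g j)" for j
    unfolding g_def[abs_def] by (intro smooth_on_add smooth_on_diff smooth_on_cmult s t1 t2 Suc.prems open_UNIV)
  have Tg: "T (g j) = 0" for j
  proof -
    let ?A = "\<lambda>x. monomial a \<beta> x * ?I (\<lambda>z. ?u j z ^ 2 * \<phi> z) x"
    let ?B = "\<lambda>x. monomial a (\<beta>(j := Suc (\<beta> j))) x * ?I (\<lambda>z. ?u j z * \<phi> z) x"
    let ?C = "\<lambda>x. monomial a (\<beta>(j := Suc (Suc (\<beta> j)))) x * ?I \<phi> x"
    have sA: "smooth_on UNIV ?A" and sB: "smooth_on UNIV ?B" and sC: "smooth_on UNIV ?C"
      by (intro s t1 t2 Suc.prems)+
    have "T (g j) = T (\<lambda>x. ?A x - 2 * ?B x) + T ?C"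
      unfolding g_def[abs_def]
      by (rule smooth_functional_add[OF T]) (intro smooth_on_diff smooth_on_cmult sA sB sC open_UNIV)+
    also have "T (\<lambda>x. ?A x - 2 * ?B x) = T ?A - T (\<lambda>x. 2 * ?B x)"
      by (rule smooth_functional_diff[OF T]) (intro smooth_on_cmult sA sB open_UNIV)+
    also have "T (\<lambda>x. 2 * ?B x) = 2 * T ?B" by (rule smooth_functional_cmult[OF T sB])
    finally show ?thesis
      using Suc.IH[OF t2] Suc.IH[OF t1] Suc.IH[OF Suc.prems] by simp
  qed
  have eq: "(\<lambda>x. monomial a \<beta> x * landau_integral R (Suc m) \<phi> x)
      = (\<lambda>x. monomial a \<beta> x * ?I \<phi> x - (\<Sum>j\<in>UNIV. 1 / of_real (R\<^sup>2) * g j x))"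
  proof
    fix x
    show "monomial a \<beta> x * landau_integral R (Suc m) \<phi> x
      = monomial a \<beta> x * ?I \<phi> x - (\<Sum>j\<in>UNIV. 1 / of_real (R\<^sup>2) * g j x)"
      unfolding landau_integral_Suc[OF Suc.prems, of R m x a] g_def up[symmetric] up2[symmetric]
      by (simp only: right_diff_distrib sum_distrib_left distrib_left mult.assoc mult.left_commute)
  qed
  have "T (\<lambda>x. monomial a \<beta> x * landau_integral R (Suc m) \<phi> x) = T (\<lambda>x. monomial a \<beta> x * ?I \<phi> x)
     - T (\<lambda>x. \<Sum>j\<in>UNIV. 1 / of_real (R\<^sup>2) * g j x)"
    unfolding eq by (rule smooth_functional_diff[OF T]) (intro smooth_on_sum smooth_on_cmult s sg Suc.prems open_UNIV)+
  also have "T (\<lambda>x. \<Sum>j\<in>UNIV. 1 / of_real (R\<^sup>2) * g j x) = (\<Sum>j\<in>UNIV. T (\<lambda>x. 1 / of_real (R\<^sup>2) * g j x))"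
    by (rule smooth_functional_sum[OF T open_UNIV]) (intro smooth_on_cmult sg open_UNIV)
  also have "\<dots> = 0" by (simp only: smooth_functional_cmult[OF T sg] Tg) simp
  finally show ?case using Suc.IH[OF Suc.prems] by simp
qed

definition landau_mass :: "real \<Rightarrow> nat \<Rightarrow> 'n::finite itself \<Rightarrow> real" where
  "landau_mass R m _ = (LINT y|lborel. indicator (cball (0::real^'n) R) y * landau_kernel R m y)"

text \<open>The first absolute moment of the normalised kernel tends to zero. The part where \<open>|y| > d\<close> is
  negligible compared with the mass of \<open>|y| \<le> d/2\<close>, because there the base of the \<open>m\<close>-th power is
  bounded below by a larger constant.\<close>

lemma landau_concentrates:
  fixes R e :: real
  assumes R: "R > 0" and e: "e > 0"
  shows "\<forall>m. landau_mass R m TYPE('n::finite) > 0"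
    and "\<forall>\<^sub>F m in sequentially. (LINT y|lborel. indicator (cball (0::real^'n) R) y * (landau_kernel R m y * norm y))
       \<le> e * landau_mass R m TYPE('n)"
proof -
  let ?B = "cball (0::real^'n) R"
  let ?k = "\<lambda>m y::real^'n. landau_kernel R m y"
  have cont: "continuous_on S (?k m)" for m S unfolding landau_kernel_def by (intro continuous_intros) (use R in auto)
  have i1: "integrable lborel (\<lambda>y. indicator ?B y * ?k m y)" for m
    by (rule integrable_continuous_compact) (auto intro: cont)
  have i2: "integrable lborel (\<lambda>y. indicator ?B y * (?k m y * norm y))" for m
    by (rule integrable_continuous_compact) (auto intro!: continuous_intros cont)
  have sq: "(norm y)\<^sup>2 / R\<^sup>2 \<le> 1" if "norm y \<le> R" for y :: "real^'n"
    using power_mono[OF that norm_ge_zero, of 2] R by simp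
  have k0: "?k m y \<ge> 0" if "norm y \<le> R" for m y
    unfolding landau_kernel_def using sq[OF that] by simp
  have kd: "?k m y \<ge> (1 - d\<^sup>2 / R\<^sup>2) ^ m" if "norm y \<le> d" "d \<le> R" for m d y
  proof -
    have "(norm y)\<^sup>2 \<le> d\<^sup>2" "d\<^sup>2 \<le> R\<^sup>2" using that by (auto intro!: power_mono order_trans[OF norm_ge_zero that(1)])
    then show ?thesis unfolding landau_kernel_def using R
      by (intro power_mono) (auto intro!: divide_right_mono)
  qed
  have ku: "?k m y \<le> (1 - d\<^sup>2 / R\<^sup>2) ^ m" if "0 \<le> d" "d \<le> norm y" "norm y \<le> R" for m d y
  proof -
    have "d\<^sup>2 \<le> (norm y)\<^sup>2" using that by (auto intro!: power_mono)
    then show ?thesis unfolding landau_kernel_def using sq[OF that(3)]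
      by (intro power_mono) (auto intro!: divide_right_mono)
  qed
  define vol where "vol r = measure lborel (cball (0::real^'n) r)" for r
  have vol_int: "integrable lborel (indicator (cball (0::real^'n) r) :: _ \<Rightarrow> real)"
    "(LINT y|lborel. indicator (cball (0::real^'n) r) y) = vol r" for r
    using emeasure_bounded_finite[OF bounded_cball[of "0::real^'n" r]] by (auto simp: vol_def integrable_indicator_iff)
  have vol_pos: "vol r > 0" if "r > 0" for r
    using content_cball_pos[OF that, of "0::real^'n"] by (simp add: vol_def)
  have lower: "landau_mass R m TYPE('n) \<ge> vol d * (1 - d\<^sup>2 / R\<^sup>2) ^ m" if "0 < d" "d \<le> R" for d m
  proof -
    have "vol d * (1 - d\<^sup>2 / R\<^sup>2) ^ m = (LINT y|lborel. indicator (cball (0::real^'n) d) y * (1 - d\<^sup>2 / R\<^sup>2) ^ m)"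
      using vol_int[of d] by simp
    also have "\<dots> \<le> (LINT y|lborel. indicator ?B y * ?k m y)"
    proof (rule integral_mono)
      show "integrable lborel (\<lambda>y. indicator (cball (0::real^'n) d) y * (1 - d\<^sup>2 / R\<^sup>2) ^ m)" using vol_int by simp
      show "indicator (cball (0::real^'n) d) y * (1 - d\<^sup>2 / R\<^sup>2) ^ m \<le> indicator ?B y * ?k m y" for y
        using kd[of y d m] k0[of y m] that by (auto simp: indicator_def)
    qed (rule i1)
    finally show ?thesis by (simp add: landau_mass_def)
  qed
  show pos: "\<forall>m. landau_mass R m TYPE('n) > 0"
  proof
    fix m
    have "(1 - (R/2)\<^sup>2 / R\<^sup>2) ^ m > 0" using R by (simp add: power_divide)
    then have "0 < vol (R/2) * (1 - (R/2)\<^sup>2 / R\<^sup>2) ^ m" using vol_pos[of "R/2"] R by simp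
    also have "\<dots> \<le> landau_mass R m TYPE('n)" by (rule lower) (use R in auto)
    finally show "landau_mass R m TYPE('n) > 0" .
  qed
  define d where "d = min (e/2) R"
  have d: "0 < d" "d \<le> R" "d \<le> e/2" using e R by (auto simp: d_def)
  define q1 where "q1 = 1 - d\<^sup>2 / R\<^sup>2"
  define q2 where "q2 = 1 - (d/2)\<^sup>2 / R\<^sup>2"
  have dR: "d\<^sup>2 \<le> R\<^sup>2" "0 < d\<^sup>2" "0 < R\<^sup>2" using d R by (auto intro: power_mono)
  have "d\<^sup>2 / R\<^sup>2 \<le> 1" "0 < d\<^sup>2 / R\<^sup>2" using dR by auto
  then have q: "0 \<le> q1" "q1 < q2" "0 < q2"
    by (simp_all add: q1_def q2_def power_divide)
  have up: "(LINT y|lborel. indicator ?B y * (?k m y * norm y)) \<le> d * landau_mass R m TYPE('n) + R * vol R * q1 ^ m" for m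
  proof -
    have "(LINT y|lborel. indicator ?B y * (?k m y * norm y)) \<le> (LINT y|lborel. d * (indicator ?B y * ?k m y) + (R * q1 ^ m) * indicator ?B y)"
    proof (rule integral_mono[OF i2])
      show "integrable lborel (\<lambda>y. d * (indicator ?B y * ?k m y) + (R * q1 ^ m) * indicator ?B y)"
        using i1 vol_int by (intro Bochner_Integration.integrable_add integrable_mult_right) auto
      fix y
      show "indicator ?B y * (?k m y * norm y) \<le> d * (indicator ?B y * ?k m y) + (R * q1 ^ m) * indicator ?B y"
      proof (cases "norm y \<le> R")
        case True
        have "?k m y * norm y \<le> d * ?k m y + R * q1 ^ m"
        proof (cases "norm y \<le> d")
          case True
          then have "?k m y * norm y \<le> d * ?k m y"
            using k0[OF \<open>norm y \<le> R\<close>, of m] by (simp add: mult.commute mult_right_mono)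
          then show ?thesis using q R by (simp add: add_increasing2)
        next
          case False
          have "?k m y * norm y \<le> q1 ^ m * R"
            using ku[of d y m] False True d k0[of y m] q unfolding q1_def by (intro mult_mono) auto
          then show ?thesis using k0[OF True, of m] d by (simp add: mult.commute add_increasing)
        qed
        then show ?thesis using True by (simp add: indicator_def)
      qed (simp add: indicator_def)
    qed
    also have "\<dots> = d * landau_mass R m TYPE('n) + R * vol R * q1 ^ m"
      using i1[of m] vol_int[of R] by (simp add: landau_mass_def)
    finally show ?thesis .
  qed
  define v where "v = vol (d/2)"
  have v: "v > 0" using vol_pos d by (simp add: v_def)
  have "(\<lambda>m. (R * vol R / v) * (q1 / q2) ^ m) \<longlonglongrightarrow> (R * vol R / v) * 0"
    by (intro tendsto_mult tendsto_const LIMSEQ_realpow_zero) (use q in auto)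
  then have "\<forall>\<^sub>F m in sequentially. (R * vol R / v) * (q1 / q2) ^ m < e/2"
    by (rule order_tendstoD(2)) (use e in simp)
  then show "\<forall>\<^sub>F m in sequentially. (LINT y|lborel. indicator ?B y * (?k m y * norm y)) \<le> e * landau_mass R m TYPE('n)"
  proof eventually_elim
    case (elim m)
    have "R * vol R * q1 ^ m = (R * vol R / v) * (q1 / q2) ^ m * (v * q2 ^ m)"
      using v q by (simp add: power_divide)
    also have "\<dots> \<le> (e/2) * (v * q2 ^ m)"
      using elim v q by (intro mult_right_mono) auto
    also have "\<dots> \<le> (e/2) * landau_mass R m TYPE('n)"
      using lower[of "d/2" m] d e unfolding v_def q2_def by (intro mult_left_mono) auto
    finally have "R * vol R * q1 ^ m \<le> (e/2) * landau_mass R m TYPE('n)" .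
    moreover have "d * landau_mass R m TYPE('n) \<le> (e/2) * landau_mass R m TYPE('n)"
      using d pos by (intro mult_right_mono) (auto simp: less_imp_le)
    ultimately show ?case using up[of m] by (simp add: field_simps)
  qed
qed

text \<open>Convolution commutes with differentiation, so uniform convergence of the convolutions with
  the kernels, applied to every derivative of \<open>\<phi>\<close>, approximates \<open>\<phi>\<close> with all derivatives.\<close>

lemma vanishes_on_tests_if_on_monomials:
  fixes T :: "'n::finite functional"
  assumes T: "smooth_functional UNIV K T" and z: "\<And>\<beta>. T (monomial a \<beta>) = 0" and \<phi>: "\<phi> \<in> test_functions"
  shows "T \<phi> = 0"
proof -
  have "bounded (K \<union> fun_support \<phi>)"
    using compact_imp_bounded[OF smooth_functional_compact[OF T]] compact_imp_bounded[OF test_compact[OF \<phi>]] by simp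
  then obtain r where r: "\<And>x. x \<in> K \<union> fun_support \<phi> \<Longrightarrow> norm x \<le> r" unfolding bounded_iff by blast
  define R where "R = 2 * \<bar>r\<bar> + 1"
  have R: "R > 0" by (simp add: R_def)
  let ?B = "cball (0::real^'n) R"
  define c where "c m = landau_mass R m TYPE('n)" for m
  have c: "c m > 0" for m using landau_concentrates(1)[where 'n='n, OF R zero_less_one] by (simp add: c_def)
  define p where "p m x = (1 / of_real (c m)) * landau_integral R m \<phi> x" for m x
  have sI: "smooth_on UNIV (landau_integral R m \<phi>)" for m by (rule smooth_landau_integral[OF \<phi>])
  have sp: "smooth_on UNIV (p m)" for m unfolding p_def[abs_def] by (rule smooth_on_cmult[OF open_UNIV sI])
  have Tp: "T (p m) = 0" for m
  proof -
    have eq: "(\<lambda>x. monomial a (\<lambda>_. 0) x * landau_integral R m \<phi> x) = landau_integral R m \<phi>"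
      by (simp add: monomial_def)
    have "T (landau_integral R m \<phi>) = 0"
      using vanishes_on_landau_integral[OF T z \<phi>, of "\<lambda>_. 0" R m] unfolding eq .
    then show ?thesis unfolding p_def[abs_def] smooth_functional_cmult[OF T sI] by (simp only: mult_zero_right)
  qed
  have "(\<lambda>m. T (p m)) \<longlonglongrightarrow> T \<phi>"
  proof (rule smooth_functional_tendsto[OF T open_UNIV sp test_smooth[OF \<phi>]])
    fix js :: "'n list" and e :: real assume e: "e > 0"
    define \<psi> where "\<psi> = derivs js \<phi>"
    have \<psi>: "\<psi> \<in> test_functions" unfolding \<psi>_def by (rule test_derivs[OF \<phi>])
    obtain C where C: "C \<ge> 0" "\<And>x y. cmod (\<psi> x - \<psi> y) \<le> C * norm (x - y)"
      using test_lipschitz[OF \<psi>] by metis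
    define e' where "e' = e / (C + 1)"
    have e': "e' > 0" "C * e' \<le> e"
      using e C by (auto simp: e'_def field_simps)
    show "\<forall>\<^sub>F m in sequentially. \<forall>x\<in>K. cmod (derivs js (p m) x - derivs js \<phi> x) \<le> e"
      using landau_concentrates(2)[OF R e'(1), where 'n='n]
    proof eventually_elim
      case (elim m)
      show ?case
      proof
        fix x assume x: "x \<in> K"
        let ?k = "\<lambda>y. complex_of_real (landau_kernel R m y)"
        let ?i = "\<lambda>y. complex_of_real (indicator ?B y * landau_kernel R m y)"
        have cont: "continuous_on S (\<lambda>y::real^'n. landau_kernel R m y)" for S
          unfolding landau_kernel_def by (intro continuous_intros) (use R in auto)
        have off: "\<psi> (x + y) = 0" if "y \<notin> ?B" for y
        proof -
          have "x + y \<notin> fun_support \<phi>"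
          proof
            assume "x + y \<in> fun_support \<phi>"
            then have "norm (x + y) \<le> r" "norm x \<le> r" using r x by auto
            then show False using that norm_triangle_ineq4[of "x + y" x] by (simp add: R_def)
          qed
          then show ?thesis unfolding \<psi>_def by (rule derivs_zero_off_support)
        qed
        have ii: "integrable lborel ?i"
          by (intro integrable_of_real integrable_continuous_compact cont) auto
        have i\<psi>: "integrable lborel (\<lambda>y. ?i y * \<psi> (x + y))"
        proof (rule Bochner_Integration.integrable_cong[THEN iffD1, OF refl _ landau_integrable[OF \<psi>, of R m x]])
          show "?k y * \<psi> (x + y) = ?i y * \<psi> (x + y)" for y
            using off[of y] by (cases "y \<in> ?B") auto
        qed
        have dI: "derivs js (p m) x = (1 / of_real (c m)) * landau_integral R m \<psi> x"
          unfolding p_def[abs_def] derivs_cmult[OF open_UNIV sI UNIV_I] \<psi>_def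
          by (simp only: derivs_translation_integral[OF landau_translation_kernel \<phi>])
        have "landau_integral R m \<psi> x = (LINT y|lborel. ?i y * \<psi> (x + y))"
          unfolding translation_integral_def scaleR_one
        proof (rule Bochner_Integration.integral_cong[OF refl])
          show "?k y * \<psi> (x + y) = ?i y * \<psi> (x + y)" for y
            using off[of y] by (cases "y \<in> ?B") auto
        qed
        moreover have "of_real (c m) = (LINT y|lborel. ?i y)"
          unfolding c_def landau_mass_def by (rule integral_complex_of_real[symmetric])
        ultimately have "landau_integral R m \<psi> x - of_real (c m) * \<psi> x = (LINT y|lborel. ?i y * \<psi> (x + y) - ?i y * \<psi> x)"
          using Bochner_Integration.integral_diff[OF i\<psi> integrable_mult_left[OF ii, of "\<psi> x"]] by simp
        also have "cmod \<dots> \<le> (LINT y|lborel. cmod (?i y * \<psi> (x + y) - ?i y * \<psi> x))"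
          by (rule integral_norm_bound)
        also have "\<dots> \<le> (LINT y|lborel. C * (indicator ?B y * (landau_kernel R m y * norm y)))"
        proof (rule integral_mono)
          show "integrable lborel (\<lambda>y. cmod (?i y * \<psi> (x + y) - ?i y * \<psi> x))"
            by (intro integrable_norm Bochner_Integration.integrable_diff i\<psi> integrable_mult_left ii)
          show "integrable lborel (\<lambda>y. C * (indicator ?B y * (landau_kernel R m y * norm y)))"
            by (intro integrable_mult_right integrable_continuous_compact continuous_intros cont) auto
          fix y
          show "cmod (?i y * \<psi> (x + y) - ?i y * \<psi> x) \<le> C * (indicator ?B y * (landau_kernel R m y * norm y))"
          proof (cases "y \<in> ?B")
            case True
            then have "landau_kernel R m y \<ge> 0"
              using power_mono[of "norm y" R 2] R unfolding landau_kernel_def by simp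
            then have "cmod (?i y * \<psi> (x + y) - ?i y * \<psi> x) = landau_kernel R m y * cmod (\<psi> (x + y) - \<psi> x)"
              using True by (simp add: norm_mult flip: right_diff_distrib)
            also have "\<dots> \<le> landau_kernel R m y * (C * norm y)"
              using C(2)[of "x + y" x] \<open>landau_kernel R m y \<ge> 0\<close> by (intro mult_left_mono) auto
            finally show ?thesis using True by (simp add: mult_ac)
          qed simp
        qed
        also have "\<dots> \<le> C * (e' * c m)" using elim C(1) by (simp add: c_def mult_left_mono)
        also have "\<dots> \<le> e * c m" using e'(2) c[of m] by (simp add: mult.assoc[symmetric] mult_right_mono)
        finally have bd: "cmod (landau_integral R m \<psi> x - of_real (c m) * \<psi> x) \<le> e * c m" .
        have "derivs js (p m) x - derivs js \<phi> x = (1 / of_real (c m)) * (landau_integral R m \<psi> x - of_real (c m) * \<psi> x)"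
          using c[of m] by (simp add: dI \<psi>_def[symmetric] right_diff_distrib)
        then have "cmod (derivs js (p m) x - derivs js \<phi> x) = cmod (landau_integral R m \<psi> x - of_real (c m) * \<psi> x) / c m"
          using c[of m] by (simp add: norm_mult norm_divide)
        then show "cmod (derivs js (p m) x - derivs js \<phi> x) \<le> e"
          using bd c[of m] by (simp add: divide_le_eq)
      qed
    qed
  qed
  then show ?thesis using Tp by (simp add: LIMSEQ_const_iff)
qed

section \<open>Derivatives of powers of the distance\<close>

definition dist_power :: "real^'n::finite \<Rightarrow> real \<Rightarrow> real^'n \<Rightarrow> complex" where
  "dist_power a s x = of_real ((norm (x - a))\<^sup>2 powr s)"

lemma cmod_dist_power: "cmod (dist_power a s x) = (norm (x - a))\<^sup>2 powr s"
  unfolding dist_power_def norm_of_real by simp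

lemma smooth_dist_power: "smooth_on (- {a}) (dist_power a s)"
  unfolding dist_power_def[abs_def]
  by (rule smooth_on_powr[OF _ smooth_on_norm_sq]) auto

lemma partial_deriv_norm_sq:
  fixes a x :: "real^'n::finite"
  shows "partial_deriv j (\<lambda>x. complex_of_real ((norm (x - a))\<^sup>2)) x = 2 * of_real (x $ j - a $ j)"
proof -
  have eq: "(\<lambda>x::real^'n. complex_of_real ((norm (x - a))\<^sup>2)) = (\<lambda>x. \<Sum>i\<in>UNIV. (complex_of_real (x $ i - a $ i))\<^sup>2)"
    by (simp add: norm_vec_def L2_set_def sum_nonneg flip: of_real_power of_real_diff of_real_sum)
  have "partial_deriv j (\<lambda>x::real^'n. complex_of_real ((norm (x - a))\<^sup>2)) x
      = (\<Sum>i\<in>UNIV. partial_deriv j (\<lambda>x. (complex_of_real (x $ i - a $ i))\<^sup>2) x)"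
    unfolding eq using derivs_sum[OF open_UNIV, of UNIV "\<lambda>i x. (complex_of_real (x $ i - a $ i))\<^sup>2" x "[j]"]
    by (simp add: smooth_on_power smooth_on_coord del: of_real_diff)
  then show ?thesis
    by (simp add: partial_deriv_coord_power del: of_real_diff)
qed

lemma partial_deriv_dist_power:
  assumes "x \<noteq> a"
  shows "partial_deriv j (dist_power a s) x = 2 * of_real s * of_real (x $ j - a $ j) * dist_power a (s - 1) x"
proof -
  have pos: "(norm (x - a))\<^sup>2 > 0" using assms by simp
  have "((\<lambda>t. t powr s) has_real_derivative s * (norm (x - a))\<^sup>2 powr (s - 1)) (at ((norm (x - a))\<^sup>2))"
    using pos by (auto intro!: derivative_eq_intros)
  from partial_deriv_eq[OF has_derivative_of_real_comp[OF open_UNIV UNIV_I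
      smooth_on_imp_differentiable[OF smooth_on_norm_sq[OF open_UNIV]] this], of j]
  have "partial_deriv j (\<lambda>x. complex_of_real ((norm (x - a))\<^sup>2 powr s)) x
     = of_real (s * (norm (x - a))\<^sup>2 powr (s - 1)) * partial_deriv j (\<lambda>x. complex_of_real ((norm (x - a))\<^sup>2)) x"
    by (simp add: partial_deriv_def)
  then show ?thesis
    unfolding dist_power_def[abs_def] partial_deriv_norm_sq by (simp add: mult_ac)
qed

lemma dist_power_add: "x \<noteq> a \<Longrightarrow> dist_power a s x * dist_power a t x = dist_power a (s + t) x"
  by (simp add: dist_power_def powr_add)

lemma dist_power_0: "x \<noteq> a \<Longrightarrow> dist_power a 0 x = 1"
  by (simp add: dist_power_def)

definition weighted_monomial :: "real^'n::finite \<Rightarrow> ('n \<Rightarrow> nat) \<Rightarrow> real \<Rightarrow> real^'n \<Rightarrow> complex" where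
  "weighted_monomial a \<beta> s x = monomial a \<beta> x * dist_power a s x"

lemma open_compl_point: "open (- {a :: real^'n::finite})"
  by (simp add: open_Compl)

lemma smooth_weighted_monomial: "smooth_on (- {a}) (weighted_monomial a \<beta> s)"
  unfolding weighted_monomial_def[abs_def]
  by (intro smooth_on_mult smooth_dist_power smooth_monomial open_compl_point)

lemma partial_deriv_weighted_monomial:
  assumes "x \<noteq> a"
  shows "partial_deriv j (weighted_monomial a \<beta> s) x = of_nat (\<beta> j) * weighted_monomial a (\<beta>(j := \<beta> j - 1)) s x
     + 2 * of_real s * weighted_monomial a (\<beta>(j := Suc (\<beta> j))) (s - 1) x"
proof -
  have "partial_deriv j (weighted_monomial a \<beta> s) x
    = partial_deriv j (monomial a \<beta>) x * dist_power a s x + monomial a \<beta> x * partial_deriv j (dist_power a s) x"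
    unfolding weighted_monomial_def[abs_def]
    by (rule partial_deriv_mult[OF open_compl_point smooth_on_imp_differentiable[OF smooth_monomial[OF open_compl_point]]
          smooth_on_imp_differentiable[OF smooth_dist_power]]) (use assms in simp)
  then show ?thesis
    using assms by (simp add: partial_deriv_monomial partial_deriv_dist_power weighted_monomial_def monomial_Suc
        algebra_simps del: of_real_diff)
qed

lemma laplacian_dist_power:
  fixes a x :: "real^'n::finite"
  assumes "x \<noteq> a"
  shows "(\<Sum>j\<in>UNIV. partial_deriv j (partial_deriv j (dist_power a s)) x)
     = of_real (2 * s * (real CARD('n) + 2 * s - 2)) * dist_power a (s - 1) x"
proof -
  have U: "x \<in> - {a}" using assms by simp
  have eq: "partial_deriv j (dist_power a s) y = 2 * of_real s * (of_real (y $ j - a $ j) * dist_power a (s - 1) y)"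
    if "y \<in> - {a}" for j y
    using partial_deriv_dist_power[of y a j s] that by (simp add: mult_ac)
  have "partial_deriv j (partial_deriv j (dist_power a s)) x = of_real (2 * s) * dist_power a (s - 1) x
      + of_real (4 * s * (s - 1) * (x $ j - a $ j)\<^sup>2) * dist_power a (s - 1 - 1) x" for j
  proof -
    have sm: "smooth_on (- {a}) (\<lambda>y. complex_of_real (y $ j - a $ j) * dist_power a (s - 1) y)"
      by (intro smooth_on_mult smooth_on_coord smooth_dist_power open_compl_point)
    have "partial_deriv j (partial_deriv j (dist_power a s)) x
       = partial_deriv j (\<lambda>y. 2 * of_real s * (of_real (y $ j - a $ j) * dist_power a (s - 1) y)) x"
      by (rule partial_deriv_cong[OF open_compl_point U eq])
    also have "\<dots> = 2 * of_real s * partial_deriv j (\<lambda>y. of_real (y $ j - a $ j) * dist_power a (s - 1) y) x"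
      by (rule partial_deriv_cmult[OF open_compl_point smooth_on_imp_differentiable[OF sm] U])
    also have "partial_deriv j (\<lambda>y. of_real (y $ j - a $ j) * dist_power a (s - 1) y) x
       = partial_deriv j (\<lambda>y. of_real (y $ j - a $ j)) x * dist_power a (s - 1) x
         + of_real (x $ j - a $ j) * partial_deriv j (dist_power a (s - 1)) x"
      by (rule partial_deriv_mult[OF open_compl_point smooth_on_imp_differentiable[OF smooth_on_coord]
          smooth_on_imp_differentiable[OF smooth_dist_power] U])
    finally show ?thesis
      unfolding partial_deriv_coord partial_deriv_dist_power[OF assms]
      by (simp add: algebra_simps power2_eq_square)
  qed
  then have "(\<Sum>j\<in>UNIV. partial_deriv j (partial_deriv j (dist_power a s)) x)
     = of_nat CARD('n) * (of_real (2 * s) * dist_power a (s - 1) x)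
       + of_real (4 * s * (s - 1)) * ((\<Sum>j\<in>UNIV. of_real ((x $ j - a $ j)\<^sup>2)) * dist_power a (s - 1 - 1) x)"
    by (simp add: sum.distrib sum_distrib_left sum_distrib_right mult.assoc)
  also have "(\<Sum>j\<in>UNIV. complex_of_real ((x $ j - a $ j)\<^sup>2)) = dist_power a 1 x"
    using assms by (simp add: dist_power_def norm_vec_def L2_set_def sum_nonneg flip: of_real_power of_real_diff of_real_sum)
  also have "dist_power a 1 x * dist_power a (s - 1 - 1) x = dist_power a (s - 1) x"
    using dist_power_add[OF assms, of 1 "s - 1 - 1"] by simp
  finally show ?thesis by (simp add: algebra_simps)
qed

text \<open>If \<open>|q| \<le> r\<close> on \<open>K\<close>, the powers of \<open>q\<close> are of the order of \<open>r\<^sup>m\<close> with all derivatives, up to polynomial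
  factors: each derivative costs at most one factor \<open>m\<close> and one factor \<open>q\<close>.\<close>

lemma derivs_power_bound:
  assumes U: "open U" and K: "compact K" "K \<subseteq> U" and q: "smooth_on U q" and b: "smooth_on U b"
    and r: "0 < r" "\<And>x. x \<in> K \<Longrightarrow> cmod (q x) \<le> r"
  shows "\<exists>C\<ge>0. \<forall>m. \<forall>x\<in>K. cmod (derivs js (\<lambda>x. q x ^ m * b x) x) \<le> C * real (Suc m) ^ length js * r ^ m"
  using b
proof (induction js arbitrary: b rule: rev_induct)
  case Nil
  have "compact (b ` K)"
    using continuous_on_subset[OF smooth_on_continuous[OF Nil] K(2)] K(1) by (rule compact_continuous_image)
  from compact_imp_bounded[OF this] obtain C where C: "\<And>x. x \<in> K \<Longrightarrow> cmod (b x) \<le> C" unfolding bounded_iff by blast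
  have "cmod (q x ^ m * b x) \<le> max C 0 * r ^ m" if "x \<in> K" for m x
  proof -
    have "cmod (q x) ^ m * cmod (b x) \<le> r ^ m * max C 0"
      using r C[OF that] that by (intro mult_mono power_mono) auto
    then show ?thesis by (simp add: norm_mult norm_power mult.commute)
  qed
  then show ?case by (intro exI[of _ "max C 0"]) simp
next
  case (snoc j js)
  let ?g = "\<lambda>x. partial_deriv j q x * b x"
  obtain C where C: "C \<ge> 0" "\<And>m x. x \<in> K \<Longrightarrow>
     cmod (derivs js (\<lambda>x. q x ^ m * partial_deriv j b x) x) \<le> C * real (Suc m) ^ length js * r ^ m"
    using snoc.IH[OF smooth_on_partial_deriv[OF snoc.prems, of j]] by blast
  have sg: "smooth_on U ?g" by (intro smooth_on_mult U smooth_on_partial_deriv q snoc.prems)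
  obtain D where D: "D \<ge> 0" "\<And>m x. x \<in> K \<Longrightarrow>
     cmod (derivs js (\<lambda>x. q x ^ m * ?g x) x) \<le> D * real (Suc m) ^ length js * r ^ m"
    using snoc.IH[OF sg] by blast
  have pw: "partial_deriv j (\<lambda>x. q x ^ m) x = of_nat m * (q x ^ (m - 1) * partial_deriv j q x)" if "x \<in> U" for m x
  proof (induction m)
    case 0
    then show ?case by (simp add: partial_deriv_const)
  next
    case (Suc m)
    have "partial_deriv j (\<lambda>x. q x ^ Suc m) x = partial_deriv j q x * q x ^ m + q x * partial_deriv j (\<lambda>x. q x ^ m) x"
      unfolding power_Suc
      by (rule partial_deriv_mult[OF U smooth_on_imp_differentiable[OF q] smooth_on_imp_differentiable[OF smooth_on_power[OF U q]] that])
    then show ?case unfolding Suc.IH by (cases m) (simp_all add: algebra_simps)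
  qed
  show ?case
  proof (intro exI[of _ "C + D / r"] conjI allI ballI)
    show "0 \<le> C + D / r" using C D r by simp
    fix m x assume x: "x \<in> K"
    then have xU: "x \<in> U" using K by auto
    have s1: "smooth_on U (\<lambda>x. q x ^ m * partial_deriv j b x)" and s2: "smooth_on U (\<lambda>x. q x ^ (m - 1) * ?g x)"
      by (intro smooth_on_mult smooth_on_power q sg U smooth_on_partial_deriv snoc.prems)+
    have "derivs (js @ [j]) (\<lambda>x. q x ^ m * b x) x
      = derivs js (\<lambda>x. q x ^ m * partial_deriv j b x + of_nat m * (q x ^ (m - 1) * ?g x)) x"
      unfolding derivs_snoc
    proof (rule derivs_cong[OF U xU])
      fix y assume y: "y \<in> U"
      have "partial_deriv j (\<lambda>x. q x ^ m * b x) y = partial_deriv j (\<lambda>x. q x ^ m) y * b y + q y ^ m * partial_deriv j b y"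
        by (rule partial_deriv_mult[OF U smooth_on_imp_differentiable[OF smooth_on_power[OF U q]] smooth_on_imp_differentiable[OF snoc.prems] y])
      then show "partial_deriv j (\<lambda>x. q x ^ m * b x) y = q y ^ m * partial_deriv j b y + of_nat m * (q y ^ (m - 1) * ?g y)"
        unfolding pw[OF y] by (simp add: mult_ac)
    qed
    also have "\<dots> = derivs js (\<lambda>x. q x ^ m * partial_deriv j b x) x + of_nat m * derivs js (\<lambda>x. q x ^ (m - 1) * ?g x) x"
      using derivs_add[OF U s1 smooth_on_cmult[OF U s2] xU] derivs_cmult[OF U s2 xU] by simp
    also have "cmod \<dots> \<le> C * real (Suc m) ^ length js * r ^ m + real m * cmod (derivs js (\<lambda>x. q x ^ (m - 1) * ?g x) x)"
      by (rule order_trans[OF norm_triangle_ineq]) (use C(2)[OF x, of m] in \<open>simp add: norm_mult\<close>)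
    also have "real m * cmod (derivs js (\<lambda>x. q x ^ (m - 1) * ?g x) x) \<le> D / r * real (Suc m) ^ Suc (length js) * r ^ m"
    proof (cases m)
      case 0
      then show ?thesis using D r by simp
    next
      case (Suc l)
      have "real m * cmod (derivs js (\<lambda>x. q x ^ (m - 1) * ?g x) x) \<le> real (Suc m) * (D * real (Suc m) ^ length js * r ^ l)"
      proof (intro mult_mono)
        have "cmod (derivs js (\<lambda>x. q x ^ (m - 1) * ?g x) x) \<le> D * real (Suc l) ^ length js * r ^ l"
          using D(2)[OF x, of l] Suc by simp
        also have "\<dots> \<le> D * real (Suc m) ^ length js * r ^ l"
          using D r Suc by (intro mult_right_mono mult_left_mono power_mono) auto
        finally show "cmod (derivs js (\<lambda>x. q x ^ (m - 1) * ?g x) x) \<le> D * real (Suc m) ^ length js * r ^ l" .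
      qed auto
      also have "\<dots> = D / r * real (Suc m) ^ Suc (length js) * r ^ m" using r Suc by (simp add: field_simps)
      finally show ?thesis .
    qed
    also have "C * real (Suc m) ^ length js * r ^ m \<le> C * real (Suc m) ^ Suc (length js) * r ^ m"
      using C r by (intro mult_right_mono mult_left_mono power_increasing) auto
    finally show "cmod (derivs (js @ [j]) (\<lambda>x. q x ^ m * b x) x) \<le> (C + D / r) * real (Suc m) ^ length (js @ [j]) * r ^ m"
      by (simp add: algebra_simps)
  qed
qed

lemma poly_times_power_tendsto_0:
  fixes r :: real
  assumes "0 < r" "r < 1"
  shows "(\<lambda>m. real (Suc m) ^ l * r ^ m) \<longlonglongrightarrow> 0"
proof -
  define t where "t = root (Suc l) r"
  have t: "0 \<le> t" "t < 1" "t ^ Suc l = r"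
    using assms real_root_pow_pos2[of "Suc l" r] by (simp_all add: t_def del: power_Suc)
  have "(\<lambda>m. real m * t ^ m) \<longlonglongrightarrow> 0" using powser_times_n_limit_0[of t] t by simp
  then have "(\<lambda>m. real (Suc m) * t ^ Suc m) \<longlonglongrightarrow> 0" by (rule LIMSEQ_Suc)
  then have lim: "(\<lambda>m. (real (Suc m) * t ^ Suc m) ^ Suc l) \<longlonglongrightarrow> 0 ^ Suc l" by (rule tendsto_power)
  have "(real (Suc m) * t ^ Suc m) ^ Suc l = real (Suc m) ^ Suc l * r ^ Suc m" for m
    unfolding power_mult_distrib t(3)[symmetric] power_mult[symmetric] by (simp only: mult.commute)
  with lim have lim: "(\<lambda>m. real (Suc m) ^ Suc l * r ^ Suc m) \<longlonglongrightarrow> 0" by (simp only: power_0_Suc)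
  have "(\<lambda>m. real (Suc m) ^ Suc l * r ^ Suc m / r) \<longlonglongrightarrow> 0 / r"
    by (rule tendsto_divide[OF lim tendsto_const]) (use assms in simp)
  moreover have "real (Suc m) ^ Suc l * r ^ Suc m / r = real (Suc m) ^ Suc l * r ^ m" for m
    using assms by simp
  ultimately have lim: "(\<lambda>m. real (Suc m) ^ Suc l * r ^ m) \<longlonglongrightarrow> 0" by (simp only: div_0)
  have bd: "norm (real (Suc m) ^ l * r ^ m) \<le> real (Suc m) ^ Suc l * r ^ m" for m
    using assms by (auto intro!: mult_right_mono power_increasing simp del: power_Suc of_nat_Suc)
  show ?thesis by (rule Lim_null_comparison[OF always_eventually[OF allI[OF bd]] lim])
qed

lemma smooth_functional_power_tendsto_0:
  assumes T: "smooth_functional U K T" and U: "open U" and q: "smooth_on U q" and b: "smooth_on U b"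
    and r: "0 < r" "r < 1" "\<And>x. x \<in> K \<Longrightarrow> cmod (q x) \<le> r"
  shows "(\<lambda>m. T (\<lambda>x. q x ^ m * b x)) \<longlonglongrightarrow> 0"
proof -
  have "(\<lambda>m. T (\<lambda>x. q x ^ m * b x)) \<longlonglongrightarrow> T (\<lambda>x. 0)"
  proof (rule smooth_functional_tendsto[OF T U])
    show "smooth_on U (\<lambda>x. q x ^ m * b x)" for m by (intro smooth_on_mult smooth_on_power U q b)
    fix js :: "'a list" and e :: real assume e: "e > 0"
    obtain C where C: "C \<ge> 0" "\<And>m x. x \<in> K \<Longrightarrow> cmod (derivs js (\<lambda>x. q x ^ m * b x) x) \<le> C * real (Suc m) ^ length js * r ^ m"
      using derivs_power_bound[OF U smooth_functional_compact[OF T] smooth_functional_subset[OF T] q b r(1,3), of js] by blast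
    have "(\<lambda>m. C * (real (Suc m) ^ length js * r ^ m)) \<longlonglongrightarrow> C * 0"
      by (intro tendsto_mult tendsto_const poly_times_power_tendsto_0 r)
    then have "\<forall>\<^sub>F m in sequentially. C * (real (Suc m) ^ length js * r ^ m) < e"
      by (rule order_tendstoD(2)) (use e in simp)
    then show "\<forall>\<^sub>F m in sequentially. \<forall>x\<in>K. cmod (derivs js (\<lambda>x. q x ^ m * b x) x - derivs js (\<lambda>x. 0) x) \<le> e"
    proof eventually_elim
      case (elim m)
      then show ?case using C(2)[of _ m] by (force simp: derivs_zero mult.assoc)
    qed
  qed simp
  then show ?thesis using smooth_functional_zero[OF T] by simp
qed

text \<open>The key density statement behind unique continuation. If all derivatives at \<open>a\<close> of the
  potential \<open>x \<mapsto> T(|x - \<cdot>|\<^bsup>1-n\<^esup>)\<close> vanish, then \<open>T\<close> vanishes on \<open>|x - a|\<^bsup>1-n\<^esup>\<close> times all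
  polynomials: the Laplacian lowers the exponent, with a factor that is never zero because the
  kernel is not harmonic; the product rule creates monomials; and the resulting
  restriction to large negative powers of the distance is removed by the geometric series
  \<open>\<rho> = \<Sum>\<^sub>k (1 - \<rho>\<^sup>-\<^sup>1/M)\<^sup>k / M\<close> for \<open>\<rho> = |x - a|\<^sup>2\<close>, which converges with all derivatives on \<open>K\<close>.\<close>

lemma vanishes_on_weighted_monomials:
  fixes T :: "'n::finite functional" and a :: "real^'n"
  assumes T: "smooth_functional (- {a}) K T" and n: "CARD('n) \<ge> 2"
    and z: "\<And>js. T (derivs js (dist_power a ((1 - real CARD('n)) / 2))) = 0"
  shows "T (weighted_monomial a \<beta> ((1 - real CARD('n)) / 2)) = 0"
proof -
  let ?U = "- {a}"
  note U = open_compl_point[of a]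
  define s0 where "s0 = (1 - real CARD('n)) / 2"
  define Z where "Z = {g. smooth_on ?U g \<and> (\<forall>js. T (derivs js g) = 0)}"
  have Z_cong: "g \<in> Z" if "f \<in> Z" "\<And>x. x \<in> ?U \<Longrightarrow> f x = g x" for f g
  proof -
    have sf: "smooth_on ?U f" using that by (simp add: Z_def)
    have sg: "smooth_on ?U g" by (rule smooth_on_cong[OF U that(2) sf])
    have "T (derivs js g) = T (derivs js f)" for js
      by (rule smooth_functional_cong[OF T U smooth_on_derivs[OF sg] smooth_on_derivs[OF sf] U smooth_functional_subset[OF T]])
        (use derivs_cong[OF U] that(2) in metis)
    then show ?thesis using that sg by (simp add: Z_def)
  qed
  have Z_pd: "partial_deriv j g \<in> Z" if g: "g \<in> Z" for g j
  proof -
    have sg: "smooth_on ?U g" and Tg: "T (derivs js g) = 0" for js using g by (auto simp: Z_def)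
    have "T (derivs js (partial_deriv j g)) = 0" for js using Tg[of "js @ [j]"] by simp
    then show ?thesis using smooth_on_partial_deriv[OF sg] by (simp add: Z_def)
  qed
  have Z_lin: "(\<lambda>x. c * f x + d * g x) \<in> Z" if "f \<in> Z" "g \<in> Z" for f g c d
  proof -
    have s: "smooth_on ?U f" "smooth_on ?U g" using that by (auto simp: Z_def)
    have s2: "smooth_on ?U (\<lambda>x. c * f x + d * g x)" by (intro smooth_on_add smooth_on_cmult s U)
    have "T (derivs js (\<lambda>x. c * f x + d * g x)) = T (\<lambda>x. c * derivs js f x + d * derivs js g x)" for js
    proof (rule smooth_functional_cong[OF T U smooth_on_derivs[OF s2] _ U smooth_functional_subset[OF T]])
      show "smooth_on ?U (\<lambda>x. c * derivs js f x + d * derivs js g x)"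
        by (intro smooth_on_add smooth_on_cmult smooth_on_derivs s U)
      show "derivs js (\<lambda>x. c * f x + d * g x) x = c * derivs js f x + d * derivs js g x" if "x \<in> ?U" for x
        using derivs_add[OF U smooth_on_cmult[OF U s(1)] smooth_on_cmult[OF U s(2)] that]
          derivs_cmult[OF U s(1) that] derivs_cmult[OF U s(2) that] by simp
    qed
    also have "\<dots> js = 0" for js
      using smooth_functional_linear[OF T smooth_on_derivs[OF s(1)] smooth_on_derivs[OF s(2)]] that by (simp add: Z_def)
    finally show ?thesis using s2 by (simp add: Z_def)
  qed
  have Z_0: "(\<lambda>x. 0) \<in> Z"
    using smooth_functional_zero[OF T] by (simp add: Z_def derivs_zero)
  have Z_sum: "(\<lambda>x. \<Sum>i\<in>I. f i x) \<in> Z" if "\<And>i. i \<in> I \<Longrightarrow> f i \<in> Z" for f :: "'n \<Rightarrow> _" and I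
    using that
  proof (induction I rule: infinite_finite_induct)
    case (insert i I)
    then show ?case using Z_lin[of "f i" "\<lambda>x. \<Sum>i\<in>I. f i x" 1 1] by simp
  qed (simp_all add: Z_0)
  have pw: "dist_power a (s0 - real l) \<in> Z" for l
  proof (induction l)
    case 0
    then show ?case using z smooth_dist_power[of a s0] by (simp add: Z_def s0_def)
  next
    case (Suc l)
    let ?s = "s0 - real l"
    let ?c = "complex_of_real (2 * ?s * (real CARD('n) + 2 * ?s - 2))"
    have c1: "2 * ?s = 1 - real CARD('n) - 2 * real l" by (simp add: s0_def field_simps)
    then have "2 * ?s \<noteq> 0" "real CARD('n) + 2 * ?s - 2 \<noteq> 0" using n by auto
    then have c: "?c \<noteq> 0" by (simp only: of_real_eq_0_iff mult_eq_0_iff) simp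
    have "(\<lambda>x. \<Sum>j\<in>UNIV. partial_deriv j (partial_deriv j (dist_power a ?s)) x) \<in> Z"
      by (intro Z_sum Z_pd Suc)
    from Z_lin[OF this Z_0, of "1 / ?c" 0]
    show ?case
    proof (rule Z_cong)
      fix x assume "x \<in> ?U"
      then have "x \<noteq> a" by simp
      then show "1 / ?c * (\<Sum>j\<in>UNIV. partial_deriv j (partial_deriv j (dist_power a ?s)) x) + 0 * 0 = dist_power a (s0 - real (Suc l)) x"
      proof -
        have e: "s0 - real (Suc l) = ?s - 1" by simp
        have cancel: "1 / c * (c * d) + 0 * 0 = d" if "c \<noteq> 0" for c d :: complex using that by simp
        show ?thesis unfolding laplacian_dist_power[OF \<open>x \<noteq> a\<close>] e by (rule cancel[OF c])
      qed
    qed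
  qed
  have wm: "weighted_monomial a \<beta> (s0 - real l) \<in> Z" if "sum \<beta> UNIV \<le> l" for \<beta> l
    using that
  proof (induction "sum \<beta> UNIV" arbitrary: \<beta> l rule: less_induct)
    case less
    show ?case
    proof (cases "\<beta> = (\<lambda>_. 0)")
      case True
      then have "weighted_monomial a \<beta> (s0 - real l) = dist_power a (s0 - real l)"
        by (simp add: weighted_monomial_def[abs_def] monomial_def)
      then show ?thesis using pw by simp
    next
      case False
      then obtain j where j: "\<beta> j > 0" by (metis neq0_conv ext)
      define \<gamma> where "\<gamma> = \<beta>(j := \<beta> j - 1)"
      have \<beta>: "\<beta> = \<gamma>(j := Suc (\<gamma> j))" using j by (auto simp: \<gamma>_def)
      have sum_upd: "sum (\<delta>(j := Suc (\<delta> j))) UNIV = Suc (sum \<delta> UNIV)" for \<delta> :: "'n \<Rightarrow> nat"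
        by (simp add: sum.remove[of UNIV j])
      have sz: "sum \<beta> UNIV = Suc (sum \<gamma> UNIV)" by (subst \<beta>) (rule sum_upd)
      then have l: "l > 0" "sum \<gamma> UNIV \<le> l - 1" using less.prems by auto
      define s where "s = s0 - real (l - 1)"
      have "2 * s = 1 - real CARD('n) - 2 * real (l - 1)" by (simp add: s_def s0_def field_simps)
      then have s: "s \<noteq> 0" using n by auto
      have g: "weighted_monomial a \<gamma> s \<in> Z" unfolding s_def using less.hyps[of \<gamma> "l - 1"] sz l by simp
      have g': "(\<lambda>x. of_nat (\<gamma> j) * weighted_monomial a (\<gamma>(j := \<gamma> j - 1)) s x) \<in> Z"
      proof (cases "\<gamma> j = 0")
        case True
        then show ?thesis using Z_0 by simp
      next
        case False
        have "\<gamma> = (\<gamma>(j := \<gamma> j - 1))(j := Suc ((\<gamma>(j := \<gamma> j - 1)) j))" using False by auto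
        then have "sum \<gamma> UNIV = Suc (sum (\<gamma>(j := \<gamma> j - 1)) UNIV)" by (metis sum_upd)
        then have "weighted_monomial a (\<gamma>(j := \<gamma> j - 1)) s \<in> Z"
          unfolding s_def using less.hyps[of "\<gamma>(j := \<gamma> j - 1)" "l - 1"] sz l by simp
        from Z_lin[OF this Z_0, of "of_nat (\<gamma> j)" 0] show ?thesis by simp
      qed
      let ?c = "2 * complex_of_real s"
      from Z_lin[OF Z_pd[OF g, of j] g', of "1 / ?c" "- 1 / ?c"]
      show ?thesis
      proof (rule Z_cong)
        fix x assume "x \<in> ?U"
        then have x: "x \<noteq> a" by simp
        have s1: "s - 1 = s0 - real l" using l(1) by (simp add: s_def of_nat_diff)
        show "1 / ?c * partial_deriv j (weighted_monomial a \<gamma> s) x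
            + - 1 / ?c * (of_nat (\<gamma> j) * weighted_monomial a (\<gamma>(j := \<gamma> j - 1)) s x) = weighted_monomial a \<beta> (s0 - real l) x"
          unfolding partial_deriv_weighted_monomial[OF x] s1 using s by (simp add: \<beta>[symmetric] field_simps)
      qed
    qed
  qed
  have TZ: "T g = 0" if "g \<in> Z" for g
    using that unfolding Z_def by (auto dest: spec[of _ "[]"])
  note sw = smooth_weighted_monomial[of a]
  \<comment> \<open>With \<open>q = 1 - \<rho>\<^sup>-\<^sup>1/M\<close>, multiplying \<open>\<rho>\<^bsup>s+1\<^esup>\<close> by \<open>q\<close> changes it by a multiple of \<open>\<rho>\<^bsup>s\<^esup>\<close>, on which \<open>T\<close>
     vanishes. So \<open>T\<close> has the same value on all \<open>q\<^sup>m \<rho>\<^bsup>s+1\<^esup>\<close>, and for large \<open>M\<close> these tend to zero.\<close>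
  have raise: "T (weighted_monomial a \<beta> (s + 1)) = 0"
    if low: "\<And>k. T (weighted_monomial a \<beta> (s - real k)) = 0" for s
  proof -
    have "compact ((\<lambda>x. dist_power a (-1) x) ` K)"
      by (intro compact_continuous_image smooth_functional_compact[OF T]
          continuous_on_subset[OF smooth_on_continuous[OF smooth_dist_power] smooth_functional_subset[OF T]])
    from compact_imp_bounded[OF this] obtain M0 where M0: "\<And>x. x \<in> K \<Longrightarrow> cmod (dist_power a (-1) x) \<le> M0"
      unfolding bounded_iff by blast
    have "compact ((\<lambda>x. dist_power a 1 x) ` K)"
      by (intro compact_continuous_image smooth_functional_compact[OF T]
          continuous_on_subset[OF smooth_on_continuous[OF smooth_dist_power] smooth_functional_subset[OF T]])
    from compact_imp_bounded[OF this] obtain M1 where M1: "\<And>x. x \<in> K \<Longrightarrow> cmod (dist_power a 1 x) \<le> M1"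
      unfolding bounded_iff by blast
    define M where "M = max M0 0 + 1"
    define m1 where "m1 = max M1 0 + 1"
    have M: "M > 0" "\<And>x. x \<in> K \<Longrightarrow> cmod (dist_power a (-1) x) \<le> M" using M0 by (force simp: M_def)+
    have m1: "m1 > 0" "\<And>x. x \<in> K \<Longrightarrow> cmod (dist_power a 1 x) \<le> m1" using M1 by (force simp: m1_def)+
    define q where "q x = 1 - 1 / of_real M * dist_power a (-1) x" for x
    have sq: "smooth_on ?U q" unfolding q_def[abs_def]
      by (intro smooth_on_diff smooth_on_const smooth_on_cmult smooth_dist_power U)
    have sqm: "smooth_on ?U (\<lambda>x. q x ^ m * weighted_monomial a \<beta> t x)" for m t
      by (intro smooth_on_mult smooth_on_power sq sw U)
    define r where "r = max (1 - 1 / (M * m1)) (1/2)"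
    have r: "0 < r" "r < 1" using M m1 by (auto simp: r_def)
    have qr: "cmod (q x) \<le> r" if x: "x \<in> K" for x
    proof -
      define t where "t = (norm (x - a))\<^sup>2 powr (-1)"
      have xa: "x \<noteq> a" using x smooth_functional_subset[OF T] by auto
      then have p: "(norm (x - a))\<^sup>2 > 0" by simp
      have t: "t > 0" "t \<le> M" using p M(2)[OF x] unfolding cmod_dist_power t_def by auto
      have "(norm (x - a))\<^sup>2 \<le> m1" using m1(2)[OF x] p unfolding cmod_dist_power by simp
      then have "1 / m1 \<le> t" using p m1 by (simp add: t_def powr_minus_divide frac_le)
      then have h1: "1 / (M * m1) \<le> t / M" using M m1 by (simp add: field_simps)
      have "t / M \<le> 1" using t M by simp
      moreover have "q x = of_real (1 - t / M)" by (simp add: q_def t_def dist_power_def)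
      ultimately have "cmod (q x) = 1 - t / M" by (simp only: norm_of_real)
      also have "\<dots> \<le> r" using h1 by (simp add: r_def)
      finally show ?thesis .
    qed
    have step: "q x * weighted_monomial a \<beta> t x = weighted_monomial a \<beta> t x - 1 / of_real M * weighted_monomial a \<beta> (t - 1) x"
      if "x \<noteq> a" for x t
      using dist_power_add[OF that, of "-1" t] by (simp add: q_def weighted_monomial_def algebra_simps)
    have Tstep: "T (\<lambda>x. q x ^ Suc m * weighted_monomial a \<beta> t x)
        = T (\<lambda>x. q x ^ m * weighted_monomial a \<beta> t x) - 1 / of_real M * T (\<lambda>x. q x ^ m * weighted_monomial a \<beta> (t - 1) x)" for m t
    proof -
      have "T (\<lambda>x. q x ^ Suc m * weighted_monomial a \<beta> t x)
         = T (\<lambda>x. q x ^ m * weighted_monomial a \<beta> t x - 1 / of_real M * (q x ^ m * weighted_monomial a \<beta> (t - 1) x))"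
      proof (rule smooth_functional_cong[OF T U sqm _ U smooth_functional_subset[OF T]])
        show "smooth_on ?U (\<lambda>x. q x ^ m * weighted_monomial a \<beta> t x - 1 / of_real M * (q x ^ m * weighted_monomial a \<beta> (t - 1) x))"
          by (intro smooth_on_diff smooth_on_cmult sqm U)
        fix x assume "x \<in> ?U"
        then have "x \<noteq> a" by simp
        have "q x ^ Suc m * weighted_monomial a \<beta> t x = q x ^ m * (q x * weighted_monomial a \<beta> t x)" by simp
        also have "\<dots> = q x ^ m * weighted_monomial a \<beta> t x - 1 / of_real M * (q x ^ m * weighted_monomial a \<beta> (t - 1) x)"
          unfolding step[OF \<open>x \<noteq> a\<close>] by (simp only: right_diff_distrib mult.left_commute)
        finally show "q x ^ Suc m * weighted_monomial a \<beta> t x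
            = q x ^ m * weighted_monomial a \<beta> t x - 1 / of_real M * (q x ^ m * weighted_monomial a \<beta> (t - 1) x)" .
      qed
      also have "\<dots> = T (\<lambda>x. q x ^ m * weighted_monomial a \<beta> t x)
          - T (\<lambda>x. 1 / of_real M * (q x ^ m * weighted_monomial a \<beta> (t - 1) x))"
        by (rule smooth_functional_diff[OF T sqm smooth_on_cmult[OF U sqm]])
      also have "T (\<lambda>x. 1 / of_real M * (q x ^ m * weighted_monomial a \<beta> (t - 1) x))
          = 1 / of_real M * T (\<lambda>x. q x ^ m * weighted_monomial a \<beta> (t - 1) x)"
        by (rule smooth_functional_cmult[OF T sqm])
      finally show ?thesis .
    qed
    have low': "T (\<lambda>x. q x ^ m * weighted_monomial a \<beta> (s - real k) x) = 0" for m k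
    proof (induction m arbitrary: k)
      case 0
      then show ?case using low[of k] by simp
    next
      case (Suc m)
      have e: "s - real k - 1 = s - real (Suc k)" by simp
      show ?case unfolding Tstep e using Suc.IH[of k] Suc.IH[of "Suc k"] by simp
    qed
    have const: "T (\<lambda>x. q x ^ m * weighted_monomial a \<beta> (s + 1) x) = T (weighted_monomial a \<beta> (s + 1))" for m
    proof (induction m)
      case (Suc m)
      show ?case unfolding Tstep Suc.IH using low'[of m 0] by simp
    qed simp
    show ?thesis
      using smooth_functional_power_tendsto_0[OF T U sq sw r qr, of \<beta> "s + 1"] unfolding const
      by (simp add: LIMSEQ_const_iff)
  qed
  have "T (weighted_monomial a \<beta> (s0 + real m - real l)) = 0" if "l \<ge> sum \<beta> UNIV" for m l
    using that
  proof (induction m arbitrary: l)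
    case 0
    then show ?case using TZ[OF wm[OF 0]] by simp
  next
    case (Suc m)
    have "T (weighted_monomial a \<beta> (s0 + real m - real l - real k)) = 0" for k
      using Suc.IH[of "l + k"] Suc.prems by (simp add: algebra_simps)
    from raise[OF this] show ?case by (simp add: algebra_simps)
  qed
  from this[of "sum \<beta> UNIV" "sum \<beta> UNIV"] show ?thesis by (simp add: s0_def)
qed

section \<open>Polar coordinates\<close>

lemma nn_integral_inverse_power_tail:
  assumes t: "t > 0" and n: "n > 0"
  shows "(\<integral>\<^sup>+r. ennreal (1 / \<bar>r\<bar> ^ (Suc n)) * indicator {r. \<bar>r\<bar> > t} r \<partial>lborel) = ennreal (2 / (real n * t ^ n))"
proof -
  define f where "f r = 1 / \<bar>r\<bar> ^ (Suc n)" for r :: real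
  have [measurable]: "f \<in> borel_measurable borel" unfolding f_def by measurable
  let ?F = "\<lambda>r. - (inverse r ^ n) / real n"
  have "((\<lambda>r. inverse r ^ n) \<longlongrightarrow> 0 ^ n) (at_top :: real filter)"
    by (intro tendsto_power tendsto_inverse_0_at_top filterlim_ident)
  then have "((\<lambda>r. inverse r ^ n) \<longlongrightarrow> 0) (at_top :: real filter)" using n by (simp only: zero_power)
  from tendsto_divide[OF tendsto_minus[OF this] tendsto_const[of "real n"]]
  have "(?F \<longlongrightarrow> 0) at_top" using n by simp
  moreover have "(?F has_real_derivative f r) (at r)" if "r \<ge> t" for r
  proof -
    obtain m where m: "n = Suc m" using n by (cases n) auto
    have r: "r > 0" using that t by simp
    have "(inverse has_real_derivative - (inverse r ^ Suc (Suc 0))) (at r)" using r by (intro DERIV_inverse) simp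
    from DERIV_cdivide[OF DERIV_minus[OF DERIV_power[OF this, of n]], of "real n"]
    have "(?F has_real_derivative - (real n * (- (inverse r ^ Suc (Suc 0)) * inverse r ^ (n - Suc 0))) / real n) (at r)" .
    moreover have "- (real n * (- (inverse r ^ Suc (Suc 0)) * inverse r ^ (n - Suc 0))) / real n = f r"
      using r n by (simp add: f_def m divide_inverse power_inverse)
    ultimately show ?thesis by simp
  qed
  moreover have "f r \<ge> 0" for r by (simp add: f_def)
  ultimately have tail: "(\<integral>\<^sup>+r. ennreal (f r) * indicator {t..} r \<partial>lborel) = ennreal (0 - ?F t)"
    by (intro nn_integral_FTC_atLeast) auto
  have Ft: "0 - ?F t = 1 / (real n * t ^ n)" by (simp add: power_inverse divide_inverse mult.commute)
  have "(\<integral>\<^sup>+r. ennreal (f r) * indicator {r. \<bar>r\<bar> > t} r \<partial>lborel)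
      = (\<integral>\<^sup>+r. ennreal (f r) * indicator {t..} r + ennreal (f r) * indicator {..-t} r \<partial>lborel)"
  proof (rule nn_integral_cong_AE)
    show "AE r in lborel. ennreal (f r) * indicator {r. \<bar>r\<bar> > t} r
        = ennreal (f r) * indicator {t..} r + ennreal (f r) * indicator {..-t} r"
      using AE_lborel_singleton[of t] AE_lborel_singleton[of "-t"]
      by eventually_elim (use t in \<open>auto simp: indicator_def\<close>)
  qed
  also have "\<dots> = (\<integral>\<^sup>+r. ennreal (f r) * indicator {t..} r \<partial>lborel) + (\<integral>\<^sup>+r. ennreal (f r) * indicator {..-t} r \<partial>lborel)"
    by (rule nn_integral_add) auto
  also have "(\<integral>\<^sup>+r. ennreal (f r) * indicator {..-t} r \<partial>lborel) = (\<integral>\<^sup>+r. ennreal (f r) * indicator {t..} r \<partial>lborel)"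
    by (subst nn_integral_real_affine[where c="-1" and t=0]) (auto simp: f_def indicator_def intro!: nn_integral_cong)
  finally have "(\<integral>\<^sup>+r. ennreal (f r) * indicator {r. \<bar>r\<bar> > t} r \<partial>lborel)
      = ennreal (1 / (real n * t ^ n)) + ennreal (1 / (real n * t ^ n))"
    unfolding tail Ft .
  also have "\<dots> = ennreal (2 / (real n * t ^ n))" using t by (simp flip: ennreal_plus)
  finally show ?thesis unfolding f_def .
qed

lemma nn_integral_lborel_scale:
  fixes f :: "'a::euclidean_space \<Rightarrow> ennreal"
  assumes [measurable]: "f \<in> borel_measurable borel" and c: "c \<noteq> 0"
  shows "(\<integral>\<^sup>+x. f x \<partial>lborel) = ennreal (\<bar>c\<bar> ^ DIM('a)) * (\<integral>\<^sup>+x. f (c *\<^sub>R x) \<partial>lborel)"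
  by (subst lborel_affine[OF c, of 0])
    (simp add: nn_integral_density nn_integral_distr nn_integral_cmult ennreal_power)

text \<open>Both sides are turned into the same double integral by the substitutions \<open>s = r |y|\<close> and
  \<open>z = r y\<close>; only linear changes of variables are needed. Letting \<open>s\<close> run over the whole line counts
  every point twice.\<close>

lemma nn_integral_polar:
  fixes G :: "real^'n::finite \<Rightarrow> ennreal"
  assumes [measurable]: "G \<in> borel_measurable borel"
  shows "(\<integral>\<^sup>+y. indicator (ball 0 1 - {0}) y * (\<integral>\<^sup>+s. G (s *\<^sub>R sgn y) * ennreal (\<bar>s\<bar> ^ (CARD('n) - 1)) \<partial>lborel) \<partial>lborel)
     = ennreal (2 / real CARD('n)) * (\<integral>\<^sup>+z. G z \<partial>lborel)"
proof -
  let ?n = "CARD('n)"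
  have n: "?n > 0" by simp
  let ?B = "ball (0::real^'n) 1 - {0}"
  have [measurable]: "?B \<in> sets borel" by simp
  have 1: "(\<integral>\<^sup>+s. G (s *\<^sub>R sgn y) * ennreal (\<bar>s\<bar> ^ (?n - 1)) \<partial>lborel)
      = (\<integral>\<^sup>+r. G (r *\<^sub>R y) * ennreal (\<bar>r\<bar> ^ (?n - 1)) * ennreal (norm y ^ ?n) \<partial>lborel)" if "y \<noteq> 0" for y
  proof -
    have "(\<integral>\<^sup>+s. G (s *\<^sub>R sgn y) * ennreal (\<bar>s\<bar> ^ (?n - 1)) \<partial>lborel)
      = ennreal \<bar>norm y\<bar> * (\<integral>\<^sup>+r. G ((0 + norm y * r) *\<^sub>R sgn y) * ennreal (\<bar>0 + norm y * r\<bar> ^ (?n - 1)) \<partial>lborel)"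
      by (rule nn_integral_real_affine) (use that in auto)
    also have "\<dots> = (\<integral>\<^sup>+r. ennreal (norm y) * (G ((norm y * r) *\<^sub>R sgn y) * ennreal (\<bar>norm y * r\<bar> ^ (?n - 1))) \<partial>lborel)"
      by (subst nn_integral_cmult) auto
    also have "\<dots> = (\<integral>\<^sup>+r. G (r *\<^sub>R y) * ennreal (\<bar>r\<bar> ^ (?n - 1)) * ennreal (norm y ^ ?n) \<partial>lborel)"
    proof (rule nn_integral_cong)
      fix r :: real
      have "(norm y * r) *\<^sub>R sgn y = r *\<^sub>R y" using that by (simp add: sgn_div_norm)
      moreover have "ennreal (norm y) * ennreal (\<bar>norm y * r\<bar> ^ (?n - 1)) = ennreal (\<bar>r\<bar> ^ (?n - 1)) * ennreal (norm y ^ ?n)"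
      proof -
        have "norm y * \<bar>norm y * r\<bar> ^ (?n - 1) = \<bar>r\<bar> ^ (?n - 1) * norm y ^ ?n"
          using power_Suc[of "norm y" "?n - 1"] n by (simp add: abs_mult power_mult_distrib mult_ac)
        then show ?thesis by (simp flip: ennreal_mult)
      qed
      ultimately show "ennreal (norm y) * (G ((norm y * r) *\<^sub>R sgn y) * ennreal (\<bar>norm y * r\<bar> ^ (?n - 1)))
        = G (r *\<^sub>R y) * ennreal (\<bar>r\<bar> ^ (?n - 1)) * ennreal (norm y ^ ?n)"
        by (simp only: mult.assoc mult.left_commute[of _ "G _"])
    qed
    finally show ?thesis .
  qed
  have 2: "(\<integral>\<^sup>+y. indicator ?B y * (G (r *\<^sub>R y) * ennreal (\<bar>r\<bar> ^ (?n - 1)) * ennreal (norm y ^ ?n)) \<partial>lborel)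
     = (\<integral>\<^sup>+z. G z * ennreal (norm z ^ ?n) * (ennreal (1 / \<bar>r\<bar> ^ Suc ?n) * indicator {r. \<bar>r\<bar> > norm z} r) \<partial>lborel)"
    if r: "r \<noteq> 0" for r
  proof -
    let ?f = "\<lambda>z. G z * ennreal (norm z ^ ?n) * (ennreal (1 / \<bar>r\<bar> ^ Suc ?n) * indicator {r. \<bar>r\<bar> > norm z} r)"
    have ind: "(\<lambda>z::real^'n. indicator {r. \<bar>r\<bar> > norm z} r :: ennreal) = indicator {z. norm z < \<bar>r\<bar>}"
      by (auto simp: indicator_def fun_eq_iff)
    have [measurable]: "(\<lambda>z::real^'n. indicator {r. \<bar>r\<bar> > norm z} r :: ennreal) \<in> borel_measurable borel"
      unfolding ind by measurable
    have "(\<integral>\<^sup>+z. ?f z \<partial>lborel) = ennreal (\<bar>r\<bar> ^ ?n) * (\<integral>\<^sup>+y. ?f (r *\<^sub>R y) \<partial>lborel)"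
      using nn_integral_lborel_scale[of ?f r] r by simp
    also have "\<dots> = (\<integral>\<^sup>+y. ennreal (\<bar>r\<bar> ^ ?n) * ?f (r *\<^sub>R y) \<partial>lborel)"
      by (subst nn_integral_cmult) auto
    also have "\<dots> = (\<integral>\<^sup>+y. indicator ?B y * (G (r *\<^sub>R y) * ennreal (\<bar>r\<bar> ^ (?n - 1)) * ennreal (norm y ^ ?n)) \<partial>lborel)"
    proof (rule nn_integral_cong)
      fix y :: "real^'n"
      have i: "indicator {r'. \<bar>r'\<bar> > norm (r *\<^sub>R y)} r = (indicator (ball 0 1) y :: ennreal)"
        using r by (auto simp: indicator_def abs_mult)
      have "\<bar>r\<bar> ^ ?n * (norm (r *\<^sub>R y) ^ ?n * (1 / \<bar>r\<bar> ^ Suc ?n)) = \<bar>r\<bar> ^ (?n - 1) * norm y ^ ?n"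
      proof -
        have "\<bar>r\<bar> ^ ?n = \<bar>r\<bar> * \<bar>r\<bar> ^ (?n - 1)" using power_Suc[of "\<bar>r\<bar>" "?n - 1"] n by simp
        then show ?thesis using r by (simp add: power_mult_distrib field_simps)
      qed
      then have "ennreal (\<bar>r\<bar> ^ ?n) * (ennreal (norm (r *\<^sub>R y) ^ ?n) * ennreal (1 / \<bar>r\<bar> ^ Suc ?n))
          = ennreal (\<bar>r\<bar> ^ (?n - 1)) * ennreal (norm y ^ ?n)"
        by (simp flip: ennreal_mult)
      note c = this
      have ac: "A * (g * N * (I * i)) = i * (g * (A * (N * I)))" for A g N I i :: ennreal
        by (simp only: mult.assoc mult.left_commute mult.commute)
      have "ennreal (\<bar>r\<bar> ^ ?n) * ?f (r *\<^sub>R y)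
         = indicator (ball 0 1) y * (G (r *\<^sub>R y) * ennreal (\<bar>r\<bar> ^ (?n - 1)) * ennreal (norm y ^ ?n))"
        unfolding i ac c by (simp only: mult.assoc)
      also have "\<dots> = indicator ?B y * (G (r *\<^sub>R y) * ennreal (\<bar>r\<bar> ^ (?n - 1)) * ennreal (norm y ^ ?n))"
        using n by (auto simp: indicator_def)
      finally show "ennreal (\<bar>r\<bar> ^ ?n) * ?f (r *\<^sub>R y)
         = indicator ?B y * (G (r *\<^sub>R y) * ennreal (\<bar>r\<bar> ^ (?n - 1)) * ennreal (norm y ^ ?n))" .
    qed
    finally show ?thesis ..
  qed
  have set_meas[measurable]: "(\<lambda>(r::real, z::real^'n). indicator {r. \<bar>r\<bar> > norm z} r :: ennreal) \<in> borel_measurable (borel \<Otimes>\<^sub>M borel)"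
  proof -
    have "(\<lambda>(r::real, z::real^'n). indicator {r. \<bar>r\<bar> > norm z} r :: ennreal) = indicator {p. norm (snd p) < \<bar>fst p\<bar>}"
      by (auto simp: indicator_def fun_eq_iff)
    then show ?thesis by simp
  qed
  have "(\<integral>\<^sup>+y. indicator ?B y * (\<integral>\<^sup>+s. G (s *\<^sub>R sgn y) * ennreal (\<bar>s\<bar> ^ (?n - 1)) \<partial>lborel) \<partial>lborel)
    = (\<integral>\<^sup>+y. (\<integral>\<^sup>+r. indicator ?B y * (G (r *\<^sub>R y) * ennreal (\<bar>r\<bar> ^ (?n - 1)) * ennreal (norm y ^ ?n)) \<partial>lborel) \<partial>lborel)"
  proof (rule nn_integral_cong)
    fix y :: "real^'n"
    show "indicator ?B y * (\<integral>\<^sup>+s. G (s *\<^sub>R sgn y) * ennreal (\<bar>s\<bar> ^ (?n - 1)) \<partial>lborel)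
      = (\<integral>\<^sup>+r. indicator ?B y * (G (r *\<^sub>R y) * ennreal (\<bar>r\<bar> ^ (?n - 1)) * ennreal (norm y ^ ?n)) \<partial>lborel)"
      using 1[of y] by (cases "y \<in> ?B") (auto simp: indicator_def)
  qed
  also have "\<dots> = (\<integral>\<^sup>+r. (\<integral>\<^sup>+y. indicator ?B y * (G (r *\<^sub>R y) * ennreal (\<bar>r\<bar> ^ (?n - 1)) * ennreal (norm y ^ ?n)) \<partial>lborel) \<partial>lborel)"
    by (rule lborel_pair.Fubini') measurable
  also have "\<dots> = (\<integral>\<^sup>+r. (\<integral>\<^sup>+z. G z * ennreal (norm z ^ ?n) * (ennreal (1 / \<bar>r\<bar> ^ Suc ?n) * indicator {r. \<bar>r\<bar> > norm z} r) \<partial>lborel) \<partial>lborel)"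
  proof (rule nn_integral_cong_AE)
    show "AE r in lborel. (\<integral>\<^sup>+y. indicator ?B y * (G (r *\<^sub>R y) * ennreal (\<bar>r\<bar> ^ (?n - 1)) * ennreal (norm y ^ ?n)) \<partial>lborel)
       = (\<integral>\<^sup>+z. G z * ennreal (norm z ^ ?n) * (ennreal (1 / \<bar>r\<bar> ^ Suc ?n) * indicator {r. \<bar>r\<bar> > norm z} r) \<partial>lborel)"
      using AE_lborel_singleton[of "0::real"] by eventually_elim (rule 2)
  qed
  also have "\<dots> = (\<integral>\<^sup>+z. (\<integral>\<^sup>+r. G z * ennreal (norm z ^ ?n) * (ennreal (1 / \<bar>r\<bar> ^ Suc ?n) * indicator {r. \<bar>r\<bar> > norm z} r) \<partial>lborel) \<partial>lborel)"
    by (rule lborel_pair.Fubini'[symmetric]) measurable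
  also have "\<dots> = (\<integral>\<^sup>+z. ennreal (2 / real ?n) * G z \<partial>lborel)"
  proof (rule nn_integral_cong_AE)
    show "AE z in lborel. (\<integral>\<^sup>+r. G z * ennreal (norm z ^ ?n) * (ennreal (1 / \<bar>r\<bar> ^ Suc ?n) * indicator {r. \<bar>r\<bar> > norm z} r) \<partial>lborel)
       = ennreal (2 / real ?n) * G z"
      using AE_lborel_singleton[of "0::real^'n"]
    proof eventually_elim
      case (elim z)
      have "(\<integral>\<^sup>+r. G z * ennreal (norm z ^ ?n) * (ennreal (1 / \<bar>r\<bar> ^ Suc ?n) * indicator {r. \<bar>r\<bar> > norm z} r) \<partial>lborel)
        = G z * ennreal (norm z ^ ?n) * (\<integral>\<^sup>+r. (ennreal (1 / \<bar>r\<bar> ^ Suc ?n) * indicator {r. \<bar>r\<bar> > norm z} r) \<partial>lborel)"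
        by (rule nn_integral_cmult) measurable
      also have "\<dots> = G z * (ennreal (norm z ^ ?n) * ennreal (2 / (real ?n * norm z ^ ?n)))"
        using nn_integral_inverse_power_tail[OF _ n, of "norm z"] elim by (simp add: mult.assoc)
      also have "ennreal (norm z ^ ?n) * ennreal (2 / (real ?n * norm z ^ ?n)) = ennreal (2 / real ?n)"
        using elim by (simp flip: ennreal_mult)
      finally show ?case by (simp add: mult.commute)
    qed
  qed
  also have "\<dots> = ennreal (2 / real ?n) * (\<integral>\<^sup>+z. G z \<partial>lborel)"
    by (rule nn_integral_cmult) auto
  finally show ?thesis .
qed

text \<open>The measure on pairs \<open>(y, s)\<close> whose image under \<open>(y, s) \<mapsto> s sgn y\<close> is Lebesgue measure.\<close>

definition polar_density :: "(real^'n::finite) \<times> real \<Rightarrow> real" where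
  "polar_density = (\<lambda>(y, s). indicator (ball 0 1 - {0}) y * (real CARD('n) / 2 * \<bar>s\<bar> ^ (CARD('n) - 1)))"

lemma polar_density_measurable [measurable]: "(polar_density :: (real^'n::finite) \<times> real \<Rightarrow> real) \<in> borel_measurable (borel \<Otimes>\<^sub>M borel)"
proof -
  have 1: "(\<lambda>p::(real^'n) \<times> real. indicator (ball 0 1 - {0}) (fst p) :: real) \<in> borel_measurable (borel \<Otimes>\<^sub>M borel)"
    by (rule measurable_compose[OF measurable_fst]) (rule borel_measurable_indicator, simp)
  have 2: "(\<lambda>p::(real^'n) \<times> real. c * \<bar>snd p\<bar> ^ k) \<in> borel_measurable (borel \<Otimes>\<^sub>M borel)" for c :: real and k
    by (rule measurable_compose[OF measurable_snd]) measurable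
  show ?thesis
    unfolding polar_density_def case_prod_beta by (rule borel_measurable_times[OF 1 2])
qed

lemma distr_polar:
  "distr (density (lborel \<Otimes>\<^sub>M lborel) (\<lambda>p. ennreal (polar_density p))) borel (\<lambda>(y, s). s *\<^sub>R sgn y)
    = (lborel :: (real^'n::finite) measure)"
proof (rule measure_eqI)
  fix A :: "(real^'n) set" assume "A \<in> sets (distr (density (lborel \<Otimes>\<^sub>M lborel) (\<lambda>p. ennreal (polar_density p))) borel (\<lambda>(y, s). s *\<^sub>R sgn y))"
  then have [measurable]: "A \<in> sets (borel :: (real^'n) measure)" by simp
  have [measurable]: "(\<lambda>y::real^'n. sgn y) \<in> borel_measurable borel" by (simp add: borel_measurable_sgn)
  let ?n = "CARD('n)"
  have "emeasure (distr (density (lborel \<Otimes>\<^sub>M lborel) (\<lambda>p. ennreal (polar_density p))) borel (\<lambda>(y, s). s *\<^sub>R sgn y)) A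
    = (\<integral>\<^sup>+z. indicator A z \<partial>distr (density (lborel \<Otimes>\<^sub>M lborel) (\<lambda>p. ennreal (polar_density p))) borel (\<lambda>(y::real^'n, s). s *\<^sub>R sgn y))"
    by simp
  also have "\<dots> = (\<integral>\<^sup>+p. ennreal (polar_density p) * indicator A (snd p *\<^sub>R sgn (fst p)) \<partial>(lborel \<Otimes>\<^sub>M (lborel :: real measure)))"
  proof -
    have "(\<integral>\<^sup>+z. indicator A z \<partial>distr (density (lborel \<Otimes>\<^sub>M lborel) (\<lambda>p. ennreal (polar_density p))) borel (\<lambda>(y::real^'n, s). s *\<^sub>R sgn y))
      = (\<integral>\<^sup>+p. indicator A (snd p *\<^sub>R sgn (fst p)) \<partial>density (lborel \<Otimes>\<^sub>M (lborel :: real measure)) (\<lambda>p. ennreal (polar_density p)))"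
      unfolding case_prod_beta by (rule nn_integral_distr) measurable
    also have "\<dots> = (\<integral>\<^sup>+p. ennreal (polar_density p) * indicator A (snd p *\<^sub>R sgn (fst p)) \<partial>(lborel \<Otimes>\<^sub>M (lborel :: real measure)))"
      by (rule nn_integral_density) measurable
    finally show ?thesis .
  qed
  also have "\<dots> = (\<integral>\<^sup>+y. \<integral>\<^sup>+s. ennreal (polar_density (y, s)) * indicator A (s *\<^sub>R sgn y) \<partial>lborel \<partial>lborel)"
    by (subst lborel.nn_integral_fst[symmetric]) (auto simp: case_prod_beta)
  also have "\<dots> = (\<integral>\<^sup>+y. ennreal (real ?n / 2) * (indicator (ball 0 1 - {0}) y * (\<integral>\<^sup>+s. indicator A (s *\<^sub>R sgn y) * ennreal (\<bar>s\<bar> ^ (?n - 1)) \<partial>lborel)) \<partial>lborel)"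
  proof (rule nn_integral_cong)
    fix y :: "real^'n"
    have "(\<integral>\<^sup>+s. ennreal (polar_density (y, s)) * indicator A (s *\<^sub>R sgn y) \<partial>lborel)
      = (\<integral>\<^sup>+s. (ennreal (real ?n / 2) * indicator (ball 0 1 - {0}) y) * (indicator A (s *\<^sub>R sgn y) * ennreal (\<bar>s\<bar> ^ (?n - 1))) \<partial>lborel)"
      by (rule nn_integral_cong) (auto simp: polar_density_def indicator_def simp flip: ennreal_mult')
    also have "\<dots> = (ennreal (real ?n / 2) * indicator (ball 0 1 - {0}) y) * (\<integral>\<^sup>+s. indicator A (s *\<^sub>R sgn y) * ennreal (\<bar>s\<bar> ^ (?n - 1)) \<partial>lborel)"
      by (rule nn_integral_cmult) measurable
    finally show "(\<integral>\<^sup>+s. ennreal (polar_density (y, s)) * indicator A (s *\<^sub>R sgn y) \<partial>lborel)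
      = ennreal (real ?n / 2) * (indicator (ball 0 1 - {0}) y * (\<integral>\<^sup>+s. indicator A (s *\<^sub>R sgn y) * ennreal (\<bar>s\<bar> ^ (?n - 1)) \<partial>lborel))"
      by (simp add: mult.assoc)
  qed
  also have "\<dots> = ennreal (real ?n / 2) * (\<integral>\<^sup>+y. indicator (ball 0 1 - {0}) y * (\<integral>\<^sup>+s. indicator A (s *\<^sub>R sgn y) * ennreal (\<bar>s\<bar> ^ (?n - 1)) \<partial>lborel) \<partial>lborel)"
  proof (rule nn_integral_cmult)
    have 1: "(\<lambda>y::real^'n. indicator (ball 0 1 - {0}) y :: ennreal) \<in> borel_measurable lborel"
      by (rule borel_measurable_indicator) simp
    have "(\<lambda>(y::real^'n, s). indicator A (s *\<^sub>R sgn y) * ennreal (\<bar>s\<bar> ^ (?n - 1))) \<in> borel_measurable (lborel \<Otimes>\<^sub>M lborel)"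
      by measurable
    then have 2: "(\<lambda>y::real^'n. \<integral>\<^sup>+s. indicator A (s *\<^sub>R sgn y) * ennreal (\<bar>s\<bar> ^ (?n - 1)) \<partial>lborel) \<in> borel_measurable lborel"
      by (rule lborel.borel_measurable_nn_integral)
    show "(\<lambda>y::real^'n. indicator (ball 0 1 - {0}) y * (\<integral>\<^sup>+s. indicator A (s *\<^sub>R sgn y) * ennreal (\<bar>s\<bar> ^ (?n - 1)) \<partial>lborel)) \<in> borel_measurable lborel"
      by (rule borel_measurable_times_ennreal[OF 1 2])
  qed
  also have "\<dots> = ennreal (real ?n / 2) * (ennreal (2 / real ?n) * (\<integral>\<^sup>+z. indicator A z \<partial>lborel))"
    by (subst nn_integral_polar) auto
  also have "\<dots> = emeasure lborel A" by (simp add: mult.assoc[symmetric] flip: ennreal_mult)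
  finally show "emeasure (distr (density (lborel \<Otimes>\<^sub>M lborel) (\<lambda>p. ennreal (polar_density p))) borel (\<lambda>(y, s). s *\<^sub>R sgn y)) A = emeasure lborel A" .
qed simp

lemma integral_polar:
  fixes g :: "real^'n::finite \<Rightarrow> complex"
  assumes g: "integrable lborel g"
  shows "(LINT z|lborel. g z) = (LINT y|lborel. indicator (ball 0 1 - {0}) y *\<^sub>R
     (LINT s|lborel. (real CARD('n) / 2 * \<bar>s\<bar> ^ (CARD('n) - 1)) *\<^sub>R g (s *\<^sub>R sgn y)))"
proof -
  have [measurable]: "g \<in> borel_measurable borel" using g by simp
  have [measurable]: "(\<lambda>y::real^'n. sgn y) \<in> borel_measurable borel" by (simp add: borel_measurable_sgn)
  let ?M = "density (lborel \<Otimes>\<^sub>M lborel) (\<lambda>p :: (real^'n) \<times> real. ennreal (polar_density p))"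
  have nonneg: "AE p in lborel \<Otimes>\<^sub>M lborel. 0 \<le> polar_density (p :: (real^'n) \<times> real)"
    by (intro AE_I2) (auto simp: polar_density_def)
  have "integrable (distr ?M borel (\<lambda>(y, s). s *\<^sub>R sgn y)) g" using g by (simp add: distr_polar)
  then have i: "integrable (lborel \<Otimes>\<^sub>M lborel) (\<lambda>p. polar_density p *\<^sub>R g (snd p *\<^sub>R sgn (fst p)))"
    by (subst (asm) integrable_distr_eq) (auto simp: integrable_density nonneg case_prod_beta)
  have "(LINT z|lborel. g z) = integral\<^sup>L (distr ?M borel (\<lambda>(y, s). s *\<^sub>R sgn y)) g" by (simp add: distr_polar)
  also have "\<dots> = (LINT p|(lborel \<Otimes>\<^sub>M lborel). polar_density p *\<^sub>R g (snd p *\<^sub>R sgn (fst p)))"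
    by (subst integral_distr) (auto simp: integral_density nonneg case_prod_beta)
  also have "\<dots> = (LINT y|lborel. LINT s|lborel. polar_density (y, s) *\<^sub>R g (s *\<^sub>R sgn y))"
    using lborel_pair.integral_fst'[OF i] by simp
  also have "\<dots> = (LINT y|lborel. indicator (ball 0 1 - {0}) y *\<^sub>R
     (LINT s|lborel. (real CARD('n) / 2 * \<bar>s\<bar> ^ (CARD('n) - 1)) *\<^sub>R g (s *\<^sub>R sgn y)))"
    by (intro Bochner_Integration.integral_cong refl) (auto simp: polar_density_def indicator_def)
  finally show ?thesis .
qed

text \<open>The surface measure of a set is defined through the cone over it in the punctured unit ball, which
  is also the domain of \<open>y\<close> in \<open>integral_polar\<close>, so the two formulas fit together.\<close>

lemma integral_sphere_measure:
  fixes \<phi> :: "real^'n::finite \<Rightarrow> complex"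
  assumes [measurable]: "\<phi> \<in> borel_measurable borel"
  shows "(LINT \<theta>|sphere_measure. \<phi> \<theta>) = (LINT y|lborel. indicator (ball 0 1 - {0}) y *\<^sub>R (real CARD('n) *\<^sub>R \<phi> (sgn y)))"
proof -
  let ?R = "restrict_space lborel (ball 0 1 - {0}) :: (real^'n) measure"
  have [measurable]: "(\<lambda>y::real^'n. sgn y) \<in> borel_measurable borel" by (simp add: borel_measurable_sgn)
  have sgnR[measurable]: "sgn \<in> ?R \<rightarrow>\<^sub>M borel"
    by (rule measurable_restrict_space1) simp
  have "sphere_measure = density (distr ?R borel sgn) (\<lambda>_. ennreal (real CARD('n)))"
    unfolding sphere_measure_def
    by (rule measure_eqI) (auto simp: emeasure_density nn_integral_cmult_indicator ennreal_of_nat_eq_real_of_nat)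
  then have "(LINT \<theta>|sphere_measure. \<phi> \<theta>)
      = integral\<^sup>L (density (distr ?R borel sgn) (\<lambda>_. ennreal (real CARD('n)))) \<phi>" by simp
  also have "\<dots> = (LINT \<theta>|distr ?R borel sgn. real CARD('n) *\<^sub>R \<phi> \<theta>)"
    by (rule integral_density) auto
  also have "\<dots> = (LINT y|?R. real CARD('n) *\<^sub>R \<phi> (sgn y))"
    by (rule integral_distr[OF sgnR]) simp
  also have "\<dots> = (LINT y|lborel. indicator (ball 0 1 - {0}) y *\<^sub>R (real CARD('n) *\<^sub>R \<phi> (sgn y)))"
    by (rule integral_restrict_space) simp
  finally show ?thesis .
qed

section \<open>The kernels of the normal operator\<close>

text \<open>The exponent of the squared norm in the kernel \<open>|y|\<^bsup>1-n\<^esup>\<close>.\<close>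

abbreviation riesz_exponent :: "'n::finite itself \<Rightarrow> real" where
  "riesz_exponent _ \<equiv> (1 - real CARD('n)) / 2"

definition riesz_kernel :: "real^'n::finite \<Rightarrow> complex" where
  "riesz_kernel = dist_power 0 (riesz_exponent TYPE('n))"

definition normal_kernel :: "'n \<Rightarrow> 'n \<Rightarrow> real^'n::finite \<Rightarrow> complex" where
  "normal_kernel k j y = of_real (y $ k * y $ j) * dist_power 0 (riesz_exponent TYPE('n) - 1) y"

lemma radial_weight:
  fixes s :: real
  assumes "s \<noteq> 0"
  shows "(s\<^sup>2) powr (riesz_exponent TYPE('n::finite)) * \<bar>s\<bar> ^ (CARD('n) - 1) = 1"
proof -
  have n: "CARD('n) \<ge> 1" by (simp add: Suc_leI)
  have "(s\<^sup>2) powr (riesz_exponent TYPE('n)) = \<bar>s\<bar> powr (1 - real CARD('n))"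
  proof -
    have "(s\<^sup>2) powr (riesz_exponent TYPE('n)) = (\<bar>s\<bar> powr 2) powr (riesz_exponent TYPE('n))"
      using assms by (simp add: powr_numeral)
    also have "\<dots> = \<bar>s\<bar> powr (2 * riesz_exponent TYPE('n))" by (rule powr_powr)
    also have "2 * riesz_exponent TYPE('n) = 1 - real CARD('n)" by simp
    finally show ?thesis .
  qed
  moreover have "\<bar>s\<bar> ^ (CARD('n) - 1) = \<bar>s\<bar> powr (real CARD('n) - 1)"
    using assms n powr_realpow[of "\<bar>s\<bar>" "CARD('n) - 1"] by (simp add: of_nat_diff)
  ultimately show ?thesis using assms by (simp flip: powr_add)
qed

lemma riesz_kernel_borel [measurable]: "riesz_kernel \<in> borel_measurable borel"
  unfolding riesz_kernel_def dist_power_def[abs_def] by measurable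

text \<open>The kernel \<open>|y|\<^bsup>1-n\<^esup>\<close> is locally integrable because in polar coordinates it becomes the constant
  one.\<close>

lemma riesz_translation_kernel:
  "translation_kernel lborel (\<lambda>y. 1 *\<^sub>R y) (riesz_kernel :: real^'n::finite \<Rightarrow> complex)"
proof (rule kernel_lborel)
  fix K :: "(real^'n) set" assume K: "compact K"
  obtain r0 where r0: "\<And>x. x \<in> K \<Longrightarrow> norm x \<le> r0"
    using compact_imp_bounded[OF K] unfolding bounded_iff by blast
  define r where "r = max r0 0"
  have r: "r \<ge> 0" "\<And>x. x \<in> K \<Longrightarrow> norm x \<le> r" using r0 by (auto simp: r_def le_max_iff_disj)
  define G where "G z = indicator (cball 0 r) z * ennreal ((norm z)\<^sup>2 powr (riesz_exponent TYPE('n)))" for z :: "real^'n"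
  have [measurable]: "G \<in> borel_measurable borel" unfolding G_def
    by (rule borel_measurable_times_ennreal, rule borel_measurable_indicator, simp, measurable)
  let ?B = "ball (0::real^'n) 1 - {0}"
  have "ennreal (2 / real CARD('n)) * (\<integral>\<^sup>+z. G z \<partial>lborel)
    = (\<integral>\<^sup>+y. indicator ?B y * (\<integral>\<^sup>+s. G (s *\<^sub>R sgn y) * ennreal (\<bar>s\<bar> ^ (CARD('n) - 1)) \<partial>lborel) \<partial>lborel)"
    by (rule nn_integral_polar[symmetric]) simp
  also have "\<dots> \<le> (\<integral>\<^sup>+y. ennreal (2 * r) * indicator ?B y \<partial>lborel)"
  proof (rule nn_integral_mono)
    fix y :: "real^'n"
    show "indicator ?B y * (\<integral>\<^sup>+s. G (s *\<^sub>R sgn y) * ennreal (\<bar>s\<bar> ^ (CARD('n) - 1)) \<partial>lborel) \<le> ennreal (2 * r) * indicator ?B y"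
    proof (cases "y \<in> ?B")
      case True
      then have ny: "norm (sgn y) = 1" by (simp add: norm_sgn)
      have "(\<integral>\<^sup>+s. G (s *\<^sub>R sgn y) * ennreal (\<bar>s\<bar> ^ (CARD('n) - 1)) \<partial>lborel) \<le> (\<integral>\<^sup>+s. indicator {-r..r} s \<partial>lborel)"
      proof (rule nn_integral_mono)
        fix s :: real
        show "G (s *\<^sub>R sgn y) * ennreal (\<bar>s\<bar> ^ (CARD('n) - 1)) \<le> indicator {-r..r} s"
        proof (cases "s = 0")
          case False
          have "ennreal ((\<bar>s\<bar>)\<^sup>2 powr (riesz_exponent TYPE('n))) * ennreal (\<bar>s\<bar> ^ (CARD('n) - 1)) = 1"
            using radial_weight[OF False, where 'n='n] by (simp flip: ennreal_mult)
          then have "G (s *\<^sub>R sgn y) * ennreal (\<bar>s\<bar> ^ (CARD('n) - 1)) = indicator (cball 0 r) (s *\<^sub>R sgn y)"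
            unfolding G_def norm_scaleR ny by (simp add: mult.assoc)
          then show ?thesis using ny by (auto simp: indicator_def abs_le_iff)
        qed (simp add: G_def)
      qed
      also have "\<dots> = ennreal (2 * r)" using r(1) by simp
      finally show ?thesis using True by simp
    qed simp
  qed
  also have "\<dots> = ennreal (2 * r) * emeasure lborel ?B" by (rule nn_integral_cmult_indicator) simp
  also have "\<dots> < \<infinity>"
    using emeasure_bounded_finite[of ?B] bounded_subset[OF bounded_ball, of ?B] by (auto simp: ennreal_mult_less_top)
  finally have "ennreal (2 / real CARD('n)) * (\<integral>\<^sup>+z. G z \<partial>lborel) < \<infinity>" .
  then have fin: "(\<integral>\<^sup>+z. G z \<partial>lborel) < \<infinity>" by (auto simp: ennreal_mult_less_top)
  have [measurable]: "K \<in> sets borel" using K by (rule borel_compact)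
  show "integrable lborel (\<lambda>y. indicator K y * cmod (riesz_kernel y))"
  proof (rule integrableI_bounded)
    have "(\<integral>\<^sup>+y. ennreal (norm (indicator K y * cmod (riesz_kernel y))) \<partial>lborel) \<le> (\<integral>\<^sup>+z. G z \<partial>lborel)"
      using r(2) by (intro nn_integral_mono) (auto simp: G_def indicator_def riesz_kernel_def cmod_dist_power)
    then show "(\<integral>\<^sup>+y. ennreal (norm (indicator K y * cmod (riesz_kernel y))) \<partial>lborel) < \<infinity>"
      using fin by (rule le_less_trans)
  qed measurable
qed auto

lemma dominated_translation_kernel:
  fixes k :: "real^'n::finite \<Rightarrow> complex"
  assumes [measurable]: "k \<in> borel_measurable borel" and bd: "\<And>y. cmod (k y) \<le> cmod (riesz_kernel y)"
  shows "translation_kernel lborel (\<lambda>y. 1 *\<^sub>R y) k"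
proof (rule kernel_lborel)
  fix K :: "(real^'n) set" assume K: "compact K"
  have [measurable]: "K \<in> sets borel" using K by (rule borel_compact)
  have "integrable lborel (\<lambda>y. indicator K y * cmod (riesz_kernel y :: complex))"
    using riesz_translation_kernel[where 'n='n] K unfolding translation_kernel_def by simp
  then show "integrable lborel (\<lambda>y. indicator K y * cmod (k y))"
    by (rule Bochner_Integration.integrable_bound) (use bd in \<open>auto simp: indicator_def\<close>)
qed auto

lemma component_product_le: "\<bar>y $ k * y $ j\<bar> \<le> (norm y)\<^sup>2" for y :: "real^'n::finite"
  unfolding abs_mult power2_eq_square by (intro mult_mono component_le_norm_cart) auto

lemma normal_kernel_bound: "cmod (normal_kernel k j y) \<le> cmod (riesz_kernel y)" for y :: "real^'n::finite"
proof (cases "y = 0")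
  case False
  have "cmod (normal_kernel k j y) = \<bar>y $ k * y $ j\<bar> * (norm y)\<^sup>2 powr (riesz_exponent TYPE('n) - 1)"
    unfolding normal_kernel_def norm_mult norm_of_real cmod_dist_power by simp
  also have "\<dots> \<le> (norm y)\<^sup>2 * (norm y)\<^sup>2 powr (riesz_exponent TYPE('n) - 1)"
    by (intro mult_right_mono component_product_le) auto
  also have "\<dots> = (norm y)\<^sup>2 powr (1 + (riesz_exponent TYPE('n) - 1))"
    unfolding powr_add using False by simp
  finally show ?thesis by (simp add: riesz_kernel_def cmod_dist_power)
qed (simp add: normal_kernel_def riesz_kernel_def dist_power_def)

lemma normal_kernel_borel [measurable]: "normal_kernel k j \<in> borel_measurable borel"
  unfolding normal_kernel_def[abs_def] dist_power_def[abs_def] by measurable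

lemma normal_translation_kernel: "translation_kernel lborel (\<lambda>y. 1 *\<^sub>R y) (normal_kernel k j)"
  by (rule dominated_translation_kernel[OF normal_kernel_borel normal_kernel_bound])

abbreviation convolve :: "(real^'n::finite \<Rightarrow> complex) \<Rightarrow> (real^'n \<Rightarrow> complex) \<Rightarrow> real^'n \<Rightarrow> complex" where
  "convolve k \<equiv> translation_integral lborel (\<lambda>y. 1 *\<^sub>R y) k"

subsection \<open>Regularisation\<close>

definition reg_power :: "real \<Rightarrow> real \<Rightarrow> real^'n::finite \<Rightarrow> complex" where
  "reg_power e s y = of_real (((norm y)\<^sup>2 + e) powr s)"

lemma smooth_norm_sq_plus: "smooth_on UNIV (\<lambda>y::real^'n::finite. complex_of_real ((norm y)\<^sup>2 + e))"
  using smooth_on_add[OF open_UNIV smooth_on_norm_sq[OF open_UNIV, of "0::real^'n"] smooth_on_const[of UNIV "of_real e"]]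
  by simp

lemma smooth_reg_power: "e > 0 \<Longrightarrow> smooth_on UNIV (reg_power e s)"
  unfolding reg_power_def[abs_def]
  by (rule smooth_on_powr[OF open_UNIV smooth_norm_sq_plus]) (simp add: add_nonneg_pos)

lemma partial_deriv_reg_power:
  assumes "e > 0"
  shows "partial_deriv j (reg_power e s) y = 2 * of_real s * of_real (y $ j) * reg_power e (s - 1) y"
proof -
  have pos: "(norm y)\<^sup>2 + e > 0" using assms by (simp add: add_nonneg_pos)
  have "((\<lambda>t. t powr s) has_real_derivative s * ((norm y)\<^sup>2 + e) powr (s - 1)) (at ((norm y)\<^sup>2 + e))"
    using pos by (auto intro!: derivative_eq_intros)
  from partial_deriv_eq[OF has_derivative_of_real_comp[OF open_UNIV UNIV_I
      smooth_on_imp_differentiable[OF smooth_norm_sq_plus] this], of j]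
  have 1: "partial_deriv j (\<lambda>x. complex_of_real (((norm x)\<^sup>2 + e) powr s)) y
     = of_real (s * ((norm y)\<^sup>2 + e) powr (s - 1)) * partial_deriv j (\<lambda>x. complex_of_real ((norm x)\<^sup>2 + e)) y"
    by (simp add: partial_deriv_def)
  have "partial_deriv j (\<lambda>x. complex_of_real ((norm (x - 0))\<^sup>2) + of_real e) y
     = partial_deriv j (\<lambda>x. complex_of_real ((norm (x - 0))\<^sup>2)) y + partial_deriv j (\<lambda>x. of_real e) y"
    by (rule partial_deriv_add[OF open_UNIV smooth_on_imp_differentiable[OF smooth_on_norm_sq[OF open_UNIV]] differentiable_on_const' UNIV_I])
  then have 2: "partial_deriv j (\<lambda>x. complex_of_real ((norm x)\<^sup>2 + e)) y = 2 * of_real (y $ j)"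
    unfolding partial_deriv_norm_sq by (simp add: partial_deriv_const)
  show ?thesis unfolding reg_power_def[abs_def] 1 2 by (simp add: mult_ac)
qed

lemma partial_deriv_translate:
  assumes "f differentiable_on UNIV"
  shows "partial_deriv j (\<lambda>y. f (x + y)) = (\<lambda>y. partial_deriv j f (x + y))"
proof
  fix y
  have L: "(f has_derivative frechet_derivative f (at (x + y))) (at (x + y))"
    by (rule has_derivative_frechet[OF assms]) auto
  have "((\<lambda>y. x + y) has_derivative (\<lambda>h. h)) (at y)" by (auto intro!: derivative_eq_intros)
  from partial_deriv_eq[OF has_derivative_compose[OF this L], of j]
  show "partial_deriv j (\<lambda>y. f (x + y)) y = partial_deriv j f (x + y)" by (simp add: partial_deriv_def)
qed

lemma derivs_translate:
  assumes "smooth_on UNIV f"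
  shows "derivs js (\<lambda>y. f (x + y)) = (\<lambda>y. derivs js f (x + y))"
  by (induction js) (simp_all add: partial_deriv_translate[OF smooth_on_imp_differentiable[OF smooth_on_derivs[OF assms]]])

lemma smooth_on_translate:
  assumes "smooth_on UNIV f"
  shows "smooth_on UNIV (\<lambda>y. f (x + y))"
  unfolding smooth_on_def
proof
  fix js
  have d: "\<And>z. derivs js f differentiable at z"
    using smooth_on_imp_differentiable[OF smooth_on_derivs[OF assms, of js]] by (simp add: differentiable_on_def)
  have "(\<lambda>y. x + y) differentiable at y" for y :: "real^'a" by (intro differentiable_add) auto
  then show "derivs js (\<lambda>y. f (x + y)) differentiable_on UNIV"
    unfolding derivs_translate[OF assms] differentiable_on_def
    using differentiable_chain_at[OF _ d, of "\<lambda>y. x + y"] by (simp add: comp_def)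
qed

lemma test_translate:
  assumes "\<eta> \<in> test_functions"
  shows "(\<lambda>y. \<eta> (x + y)) \<in> test_functions"
proof (rule testI[OF smooth_on_translate[OF test_smooth[OF assms]]])
  show "compact ((\<lambda>z. z - x) ` fun_support \<eta>)"
    by (intro compact_continuous_image test_compact assms continuous_intros)
  show "\<eta> (x + y) = 0" if "y \<notin> (\<lambda>z. z - x) ` fun_support \<eta>" for y
    using that fun_supportI[of \<eta> "x + y"] by (force simp: image_iff)
qed

lemma tendsto_convolve:
  fixes k :: "real^'n::finite \<Rightarrow> complex"
  assumes \<eta>: "\<eta> \<in> test_functions" and [measurable]: "\<And>m. kk m \<in> borel_measurable borel" "k \<in> borel_measurable borel"
    and bd: "\<And>m y. y \<noteq> 0 \<Longrightarrow> cmod (kk m y) \<le> cmod (riesz_kernel y)"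
    and lim: "\<And>y. y \<noteq> 0 \<Longrightarrow> (\<lambda>m. kk m y) \<longlonglongrightarrow> k y"
  shows "(\<lambda>m. convolve (kk m) \<eta> x) \<longlonglongrightarrow> convolve k \<eta> x"
  unfolding translation_integral_def scaleR_one
proof (rule integral_dominated_convergence[where w="\<lambda>y. cmod (riesz_kernel y * \<eta> (x + y))"])
  have [measurable]: "\<eta> \<in> borel_measurable borel" by (rule test_borel[OF \<eta>])
  show "(\<lambda>y. k y * \<eta> (x + y)) \<in> borel_measurable lborel" by measurable
  show "(\<lambda>y. kk m y * \<eta> (x + y)) \<in> borel_measurable lborel" for m by measurable
  show "integrable lborel (\<lambda>y. cmod (riesz_kernel y * \<eta> (x + y)))"
    using translation_integrable[OF riesz_translation_kernel \<eta>, of x] by (intro integrable_norm) simp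
  show "AE y in lborel. (\<lambda>m. kk m y * \<eta> (x + y)) \<longlonglongrightarrow> k y * \<eta> (x + y)"
    using AE_lborel_singleton[of "0::real^'n"] by eventually_elim (intro tendsto_mult lim tendsto_const)
  show "AE y in lborel. norm (kk m y * \<eta> (x + y)) \<le> cmod (riesz_kernel y * \<eta> (x + y))" for m
    using AE_lborel_singleton[of "0::real^'n"] by eventually_elim (auto simp: norm_mult intro!: mult_right_mono bd)
qed

lemma reg_power_tendsto:
  assumes "y \<noteq> 0"
  shows "(\<lambda>m. reg_power (1 / real (Suc m)) s y) \<longlonglongrightarrow> dist_power 0 s y"
  unfolding reg_power_def dist_power_def
proof (intro tendsto_of_real tendsto_powr tendsto_const)
  have "(\<lambda>m. (norm y)\<^sup>2 + 1 / real (Suc m)) \<longlonglongrightarrow> (norm y)\<^sup>2 + 0"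
    by (intro tendsto_add tendsto_const) (use LIMSEQ_inverse_real_of_nat in \<open>simp add: inverse_eq_divide\<close>)
  then show "(\<lambda>m. (norm y)\<^sup>2 + 1 / real (Suc m)) \<longlonglongrightarrow> (norm (y - 0))\<^sup>2" by simp
qed (use assms in simp)

lemma reg_power_le:
  assumes "y \<noteq> 0" "e \<ge> 0" "s \<le> 0"
  shows "cmod (reg_power e s y) \<le> (norm y)\<^sup>2 powr s"
  unfolding reg_power_def norm_of_real using assms by (simp add: powr_mono2')

subsection \<open>The curl of the normal operator\<close>

text \<open>In the kernels \<open>y\<^sub>k y\<^sub>j |y|\<^bsup>-n-1\<^esup>\<close> the antisymmetrisation
  \<open>\<partial>\<^sub>i(y\<^sub>k y\<^sub>j \<rho>) - \<partial>\<^sub>j(y\<^sub>k y\<^sub>i \<rho>) = (\<delta>\<^sub>i\<^sub>k y\<^sub>j - \<delta>\<^sub>j\<^sub>k y\<^sub>i) \<rho>\<close> for radial \<open>\<rho>\<close> does not involve derivatives of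
  \<open>\<rho>\<close>, and \<open>y\<^sub>j |y|\<^bsup>-n-1\<^esup>\<close> is a multiple of \<open>\<partial>\<^sub>j |y|\<^bsup>1-n\<^esup>\<close>. The identity holds exactly for the
  regularised kernels, where integration by parts has no boundary terms.\<close>

lemma regularised_curl_identity:
  fixes \<eta> :: "real^'n::finite \<Rightarrow> complex"
  assumes n: "CARD('n) \<ge> 2" and e: "e > 0" and \<eta>: "\<eta> \<in> test_functions"
  defines "s \<equiv> riesz_exponent TYPE('n)"
  defines "K \<equiv> \<lambda>k j y. of_real (y $ k * y $ j) * reg_power e (s - 1) y"
  shows "convolve (K k j) (partial_deriv i \<eta>) x - convolve (K k i) (partial_deriv j \<eta>) x
    = (1 / of_real (real CARD('n) - 1)) *
      ((if k = j then convolve (reg_power e s) (partial_deriv i \<eta>) x else 0)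
       - (if k = i then convolve (reg_power e s) (partial_deriv j \<eta>) x else 0))"
proof -
  let ?\<eta> = "\<lambda>y. \<eta> (x + y)"
  have t: "?\<eta> \<in> test_functions" by (rule test_translate[OF \<eta>])
  have pd: "partial_deriv l ?\<eta> y = partial_deriv l \<eta> (x + y)" for l y
    using partial_deriv_translate[OF smooth_on_imp_differentiable[OF test_smooth[OF \<eta>]], of l x] by simp
  have by_parts: "convolve g (partial_deriv l \<eta>) x = - (LINT y|lborel. partial_deriv l g y * ?\<eta> y)"
    if "smooth_on UNIV g" for g l
    using integration_by_parts[OF that t, of l] by (simp add: translation_integral_def pd)
  have sr: "smooth_on UNIV (reg_power e r)" for r by (rule smooth_reg_power[OF e])
  have sc: "smooth_on UNIV (\<lambda>y. complex_of_real (y $ l))" for l :: 'n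
    using smooth_on_coord[of UNIV l 0] by simp
  have pc: "partial_deriv i (\<lambda>y. complex_of_real (y $ l)) y = (if l = i then 1 else 0)" for i l :: 'n and y
    using partial_deriv_coord[of i l 0] by simp
  have sK: "smooth_on UNIV (K k j)" for k j
    unfolding K_def of_real_mult by (intro smooth_on_mult sc sr open_UNIV)
  have pK: "partial_deriv i (K k j) y = ((if k = i then of_real (y $ j) else 0) + (if j = i then of_real (y $ k) else 0)) * reg_power e (s - 1) y
     + of_real (y $ k * y $ j * y $ i) * (2 * of_real (s - 1) * reg_power e (s - 1 - 1) y)" for i j k y
  proof -
    have s2: "smooth_on UNIV (\<lambda>y. complex_of_real (y $ k) * of_real (y $ j))" by (intro smooth_on_mult sc open_UNIV)
    have "partial_deriv i (K k j) y = partial_deriv i (\<lambda>y. complex_of_real (y $ k) * of_real (y $ j)) y * reg_power e (s - 1) y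
       + (complex_of_real (y $ k) * of_real (y $ j)) * partial_deriv i (reg_power e (s - 1)) y"
      unfolding K_def of_real_mult
      by (rule partial_deriv_mult[OF open_UNIV smooth_on_imp_differentiable[OF s2] smooth_on_imp_differentiable[OF sr]]) simp
    also have "partial_deriv i (\<lambda>y. complex_of_real (y $ k) * of_real (y $ j)) y
       = partial_deriv i (\<lambda>y. complex_of_real (y $ k)) y * of_real (y $ j) + of_real (y $ k) * partial_deriv i (\<lambda>y. complex_of_real (y $ j)) y"
      by (rule partial_deriv_mult[OF open_UNIV smooth_on_imp_differentiable[OF sc] smooth_on_imp_differentiable[OF sc]]) simp
    finally show ?thesis
      unfolding pc partial_deriv_reg_power[OF e] by (simp add: algebra_simps)
  qed
  define E where "E l = (LINT y|lborel. of_real (y $ l) * reg_power e (s - 1) y * ?\<eta> y)" for l :: 'n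
  have iE: "integrable lborel (\<lambda>y. of_real (y $ l) * reg_power e (s - 1) y * ?\<eta> y)" for l :: 'n
    by (intro integrable_test test_mult t smooth_on_mult sc sr open_UNIV)
  have iK: "integrable lborel (\<lambda>y. partial_deriv i (K k j) y * ?\<eta> y)" for i j k
    by (intro integrable_test test_mult t smooth_on_partial_deriv sK)
  have "convolve (K k j) (partial_deriv i \<eta>) x - convolve (K k i) (partial_deriv j \<eta>) x
     = (LINT y|lborel. partial_deriv j (K k i) y * ?\<eta> y) - (LINT y|lborel. partial_deriv i (K k j) y * ?\<eta> y)"
    unfolding by_parts[OF sK] by simp
  also have "\<dots> = (LINT y|lborel. partial_deriv j (K k i) y * ?\<eta> y - partial_deriv i (K k j) y * ?\<eta> y)"
    by (rule Bochner_Integration.integral_diff[OF iK iK, symmetric])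
  also have "\<dots> = (LINT y|lborel. (if k = j then of_real (y $ i) * reg_power e (s - 1) y * ?\<eta> y else 0)
       - (if k = i then of_real (y $ j) * reg_power e (s - 1) y * ?\<eta> y else 0))"
    unfolding pK by (intro Bochner_Integration.integral_cong refl) (auto simp: algebra_simps)
  also have "\<dots> = (if k = j then E i else 0) - (if k = i then E j else 0)"
    using iE by (auto simp: E_def)
  finally have 1: "convolve (K k j) (partial_deriv i \<eta>) x - convolve (K k i) (partial_deriv j \<eta>) x
     = (if k = j then E i else 0) - (if k = i then E j else 0)" .
  have "convolve (reg_power e s) (partial_deriv l \<eta>) x = of_real (real CARD('n) - 1) * E l" for l
  proof -
    have "(LINT y|lborel. partial_deriv l (reg_power e s) y * ?\<eta> y)
      = (LINT y|lborel. (2 * of_real s) * (of_real (y $ l) * reg_power e (s - 1) y * ?\<eta> y))"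
      unfolding partial_deriv_reg_power[OF e] by (simp only: mult.assoc)
    also have "\<dots> = (2 * of_real s) * E l" unfolding E_def by (rule integral_mult_right_zero)
    finally have int: "(LINT y|lborel. partial_deriv l (reg_power e s) y * ?\<eta> y) = (2 * of_real s) * E l" .
    have s2: "2 * complex_of_real s = - of_real (real CARD('n) - 1)" by (simp add: s_def)
    show ?thesis unfolding by_parts[OF sr] int s2 by (simp add: algebra_simps)
  qed
  then have 2: "E l = (1 / of_real (real CARD('n) - 1)) * convolve (reg_power e s) (partial_deriv l \<eta>) x" for l
    using n by simp
  have "(if a then c * X else 0) - (if b then c * Y else 0) = c * ((if a then X else 0) - (if b then Y else 0))"
    for a b and c X Y :: complex
    by (simp add: algebra_simps)
  then show ?thesis unfolding 1 2 .
qed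

lemma curl_identity:
  fixes \<eta> :: "real^'n::finite \<Rightarrow> complex"
  assumes n: "CARD('n) \<ge> 2" and \<eta>: "\<eta> \<in> test_functions"
  shows "convolve (normal_kernel k j) (partial_deriv i \<eta>) x - convolve (normal_kernel k i) (partial_deriv j \<eta>) x
    = (1 / of_real (real CARD('n) - 1)) *
      ((if k = j then convolve riesz_kernel (partial_deriv i \<eta>) x else 0)
       - (if k = i then convolve riesz_kernel (partial_deriv j \<eta>) x else 0))"
proof -
  let ?s = "riesz_exponent TYPE('n)"
  let ?K = "\<lambda>m k j y. of_real (y $ k * y $ j) * reg_power (1 / real (Suc m)) (?s - 1) y"
  let ?R = "\<lambda>m. reg_power (1 / real (Suc m)) ?s :: real^'n \<Rightarrow> complex"
  have s0: "?s \<le> 0" by (simp add: Suc_leI)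
  have limK: "(\<lambda>m. convolve (?K m k j) (partial_deriv i \<eta>) x) \<longlonglongrightarrow> convolve (normal_kernel k j) (partial_deriv i \<eta>) x" for i j k
  proof (rule tendsto_convolve[OF test_partial_deriv[OF \<eta>]])
    show "?K m k j \<in> borel_measurable borel" for m unfolding reg_power_def by measurable
    fix m and y :: "real^'n" assume y: "y \<noteq> 0"
    have "cmod (?K m k j y) = \<bar>y $ k * y $ j\<bar> * cmod (reg_power (1 / real (Suc m)) (?s - 1) y)"
      unfolding norm_mult norm_of_real by simp
    also have "\<dots> \<le> (norm y)\<^sup>2 * (norm y)\<^sup>2 powr (?s - 1)"
      by (intro mult_mono component_product_le reg_power_le y) (use s0 in auto)
    also have "\<dots> = (norm y)\<^sup>2 powr (1 + (?s - 1))" unfolding powr_add using y by simp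
    finally show "cmod (?K m k j y) \<le> cmod (riesz_kernel y)" by (simp add: riesz_kernel_def cmod_dist_power)
    show "(\<lambda>m. ?K m k j y) \<longlonglongrightarrow> normal_kernel k j y"
      unfolding normal_kernel_def by (intro tendsto_mult tendsto_const reg_power_tendsto y)
  qed measurable
  have limR: "(\<lambda>m. convolve (?R m) (partial_deriv i \<eta>) x) \<longlonglongrightarrow> convolve riesz_kernel (partial_deriv i \<eta>) x" for i
  proof (rule tendsto_convolve[OF test_partial_deriv[OF \<eta>]])
    show "?R m \<in> borel_measurable borel" for m unfolding reg_power_def by measurable
    fix m and y :: "real^'n" assume y: "y \<noteq> 0"
    show "cmod (?R m y) \<le> cmod (riesz_kernel y)"
      using reg_power_le[OF y, of "1 / real (Suc m)" ?s] s0 by (simp add: riesz_kernel_def cmod_dist_power)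
    show "(\<lambda>m. ?R m y) \<longlonglongrightarrow> riesz_kernel y"
      unfolding riesz_kernel_def by (rule reg_power_tendsto[OF y])
  qed measurable
  have if_lim: "(\<lambda>m. if b then f m else 0) \<longlonglongrightarrow> (if b then l else 0)" if "f \<longlonglongrightarrow> l"
    for f :: "nat \<Rightarrow> complex" and l b
    using that by (cases b) auto
  have eq: "convolve (?K m k j) (partial_deriv i \<eta>) x - convolve (?K m k i) (partial_deriv j \<eta>) x
     = (1 / complex_of_real (real CARD('n) - 1)) *
      ((if k = j then convolve (?R m) (partial_deriv i \<eta>) x else 0)
       - (if k = i then convolve (?R m) (partial_deriv j \<eta>) x else 0))" for m
    by (rule regularised_curl_identity[OF n _ \<eta>]) simp
  have lim1: "(\<lambda>m. convolve (?K m k j) (partial_deriv i \<eta>) x - convolve (?K m k i) (partial_deriv j \<eta>) x)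
     \<longlonglongrightarrow> convolve (normal_kernel k j) (partial_deriv i \<eta>) x - convolve (normal_kernel k i) (partial_deriv j \<eta>) x"
    by (intro tendsto_diff limK)
  have lim2: "(\<lambda>m. convolve (?K m k j) (partial_deriv i \<eta>) x - convolve (?K m k i) (partial_deriv j \<eta>) x)
     \<longlonglongrightarrow> (1 / of_real (real CARD('n) - 1)) *
      ((if k = j then convolve riesz_kernel (partial_deriv i \<eta>) x else 0)
       - (if k = i then convolve riesz_kernel (partial_deriv j \<eta>) x else 0))"
    unfolding eq by (intro tendsto_mult[OF tendsto_const] tendsto_diff if_lim limR)
  show ?thesis by (rule LIMSEQ_unique[OF lim1 lim2])
qed

subsection \<open>The normal operator as a convolution\<close>

text \<open>The projection of \<open>x\<close> to the hyperplane orthogonal to \<open>\<theta>\<close> only shifts the parameter of the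
  line, so the composition integrates \<open>\<theta>\<^sub>k \<theta>\<^sub>j \<eta>(x + s \<theta>)\<close> over all directions and all real \<open>s\<close>. In
  polar coordinates \<open>y = s \<theta>\<close> this is a volume integral, counted twice.\<close>

lemma xray_adjoint_xray:
  fixes \<eta> :: "real^'n::finite \<Rightarrow> complex"
  assumes \<eta>: "\<eta> \<in> test_functions"
  shows "xray_adjoint (xray (\<lambda>l. if l = j then \<eta> else (\<lambda>_. 0))) k = (\<lambda>x. 2 * convolve (normal_kernel k j) \<eta> x)"
proof
  fix x :: "real^'n"
  have [measurable]: "\<eta> \<in> borel_measurable borel" by (rule test_borel[OF \<eta>])
  have [measurable]: "(\<lambda>y::real^'n. sgn y) \<in> borel_measurable borel" by (simp add: borel_measurable_sgn)
  let ?n = "CARD('n)"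
  define \<phi> where "\<phi> \<theta> = of_real (\<theta> $ k) * (LINT s|lborel. \<eta> (x + s *\<^sub>R \<theta>) * of_real (\<theta> $ j))" for \<theta>
  have xr: "xray (\<lambda>l. if l = j then \<eta> else (\<lambda>_. 0)) (x - (x \<bullet> \<theta>) *\<^sub>R \<theta>, \<theta>) = (LINT s|lborel. \<eta> (x + s *\<^sub>R \<theta>) * of_real (\<theta> $ j))" for \<theta>
  proof -
    have "(\<Sum>l\<in>UNIV. (if l = j then \<eta> else (\<lambda>_. 0)) z * complex_of_real (\<theta> $ l)) = \<eta> z * of_real (\<theta> $ j)" for z
    proof -
      have "(\<Sum>l\<in>UNIV. (if l = j then \<eta> else (\<lambda>_. 0)) z * complex_of_real (\<theta> $ l)) = (\<Sum>l\<in>UNIV. if l = j then \<eta> z * of_real (\<theta> $ l) else 0)"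
        by (rule sum.cong) auto
      then show ?thesis by simp
    qed
    then have "xray (\<lambda>l. if l = j then \<eta> else (\<lambda>_. 0)) (x - (x \<bullet> \<theta>) *\<^sub>R \<theta>, \<theta>)
       = (LINT s|lborel. \<eta> (x - (x \<bullet> \<theta>) *\<^sub>R \<theta> + s *\<^sub>R \<theta>) * of_real (\<theta> $ j))"
      by (simp add: xray_def)
    also have "\<dots> = (LINT s|lborel. \<eta> (x - (x \<bullet> \<theta>) *\<^sub>R \<theta> + (x \<bullet> \<theta> + 1 * s) *\<^sub>R \<theta>) * of_real (\<theta> $ j))"
      by (subst lborel_integral_real_affine[where c=1 and t="x \<bullet> \<theta>"]) simp_all
    finally show ?thesis by (simp add: algebra_simps)
  qed
  have "continuous_on UNIV (\<lambda>p::(real^'n) \<times> real. \<eta> (x + snd p *\<^sub>R fst p) * complex_of_real (fst p $ j))"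
    by (intro continuous_intros continuous_on_compose2[OF test_continuous[OF \<eta>]]) auto
  then have m1: "(\<lambda>p::(real^'n) \<times> real. \<eta> (x + snd p *\<^sub>R fst p) * complex_of_real (fst p $ j)) \<in> borel_measurable (borel \<Otimes>\<^sub>M borel)"
    unfolding borel_prod by (rule borel_measurable_continuous_onI)
  have m2: "sets (borel \<Otimes>\<^sub>M borel) = sets ((borel :: (real^'n) measure) \<Otimes>\<^sub>M (lborel :: real measure))"
    by (rule sets_pair_measure_cong) auto
  have "(\<lambda>(\<theta>, s). \<eta> (x + s *\<^sub>R \<theta>) * complex_of_real (\<theta> $ j)) \<in> borel_measurable (borel \<Otimes>\<^sub>M lborel)"
    using m1[unfolded measurable_cong_sets[OF m2 refl]] unfolding case_prod_beta .
  then have "(\<lambda>\<theta>. LINT s|lborel. \<eta> (x + s *\<^sub>R \<theta>) * complex_of_real (\<theta> $ j)) \<in> borel_measurable borel"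
    by (rule lborel.borel_measurable_lebesgue_integral)
  moreover have "(\<lambda>\<theta>::real^'n. complex_of_real (\<theta> $ k)) \<in> borel_measurable borel"
    by (intro borel_measurable_continuous_onI continuous_intros)
  ultimately have m\<phi>: "\<phi> \<in> borel_measurable borel"
    unfolding \<phi>_def by (intro borel_measurable_times)
  let ?g = "\<lambda>y. normal_kernel k j y * \<eta> (x + y)"
  have ig: "integrable lborel ?g"
    using translation_integrable[OF normal_translation_kernel \<eta>, of k j x] by simp
  have inner: "(LINT s|lborel. (real ?n / 2 * \<bar>s\<bar> ^ (?n - 1)) *\<^sub>R ?g (s *\<^sub>R sgn y)) = (real ?n / 2) *\<^sub>R \<phi> (sgn y)"
    if y: "y \<in> ball 0 1 - {0}" for y
  proof -
    define \<theta> where "\<theta> = sgn y"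
    have ny: "norm \<theta> = 1" using y by (simp add: \<theta>_def norm_sgn)
    have "(real ?n / 2) *\<^sub>R \<phi> \<theta> = (LINT s|lborel. (real ?n / 2) *\<^sub>R (of_real (\<theta> $ k) * (\<eta> (x + s *\<^sub>R \<theta>) * of_real (\<theta> $ j))))"
      by (simp add: \<phi>_def)
    also have "\<dots> = (LINT s|lborel. (real ?n / 2 * \<bar>s\<bar> ^ (?n - 1)) *\<^sub>R ?g (s *\<^sub>R \<theta>))"
    proof (rule integral_cong_AE)
      show "AE s in lborel. (real ?n / 2) *\<^sub>R (of_real (\<theta> $ k) * (\<eta> (x + s *\<^sub>R \<theta>) * of_real (\<theta> $ j)))
         = (real ?n / 2 * \<bar>s\<bar> ^ (?n - 1)) *\<^sub>R ?g (s *\<^sub>R \<theta>)"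
        using AE_lborel_singleton[of "0::real"]
      proof eventually_elim
        case (elim s)
        have "s\<^sup>2 * (s\<^sup>2) powr (riesz_exponent TYPE('n) - 1) = (s\<^sup>2) powr (1 + (riesz_exponent TYPE('n) - 1))"
          unfolding powr_add using elim by simp
        then have w: "\<bar>s\<bar> ^ (?n - 1) * (s\<^sup>2 * (s\<^sup>2) powr (riesz_exponent TYPE('n) - 1)) = 1"
          using radial_weight[OF elim, where 'n='n] by (simp add: mult.commute)
        have "normal_kernel k j (s *\<^sub>R \<theta>) = of_real (s\<^sup>2 * (s\<^sup>2) powr (riesz_exponent TYPE('n) - 1)) * (of_real (\<theta> $ k) * of_real (\<theta> $ j))"
          unfolding normal_kernel_def dist_power_def by (simp add: ny power2_eq_square)
        then have "of_real (\<bar>s\<bar> ^ (?n - 1)) * normal_kernel k j (s *\<^sub>R \<theta>)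
          = of_real (\<bar>s\<bar> ^ (?n - 1) * (s\<^sup>2 * (s\<^sup>2) powr (riesz_exponent TYPE('n) - 1))) * (of_real (\<theta> $ k) * of_real (\<theta> $ j))"
          by (simp only: of_real_mult mult.assoc)
        then have "of_real (\<bar>s\<bar> ^ (?n - 1)) * normal_kernel k j (s *\<^sub>R \<theta>) = of_real (\<theta> $ k) * of_real (\<theta> $ j)"
          unfolding w by simp
        note nk = this
        have "(a * b) *\<^sub>R (c * d) = a *\<^sub>R ((of_real b * c) * d)" for a b and c d :: complex
          by (simp add: scaleR_conv_of_real mult.assoc)
        then have "(real ?n / 2 * \<bar>s\<bar> ^ (?n - 1)) *\<^sub>R ?g (s *\<^sub>R \<theta>)
            = (real ?n / 2) *\<^sub>R ((of_real (\<bar>s\<bar> ^ (?n - 1)) * normal_kernel k j (s *\<^sub>R \<theta>)) * \<eta> (x + s *\<^sub>R \<theta>))" .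
        then have "(real ?n / 2 * \<bar>s\<bar> ^ (?n - 1)) *\<^sub>R ?g (s *\<^sub>R \<theta>) = (real ?n / 2) *\<^sub>R (of_real (\<theta> $ k) * of_real (\<theta> $ j) * \<eta> (x + s *\<^sub>R \<theta>))"
          unfolding nk .
        then show ?case by (simp add: mult_ac)
      qed
    qed measurable
    finally show ?thesis by (simp add: \<theta>_def)
  qed
  have "xray_adjoint (xray (\<lambda>l. if l = j then \<eta> else (\<lambda>_. 0))) k x = (LINT \<theta>|sphere_measure. \<phi> \<theta>)"
    unfolding xray_adjoint_def xr \<phi>_def ..
  also have "\<dots> = (LINT y|lborel. indicator (ball 0 1 - {0}) y *\<^sub>R (real ?n *\<^sub>R \<phi> (sgn y)))"
    by (rule integral_sphere_measure[OF m\<phi>])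
  also have "\<dots> = (LINT y|lborel. 2 * (indicator (ball 0 1 - {0}) y *\<^sub>R
     (LINT s|lborel. (real ?n / 2 * \<bar>s\<bar> ^ (?n - 1)) *\<^sub>R ?g (s *\<^sub>R sgn y))))"
  proof (rule Bochner_Integration.integral_cong[OF refl])
    fix y :: "real^'n"
    show "indicator (ball 0 1 - {0}) y *\<^sub>R (real ?n *\<^sub>R \<phi> (sgn y)) = 2 * (indicator (ball 0 1 - {0}) y *\<^sub>R
     (LINT s|lborel. (real ?n / 2 * \<bar>s\<bar> ^ (?n - 1)) *\<^sub>R ?g (s *\<^sub>R sgn y)))"
    proof (cases "y \<in> ball 0 1 - {0}")
      case True
      then show ?thesis unfolding inner[OF True] by (simp add: scaleR_conv_of_real)
    qed simp
  qed
  also have "\<dots> = 2 * (LINT y|lborel. indicator (ball 0 1 - {0}) y *\<^sub>R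
     (LINT s|lborel. (real ?n / 2 * \<bar>s\<bar> ^ (?n - 1)) *\<^sub>R ?g (s *\<^sub>R sgn y)))"
    by (rule integral_mult_right_zero)
  also have "\<dots> = 2 * (LINT y|lborel. ?g y)" by (subst integral_polar[OF ig]) (rule refl)
  also have "\<dots> = 2 * convolve (normal_kernel k j) \<eta> x" by (simp add: translation_integral_def)
  finally show "xray_adjoint (xray (\<lambda>l. if l = j then \<eta> else (\<lambda>_. 0))) k x = 2 * convolve (normal_kernel k j) \<eta> x" .
qed

lemma normal_operator_convolve:
  fixes F :: "'n::finite \<Rightarrow> 'n functional"
  assumes "\<eta> \<in> test_functions"
  shows "normal_operator F j \<eta> = (\<Sum>k\<in>UNIV. compact_pairing (F k) (\<lambda>x. 2 * convolve (normal_kernel k j) \<eta> x))"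
  unfolding normal_operator_def dist_xray_adjoint_def dist_xray_def xray_adjoint_xray[OF assms] ..

text \<open>By duality the curl moves from \<open>N\<^sub>1 F\<close> to the convolution kernels, and \<open>curl_identity\<close> moves it on
  to \<open>F\<close>. Read as distributions, \<open>curl (N\<^sub>1 F) = 2/(n-1) |\<cdot>|\<^bsup>1-n\<^esup> * curl F\<close>.\<close>

lemma curl_normal_operator:
  fixes F :: "'n::finite \<Rightarrow> 'n functional"
  assumes n: "CARD('n) \<ge> 2" and F: "\<And>i. F i \<in> compact_distributions" and \<eta>: "\<eta> \<in> test_functions"
  shows "curl (normal_operator F) i j \<eta> = (2 / of_real (real CARD('n) - 1)) *
     (compact_pairing (F i) (partial_deriv j (convolve riesz_kernel \<eta>))
      - compact_pairing (F j) (partial_deriv i (convolve riesz_kernel \<eta>)))"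
proof -
  have "\<exists>K. smooth_functional UNIV K (compact_pairing (F i))" for i
    using smooth_functional_compact_pairing[OF F[of i]] by blast
  then obtain K where K: "\<And>i. smooth_functional UNIV (K i) (compact_pairing (F i))" by metis
  let ?c = "1 / complex_of_real (real CARD('n) - 1)"
  let ?N = "\<lambda>k j i. convolve (normal_kernel k j) (partial_deriv i \<eta>)"
  let ?R = "\<lambda>i. convolve riesz_kernel (partial_deriv i \<eta>)"
  have alg: "2 * (c * ((if a then X else 0) - (if b then Y else 0)))
      = (if a then 2 * c * X else 0) - (if b then 2 * c * Y else 0)" for a b and c X Y :: complex
    by (simp add: algebra_simps)
  have sN: "smooth_on UNIV (?N k j i)" for k j i
    by (rule smooth_translation_integral[OF normal_translation_kernel test_partial_deriv[OF \<eta>]])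
  have sR: "smooth_on UNIV (?R i)" for i
    by (rule smooth_translation_integral[OF riesz_translation_kernel test_partial_deriv[OF \<eta>]])
  have "curl (normal_operator F) i j \<eta> = normal_operator F i (partial_deriv j \<eta>) - normal_operator F j (partial_deriv i \<eta>)"
    by (simp add: curl_def dist_deriv_def)
  also have "\<dots> = (\<Sum>k\<in>UNIV. compact_pairing (F k) (\<lambda>x. 2 * ?N k i j x) - compact_pairing (F k) (\<lambda>x. 2 * ?N k j i x))"
    unfolding normal_operator_convolve[OF test_partial_deriv[OF \<eta>]] by (rule sum_subtractf[symmetric])
  also have "\<dots> = (\<Sum>k\<in>UNIV. (if k = i then 2 * ?c * compact_pairing (F k) (?R j) else 0)
      - (if k = j then 2 * ?c * compact_pairing (F k) (?R i) else 0))"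
  proof (rule sum.cong[OF refl])
    fix k :: 'n
    have z: "compact_pairing (F k) (\<lambda>x. 0) = 0" by (rule smooth_functional_zero[OF K])
    have "compact_pairing (F k) (\<lambda>x. 2 * ?N k i j x) - compact_pairing (F k) (\<lambda>x. 2 * ?N k j i x)
      = 2 * (compact_pairing (F k) (?N k i j) - compact_pairing (F k) (?N k j i))"
      unfolding smooth_functional_cmult[OF K sN] by (rule right_diff_distrib[symmetric])
    also have "compact_pairing (F k) (?N k i j) - compact_pairing (F k) (?N k j i)
      = compact_pairing (F k) (\<lambda>x. ?N k i j x - ?N k j i x)"
      by (rule smooth_functional_diff[OF K sN sN, symmetric])
    also have "(\<lambda>x. ?N k i j x - ?N k j i x)
      = (\<lambda>x. ?c * ((if k = i then ?R j x else 0) - (if k = j then ?R i x else 0)))"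
      by (rule ext) (rule curl_identity[OF n \<eta>])
    also have "compact_pairing (F k) (\<lambda>x. ?c * ((if k = i then ?R j x else 0) - (if k = j then ?R i x else 0)))
      = ?c * compact_pairing (F k) (\<lambda>x. (if k = i then ?R j x else 0) - (if k = j then ?R i x else 0))"
      by (rule smooth_functional_cmult[OF K]) (cases "k = i"; cases "k = j"; simp add: smooth_on_diff smooth_on_minus sR del: scaleR_one)
    also have "compact_pairing (F k) (\<lambda>x. (if k = i then ?R j x else 0) - (if k = j then ?R i x else 0))
      = compact_pairing (F k) (\<lambda>x. if k = i then ?R j x else 0) - compact_pairing (F k) (\<lambda>x. if k = j then ?R i x else 0)"
      by (rule smooth_functional_diff[OF K]) (cases "k = i"; cases "k = j"; simp add: sR del: scaleR_one)+
    also have "compact_pairing (F k) (\<lambda>x. if k = i then ?R j x else 0) = (if k = i then compact_pairing (F k) (?R j) else 0)"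
      using z by (cases "k = i") (simp_all only: if_True if_False simp_thms)
    also have "compact_pairing (F k) (\<lambda>x. if k = j then ?R i x else 0) = (if k = j then compact_pairing (F k) (?R i) else 0)"
      using z by (cases "k = j") (simp_all only: if_True if_False simp_thms)
    also have "2 * (?c * ((if k = i then compact_pairing (F k) (?R j) else 0) - (if k = j then compact_pairing (F k) (?R i) else 0)))
      = (if k = i then 2 * ?c * compact_pairing (F k) (?R j) else 0) - (if k = j then 2 * ?c * compact_pairing (F k) (?R i) else 0)"
      by (rule alg)
    finally show "compact_pairing (F k) (\<lambda>x. 2 * ?N k i j x) - compact_pairing (F k) (\<lambda>x. 2 * ?N k j i x)
      = (if k = i then 2 * ?c * compact_pairing (F k) (?R j) else 0) - (if k = j then 2 * ?c * compact_pairing (F k) (?R i) else 0)" .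
  qed
  also have "\<dots> = 2 * ?c * compact_pairing (F i) (?R j) - 2 * ?c * compact_pairing (F j) (?R i)"
    by (simp only: sum_subtractf sum.delta[OF finite] UNIV_I if_True)
  also have "?R j = partial_deriv j (convolve riesz_kernel \<eta>)"
    by (rule partial_deriv_translation_integral[OF riesz_translation_kernel \<eta>, symmetric])
  also have "?R i = partial_deriv i (convolve riesz_kernel \<eta>)"
    by (rule partial_deriv_translation_integral[OF riesz_translation_kernel \<eta>, symmetric])
  finally show ?thesis by (simp only: right_diff_distrib times_divide_eq_right mult_1_right)
qed

section \<open>Unique continuation at a point\<close>

definition unit_bump :: "real^'n::finite \<Rightarrow> real \<Rightarrow> real^'n \<Rightarrow> complex" where
  "unit_bump a r x = (1 / (LINT z|lborel. bump a r z)) * bump a r x"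

lemma unit_bump_test: "r > 0 \<Longrightarrow> unit_bump a r \<in> test_functions"
  unfolding unit_bump_def[abs_def] by (intro test_cmult bump_test)

lemma unit_bump_zero: "r > 0 \<Longrightarrow> x \<notin> ball a r \<Longrightarrow> unit_bump a r x = 0"
  using bump_eq_0_iff[of r a x] by (simp add: unit_bump_def)

lemma unit_bump_real:
  assumes r: "r > 0"
  obtains v where "\<And>x. unit_bump a r x = of_real (v x)" "\<And>x. v x \<ge> 0" "integrable lborel v" "(LINT x|lborel. v x) = 1"
proof -
  define c where "c = (LINT x|lborel. Re (bump a r x))"
  have c: "c > 0" unfolding c_def by (rule bump_integral_pos(2)[OF r])
  define v where "v x = (1 / c) * Re (bump a r x)" for x
  show ?thesis
  proof (rule that[of v])
    show "unit_bump a r x = of_real (v x)" for x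
      unfolding unit_bump_def bump_integral_pos(1)[OF r] c_def[symmetric] v_def
      by (subst bump_nonneg(1)) simp
    show "v x \<ge> 0" for x using c bump_nonneg(2)[of a r x] by (simp add: v_def)
    have i: "integrable lborel (\<lambda>x. Re (bump a r x))"
      using integrable_test[OF bump_test[OF r]] by (rule integrable_Re)
    then show "integrable lborel v" unfolding v_def[abs_def] by (rule integrable_mult_right)
    have "(LINT x|lborel. v x) = (1 / c) * (LINT x|lborel. Re (bump a r x))"
      unfolding v_def by (rule integral_mult_right_zero)
    then show "(LINT x|lborel. v x) = 1" using c by (simp add: c_def[symmetric])
  qed
qed

lemma unit_bump_average:
  fixes g :: "real^'n::finite \<Rightarrow> complex"
  assumes r: "r > 0" and C: "C \<ge> 0" and lip: "\<And>z. cmod (g z - g a) \<le> C * norm (z - a)"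
    and int: "integrable lborel (\<lambda>z. unit_bump a r z * g z)"
  shows "cmod ((LINT z|lborel. unit_bump a r z * g z) - g a) \<le> C * r"
proof -
  obtain v where v: "\<And>x. unit_bump a r x = of_real (v x)" "\<And>x. v x \<ge> 0" "integrable lborel v" "(LINT x|lborel. v x) = 1"
    using unit_bump_real[OF r, of a] by metis
  have iv: "integrable lborel (\<lambda>z. complex_of_real (v z) * g a)"
    by (intro integrable_mult_left integrable_of_real v(3))
  have i1: "integrable lborel (\<lambda>z. complex_of_real (v z) * g z)" using int by (simp only: v(1))
  have "(LINT z|lborel. complex_of_real (v z) * g a) = (LINT z|lborel. complex_of_real (v z)) * g a"
    by (rule integral_mult_left_zero)
  also have "(LINT z|lborel. complex_of_real (v z)) = of_real (LINT z|lborel. v z)"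
    by (rule integral_complex_of_real)
  finally have ga: "(LINT z|lborel. complex_of_real (v z) * g a) = g a" by (simp add: v(4))
  have "(LINT z|lborel. unit_bump a r z * g z) - g a
     = (LINT z|lborel. complex_of_real (v z) * g z) - (LINT z|lborel. complex_of_real (v z) * g a)"
    unfolding ga by (simp only: v(1))
  also have "\<dots> = (LINT z|lborel. complex_of_real (v z) * g z - complex_of_real (v z) * g a)"
    by (rule Bochner_Integration.integral_diff[OF i1 iv, symmetric])
  also have "cmod \<dots> \<le> (LINT z|lborel. cmod (complex_of_real (v z) * g z - complex_of_real (v z) * g a))"
    by (rule integral_norm_bound)
  also have "\<dots> \<le> (LINT z|lborel. (C * r) * v z)"
  proof (rule integral_mono)
    show "integrable lborel (\<lambda>z. cmod (complex_of_real (v z) * g z - complex_of_real (v z) * g a))"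
      by (intro integrable_norm Bochner_Integration.integrable_diff i1 iv)
    show "integrable lborel (\<lambda>z. (C * r) * v z)" by (intro integrable_mult_right v(3))
    fix z
    have "cmod (complex_of_real (v z) * g z - complex_of_real (v z) * g a) = v z * cmod (g z - g a)"
      using v(2)[of z] by (simp add: norm_mult flip: right_diff_distrib)
    also have "\<dots> \<le> v z * (C * r)"
    proof (cases "z \<in> ball a r")
      case True
      then have "norm (z - a) \<le> r" by (simp add: dist_norm norm_minus_commute)
      then have "cmod (g z - g a) \<le> C * r" using lip[of z] mult_left_mono[OF _ C] order_trans by blast
      then show ?thesis using v(2) by (rule mult_left_mono)
    next
      case False
      then have "v z = 0" using unit_bump_zero[OF r False] v(1)[of z] by simp
      then show ?thesis by simp
    qed
    finally show "cmod (complex_of_real (v z) * g z - complex_of_real (v z) * g a) \<le> (C * r) * v z"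
      by (simp add: mult.commute)
  qed
  also have "\<dots> = C * r" using v(4) by simp
  finally show ?thesis .
qed

lemma integration_by_parts_derivs:
  assumes "smooth_on UNIV f" "\<phi> \<in> test_functions"
  shows "(LINT y|lborel. f y * derivs js \<phi> y) = (-1) ^ length js * (LINT y|lborel. derivs (rev js) f y * \<phi> y)"
  using assms(1)
proof (induction js arbitrary: f)
  case (Cons j js)
  have "(LINT y|lborel. f y * derivs (j # js) \<phi> y) = - (LINT y|lborel. partial_deriv j f y * derivs js \<phi> y)"
    using integration_by_parts[OF Cons.prems test_derivs[OF assms(2), of js], of j] by simp
  also have "\<dots> = - ((-1) ^ length js * (LINT y|lborel. derivs (rev js) (partial_deriv j f) y * \<phi> y))"
    unfolding Cons.IH[OF smooth_on_partial_deriv[OF Cons.prems]] ..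
  finally show ?case by simp
qed simp

lemma translation_integral_sum:
  assumes M: "translation_kernel M m k" and f: "\<And>i. i \<in> I \<Longrightarrow> f i \<in> test_functions"
  shows "translation_integral M m k (\<lambda>x. \<Sum>i\<in>I. c i * f i x) x = (\<Sum>i\<in>I. c i * translation_integral M m k (f i) x)"
  using f
proof (induction I rule: infinite_finite_induct)
  case (insert i I)
  have t: "(\<lambda>x. \<Sum>i\<in>I. c i * f i x) \<in> test_functions" by (intro test_sum test_cmult insert.prems) simp
  have fi: "f i \<in> test_functions" using insert.prems by simp
  have eq: "(\<lambda>x. \<Sum>i\<in>insert i I. c i * f i x) = (\<lambda>x. c i * f i x + 1 * (\<Sum>i\<in>I. c i * f i x))"
    using insert.hyps by simp
  show ?case unfolding eq translation_integral_add[OF M fi t] using insert by simp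
qed (simp_all add: translation_integral_def)

lemma transposed_op_translation_integral:
  assumes M: "translation_kernel M m k" and \<psi>: "\<psi> \<in> test_functions"
  shows "transposed_op P (translation_integral M m k \<psi>) = translation_integral M m k (transposed_op P \<psi>)"
  unfolding transposed_op_def[abs_def] derivs_translation_integral[OF M \<psi>]
  by (rule ext, rule translation_integral_sum[OF M, symmetric]) (rule test_derivs[OF \<psi>])

text \<open>Testing the potential \<open>x \<mapsto> T(|x - \<cdot>|\<^bsup>1-n\<^esup>)\<close> against approximate identities at \<open>x\<^sub>0\<close> replaces
  differentiating it. The functional \<open>h = T \<circ> P(D)\<^sup>t\<close> vanishes near \<open>x\<^sub>0\<close>, so it can be evaluated on
  derivatives of \<open>|\<cdot> - x\<^sub>0|\<^bsup>1-n\<^esup>\<close>, and there it is zero. By the density results \<open>h\<close> vanishes, that is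
  \<open>P(D)T = 0\<close>, and this forces \<open>T = 0\<close> because the support of \<open>T\<close> is compact.\<close>

lemma unique_continuation:
  fixes T :: "'n::finite functional" and G :: "real^'n \<Rightarrow> complex"
  assumes n: "CARD('n) \<ge> 2" and T: "smooth_functional UNIV K T" and P: "P \<noteq> 0"
    and V: "open V" "x0 \<in> V"
    and vanish: "\<And>\<phi>. \<phi> \<in> test_functions \<Longrightarrow> fun_support \<phi> \<subseteq> V \<Longrightarrow> T (transposed_op P \<phi>) = 0"
    and W: "open W" "x0 \<in> W" and G: "G \<in> test_functions" "\<And>js. derivs js G x0 = 0" and c: "c \<noteq> 0"
    and pot: "\<And>\<eta>. \<eta> \<in> test_functions \<Longrightarrow> fun_support \<eta> \<subseteq> W \<Longrightarrow>
      c * T (convolve riesz_kernel \<eta>) = (LINT y|lborel. G y * \<eta> y)"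
    and \<phi>: "\<phi> \<in> test_functions"
  shows "T \<phi> = 0"
proof -
  let ?s = "riesz_exponent TYPE('n)"
  let ?U = "- {x0}"
  note U = open_compl_point[of x0]
  define h where "h \<psi> = T (transposed_op P \<psi>)" for \<psi>
  obtain L where h: "smooth_functional UNIV L h"
    using smooth_functional_transposed_op[OF T open_UNIV, of P] unfolding h_def[abs_def] by blast
  have h0: "h \<psi> = 0" if "\<psi> \<in> test_functions" "fun_support \<psi> \<subseteq> V" for \<psi>
    unfolding h_def by (rule vanish[OF that])
  have "compact {x0}" "{x0} \<subseteq> V" using V by auto
  then obtain \<kappa> W1 where \<kappa>: "\<kappa> \<in> test_functions" "fun_support \<kappa> \<subseteq> V" "open W1" "{x0} \<subseteq> W1" "\<And>x. x \<in> W1 \<Longrightarrow> \<kappa> x = 1"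
    using cutoff_exists[of "{x0}" V] V(1) by metis
  have "open (W1 \<inter> W)" "x0 \<in> W1 \<inter> W" using \<kappa>(3,4) W by auto
  then obtain d0 where d0: "d0 > 0" "ball x0 d0 \<subseteq> W1 \<inter> W" using open_contains_ball by blast
  define d where "d = d0 / 2"
  have d: "d > 0" "ball x0 (2 * d) \<subseteq> W1 \<inter> W" using d0 by (auto simp: d_def)
  define a where "a x = 1 - \<kappa> x" for x
  have sa: "smooth_on UNIV a"
    unfolding a_def[abs_def] by (intro smooth_on_diff smooth_on_const test_smooth[OF \<kappa>(1)] open_UNIV)
  have a0: "a x = 0" if "x \<in> ball x0 (2 * d)" for x using that d \<kappa>(5) by (auto simp: a_def)
  have supp_a: "fun_support a \<subseteq> - ball x0 (2 * d)"
    by (rule fun_support_subset) (use a0 in auto)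
  then have supp_a': "fun_support a \<inter> UNIV \<subseteq> ?U" using d(1) by auto
  define h' where "h' \<psi> = h (\<lambda>x. a x * \<psi> x)" for \<psi>
  define K' where "K' = L \<inter> fun_support a"
  have h': "smooth_functional ?U K' h'"
    unfolding h'_def[abs_def] K'_def by (rule smooth_functional_mult[OF h open_UNIV U sa supp_a'])
  have h_h': "h \<psi> = h' \<psi>" if \<psi>: "smooth_on UNIV \<psi>" for \<psi>
  proof -
    have k: "(\<lambda>x. \<kappa> x * \<psi> x) \<in> test_functions"
      using test_mult[OF \<psi> \<kappa>(1)] by (simp add: mult.commute)
    have "h' \<psi> = h (\<lambda>x. \<psi> x - \<kappa> x * \<psi> x)" by (simp add: h'_def a_def left_diff_distrib)
    also have "\<dots> = h \<psi> - h (\<lambda>x. \<kappa> x * \<psi> x)" by (rule smooth_functional_diff[OF h \<psi> test_smooth[OF k]])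
    also have "h (\<lambda>x. \<kappa> x * \<psi> x) = 0"
      using fun_support_mult[of \<kappa> \<psi>] \<kappa>(2) by (intro h0[OF k]) auto
    finally show ?thesis by simp
  qed

  \<comment> \<open>On \<open>N\<close>, a neighbourhood of the support of \<open>h'\<close>, the potentials of functions supported near
     \<open>x0\<close> only involve the kernel on an annulus, where it can be replaced by a test function.\<close>
  have "bounded ((\<lambda>x. x - x0) ` K')"
    by (intro compact_imp_bounded compact_continuous_image continuous_intros smooth_functional_compact[OF h'])
  then obtain R0 where R0: "\<And>x. x \<in> K' \<Longrightarrow> norm (x - x0) \<le> R0" unfolding bounded_iff by blast
  define R where "R = \<bar>R0\<bar> + 1"
  define N where "N = {x. 3/2 * d < norm (x - x0) \<and> norm (x - x0) < R}"
  have openN: "open N"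
    unfolding N_def by (intro open_Collect_conj open_Collect_less continuous_intros)
  have K'N: "K' \<subseteq> N"
  proof
    fix x assume x: "x \<in> K'"
    then have "x \<notin> ball x0 (2 * d)" using supp_a by (auto simp: K'_def)
    then have "2 * d \<le> norm (x - x0)" by (simp add: dist_norm norm_minus_commute)
    then show "x \<in> N" using R0[OF x] d(1) by (simp add: N_def R_def)
  qed
  define A where "A = cball (0::real^'n) (R + d) \<inter> {y. d \<le> norm y}"
  have "closed {y::real^'n. d \<le> norm y}" by (intro closed_Collect_le continuous_intros)
  then have "compact A" unfolding A_def by (intro compact_Int_closed) auto
  moreover have "A \<subseteq> - {0}" using d(1) by (auto simp: A_def)
  ultimately obtain \<kappa>t W2 where \<kappa>t: "\<kappa>t \<in> test_functions" "fun_support \<kappa>t \<subseteq> - {0::real^'n}" "open W2" "A \<subseteq> W2" "\<And>x. x \<in> W2 \<Longrightarrow> \<kappa>t x = 1"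
    using cutoff_exists[OF _ open_compl_point] by metis
  define k where "k y = \<kappa>t y * riesz_kernel y" for y
  have kt: "k \<in> test_functions"
    unfolding k_def[abs_def] riesz_kernel_def
    by (rule test_cutoff[OF \<kappa>t(1) open_compl_point smooth_dist_power \<kappa>t(2)])
  have kA: "k y = riesz_kernel y" if "y \<in> A" for y using that \<kappa>t(4,5) by (auto simp: k_def)
  define r where "r m = d / 2 / real (Suc m)" for m
  have r: "r m > 0" "r m \<le> d / 2" for m
    using d(1) by (auto simp: r_def field_simps)
  have rlim: "r \<longlonglongrightarrow> 0"
  proof -
    have lim: "(\<lambda>m. d / 2 * inverse (real (Suc m))) \<longlonglongrightarrow> d / 2 * 0"
      by (intro tendsto_mult tendsto_const LIMSEQ_inverse_real_of_nat)
    have "r = (\<lambda>m. d / 2 * inverse (real (Suc m)))"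
      by (rule ext) (simp only: r_def divide_inverse)
    then show ?thesis using lim by (simp only: mult_zero_right)
  qed
  define \<eta> where "\<eta> m = unit_bump x0 (r m)" for m
  have \<eta>t: "\<eta> m \<in> test_functions" for m unfolding \<eta>_def by (rule unit_bump_test[OF r(1)])
  define B where "B m = convolve riesz_kernel (\<eta> m)" for m
  have sB: "smooth_on UNIV (B m)" for m
    unfolding B_def by (rule smooth_translation_integral[OF riesz_translation_kernel \<eta>t])
  have kern: "translation_kernel lborel (\<lambda>z. (-1) *\<^sub>R z) (\<eta> m)" for m
    by (rule kernel_continuous) (use test_continuous[OF \<eta>t] in auto)
  have B_eq: "B m x = translation_integral lborel (\<lambda>z. (-1) *\<^sub>R z) (\<eta> m) k x" if x: "x \<in> N" for m x
  proof -
    have [measurable]: "\<eta> m \<in> borel_measurable borel" by (rule test_borel[OF \<eta>t])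
    have "B m x = (LINT y|lborel. riesz_kernel y * \<eta> m (x + y))" by (simp add: B_def translation_integral_def)
    also have "\<dots> = (LINT z|lborel. riesz_kernel (- x + 1 *\<^sub>R z) * \<eta> m (x + (- x + 1 *\<^sub>R z)))"
      by (rule lborel_integral_translate_reflect(1)[symmetric]) auto
    also have "\<dots> = (LINT z|lborel. \<eta> m z * k (x + (-1) *\<^sub>R z))"
    proof (rule Bochner_Integration.integral_cong[OF refl])
      fix z
      show "riesz_kernel (- x + 1 *\<^sub>R z) * \<eta> m (x + (- x + 1 *\<^sub>R z)) = \<eta> m z * k (x + (-1) *\<^sub>R z)"
      proof (cases "z \<in> ball x0 (r m)")
        case True
        then have z: "norm (z - x0) < d / 2" using r(2)[of m] by (simp add: dist_norm norm_minus_commute)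
        have "norm (x - x0) \<le> norm (x - z) + norm (z - x0)" using norm_triangle_ineq[of "x - z" "z - x0"] by simp
        moreover have "norm (x - z) \<le> norm (x - x0) + norm (z - x0)"
          using norm_triangle_ineq4[of "x - x0" "z - x0"] by simp
        ultimately have "x - z \<in> A" using x z by (simp add: A_def N_def)
        then show ?thesis by (simp add: kA riesz_kernel_def dist_power_def norm_minus_commute)
      next
        case False
        then show ?thesis using unit_bump_zero[OF r(1) False] by (simp add: \<eta>_def)
      qed
    qed
    finally show ?thesis by (simp only: translation_integral_def)
  qed
  have dp_eq: "dist_power x0 ?s x = k (- x0 + x)" if x: "x \<in> N" for x
  proof -
    have "- x0 + x \<in> A" using x d(1) by (simp add: A_def N_def)
    then show ?thesis by (simp add: kA riesz_kernel_def dist_power_def)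
  qed
  have conv: "\<forall>\<^sub>F m in sequentially. \<forall>x\<in>K'. cmod (derivs ls (B m) x - derivs ls (dist_power x0 ?s) x) \<le> e"
    if e: "e > 0" for ls e
  proof -
    obtain C where C: "C \<ge> 0" "\<And>x y. cmod (derivs ls k x - derivs ls k y) \<le> C * norm (x - y)"
      using test_lipschitz[OF test_derivs[OF kt]] by metis
    have "(\<lambda>m. C * r m) \<longlonglongrightarrow> C * 0" by (intro tendsto_mult tendsto_const rlim)
    then have "\<forall>\<^sub>F m in sequentially. C * r m < e" by (rule order_tendstoD(2)) (use e in simp)
    then show ?thesis
    proof eventually_elim
      case (elim m)
      show ?case
      proof
        fix x assume "x \<in> K'"
        then have x: "x \<in> N" using K'N by auto
        have "derivs ls (B m) x = derivs ls (translation_integral lborel (\<lambda>z. (-1) *\<^sub>R z) (\<eta> m) k) x"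
          by (rule derivs_cong[OF openN x B_eq])
        also have "\<dots> = (LINT z|lborel. unit_bump x0 (r m) z * derivs ls k (x + (-1) *\<^sub>R z))"
          by (simp only: derivs_translation_integral[OF kern kt]) (simp only: translation_integral_def \<eta>_def)
        finally have 1: "derivs ls (B m) x = (LINT z|lborel. unit_bump x0 (r m) z * derivs ls k (x + (-1) *\<^sub>R z))" .
        have "derivs ls (dist_power x0 ?s) x = derivs ls (\<lambda>x. k (- x0 + x)) x"
          by (rule derivs_cong[OF openN x dp_eq])
        also have "\<dots> = derivs ls k (x + (-1) *\<^sub>R x0)"
          by (simp only: derivs_translate[OF test_smooth[OF kt]]) simp
        finally have 2: "derivs ls (dist_power x0 ?s) x = derivs ls k (x + (-1) *\<^sub>R x0)" .
        have "cmod ((LINT z|lborel. unit_bump x0 (r m) z * derivs ls k (x + (-1) *\<^sub>R z)) - derivs ls k (x + (-1) *\<^sub>R x0)) \<le> C * r m"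
        proof (rule unit_bump_average[OF r(1) C(1)])
          show "cmod (derivs ls k (x + (-1) *\<^sub>R z) - derivs ls k (x + (-1) *\<^sub>R x0)) \<le> C * norm (z - x0)" for z
            using C(2)[of "x + (-1) *\<^sub>R z" "x + (-1) *\<^sub>R x0"] by (simp add: norm_minus_commute)
          show "integrable lborel (\<lambda>z. unit_bump x0 (r m) z * derivs ls k (x + (-1) *\<^sub>R z))"
            using translation_integrable[OF kern[of m] test_derivs[OF kt], of ls x] by (simp only: \<eta>_def)
        qed
        then show "cmod (derivs ls (B m) x - derivs ls (dist_power x0 ?s) x) \<le> e"
          unfolding 1 2 using elim by simp
      qed
    qed
  qed

  \<comment> \<open>For each \<open>m\<close> the value on \<open>derivs js (B m)\<close> is, up to the factor \<open>c\<close>, the integral of \<open>G\<close>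
     against derivatives of \<open>\<eta> m\<close>, which converges to derivatives of \<open>G\<close> at \<open>x0\<close>.\<close>
  have h'dp: "h' (derivs js (dist_power x0 ?s)) = 0" for js
  proof -
    have "(\<lambda>m. h' (derivs js (B m))) \<longlonglongrightarrow> h' (derivs js (dist_power x0 ?s))"
    proof (rule smooth_functional_tendsto[OF h' U])
      show "smooth_on ?U (derivs js (B m))" for m
        by (rule smooth_on_subset[OF smooth_on_derivs[OF sB]]) simp
      show "smooth_on ?U (derivs js (dist_power x0 ?s))" by (intro smooth_on_derivs smooth_dist_power)
      show "\<forall>\<^sub>F m in sequentially. \<forall>x\<in>K'. cmod (derivs ls (derivs js (B m)) x - derivs ls (derivs js (dist_power x0 ?s)) x) \<le> e"
        if "e > 0" for ls e
        using conv[OF that, of "ls @ js"] by simp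
    qed
    moreover have "(\<lambda>m. h' (derivs js (B m))) \<longlonglongrightarrow> 0"
    proof -
      let ?c = "\<lambda>\<alpha>. Poly_Mapping.lookup P \<alpha> * \<i> ^ sum \<alpha> UNIV"
      let ?l = "\<lambda>\<alpha>. rev (index_list \<alpha>) @ js"
      have step: "h' (derivs js (B m)) = (1 / c) * (\<Sum>\<alpha>\<in>Poly_Mapping.keys P. ?c \<alpha> * ((-1) ^ length (?l \<alpha>) *
          (LINT z|lborel. unit_bump x0 (r m) z * derivs (rev (?l \<alpha>)) G z)))" for m
      proof -
        have t: "derivs js (\<eta> m) \<in> test_functions" by (rule test_derivs[OF \<eta>t])
        have tt: "transposed_op P (derivs js (\<eta> m)) \<in> test_functions" by (rule test_transposed_op[OF t])
        have off: "derivs ls (\<eta> m) x = 0" if "x \<notin> cball x0 d" for ls x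
        proof (rule derivs_zero_off_support)
          have "fun_support (\<eta> m) \<subseteq> cball x0 d"
          proof (rule fun_support_subset[OF closed_cball])
            fix z assume "z \<notin> cball x0 d"
            then have "z \<notin> ball x0 (r m)" using r(2)[of m] d(1) by auto
            then show "\<eta> m z = 0" unfolding \<eta>_def by (rule unit_bump_zero[OF r(1)])
          qed
          then show "x \<notin> fun_support (\<eta> m)" using that by auto
        qed
        have "fun_support (transposed_op P (derivs js (\<eta> m))) \<subseteq> cball x0 d"
        proof (rule fun_support_subset[OF closed_cball])
          show "transposed_op P (derivs js (\<eta> m)) z = 0" if "z \<notin> cball x0 d" for z
            using off[OF that, of "_ @ js"] by (simp add: transposed_op_def)
        qed
        also have "cball x0 d \<subseteq> W" using d by (auto simp: subset_iff)
        finally have suppW: "fun_support (transposed_op P (derivs js (\<eta> m))) \<subseteq> W" .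
        have "h' (derivs js (B m)) = h (derivs js (B m))" by (rule h_h'[OF smooth_on_derivs[OF sB], symmetric])
        also have "\<dots> = T (convolve riesz_kernel (transposed_op P (derivs js (\<eta> m))))"
          by (simp only: h_def B_def derivs_translation_integral[OF riesz_translation_kernel \<eta>t]
              transposed_op_translation_integral[OF riesz_translation_kernel t])
        also have "\<dots> = (1 / c) * (LINT y|lborel. G y * transposed_op P (derivs js (\<eta> m)) y)"
          using pot[OF tt suppW] c by (simp add: field_simps del: scaleR_one)
        also have "(LINT y|lborel. G y * transposed_op P (derivs js (\<eta> m)) y)
           = (LINT y|lborel. (\<Sum>\<alpha>\<in>Poly_Mapping.keys P. ?c \<alpha> * (G y * derivs (?l \<alpha>) (\<eta> m) y)))"
          by (simp add: transposed_op_def sum_distrib_left mult_ac)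
        also have "\<dots> = (\<Sum>\<alpha>\<in>Poly_Mapping.keys P. (LINT y|lborel. ?c \<alpha> * (G y * derivs (?l \<alpha>) (\<eta> m) y)))"
          by (rule Bochner_Integration.integral_sum)
            (intro integrable_mult_right integrable_test test_mult test_smooth[OF G(1)] test_derivs \<eta>t)
        also have "\<dots> = (\<Sum>\<alpha>\<in>Poly_Mapping.keys P. ?c \<alpha> * (LINT y|lborel. G y * derivs (?l \<alpha>) (\<eta> m) y))"
          by (intro sum.cong refl integral_mult_right_zero)
        also have "\<dots> = (\<Sum>\<alpha>\<in>Poly_Mapping.keys P. ?c \<alpha> * ((-1) ^ length (?l \<alpha>) *
          (LINT z|lborel. unit_bump x0 (r m) z * derivs (rev (?l \<alpha>)) G z)))"
          unfolding integration_by_parts_derivs[OF test_smooth[OF G(1)] \<eta>t]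
          by (simp only: \<eta>_def mult.commute[of "unit_bump x0 (r m) _"])
        finally show ?thesis .
      qed
      have avg: "(\<lambda>m. LINT z|lborel. unit_bump x0 (r m) z * derivs ls G z) \<longlonglongrightarrow> 0" for ls
      proof -
        obtain C where C: "C \<ge> 0" "\<And>x y. cmod (derivs ls G x - derivs ls G y) \<le> C * norm (x - y)"
          using test_lipschitz[OF test_derivs[OF G(1)]] by metis
        have "cmod ((LINT z|lborel. unit_bump x0 (r m) z * derivs ls G z) - derivs ls G x0) \<le> C * r m" for m
          by (rule unit_bump_average[OF r(1) C])
            (intro integrable_test test_mult test_derivs G test_smooth[OF unit_bump_test[OF r(1)]])
        then have bd: "norm (LINT z|lborel. unit_bump x0 (r m) z * derivs ls G z) \<le> C * r m" for m
          by (simp add: G(2))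
        have "(\<lambda>m. C * r m) \<longlonglongrightarrow> C * 0" by (intro tendsto_mult tendsto_const rlim)
        then have "(\<lambda>m. C * r m) \<longlonglongrightarrow> 0" by simp
        then show ?thesis by (rule Lim_null_comparison[OF always_eventually[OF allI[OF bd]]])
      qed
      have "(\<lambda>m. (1 / c) * (\<Sum>\<alpha>\<in>Poly_Mapping.keys P. ?c \<alpha> * ((-1) ^ length (?l \<alpha>) *
          (LINT z|lborel. unit_bump x0 (r m) z * derivs (rev (?l \<alpha>)) G z)))) \<longlonglongrightarrow>
          (1 / c) * (\<Sum>\<alpha>\<in>Poly_Mapping.keys P. ?c \<alpha> * ((-1) ^ length (?l \<alpha>) * 0))"
        by (intro tendsto_mult tendsto_const tendsto_sum avg)
      then show ?thesis unfolding step by (simp only: mult_zero_right sum.neutral_const)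
    qed
    ultimately show ?thesis by (rule LIMSEQ_unique)
  qed

  \<comment> \<open>Since \<open>h\<close> vanishes near \<open>x0\<close>, division by the kernel is harmless: every test function can be
     written as kernel times test function on the support of \<open>h\<close>.\<close>
  define S where "S \<psi> = h' (\<lambda>x. dist_power x0 ?s x * \<psi> x)" for \<psi>
  obtain KS where S: "smooth_functional UNIV KS S"
    using smooth_functional_mult[OF h' U open_UNIV smooth_dist_power] unfolding S_def[abs_def] by blast
  have "S (monomial x0 \<beta>) = 0" for \<beta>
  proof -
    have "S (monomial x0 \<beta>) = h' (weighted_monomial x0 \<beta> ?s)"
      unfolding S_def weighted_monomial_def[abs_def] by (simp only: mult.commute)
    then show ?thesis using vanishes_on_weighted_monomials[OF h' n h'dp] by simp
  qed
  then have S0: "S \<zeta> = 0" if "\<zeta> \<in> test_functions" for \<zeta>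
    by (rule vanishes_on_tests_if_on_monomials[OF S _ that])
  have h_test: "h \<zeta> = 0" if \<zeta>: "\<zeta> \<in> test_functions" for \<zeta>
  proof -
    define \<zeta>' where "\<zeta>' x = a x * (dist_power x0 (- ?s) x * \<zeta> x)" for x
    have "\<zeta>' \<in> test_functions"
    proof (rule testI[OF _ test_compact[OF \<zeta>]])
      show "smooth_on UNIV \<zeta>'" unfolding \<zeta>'_def[abs_def]
      proof (rule smooth_on_cutoff[OF sa U])
        show "smooth_on ?U (\<lambda>x. dist_power x0 (- ?s) x * \<zeta> x)"
          by (intro smooth_on_mult U smooth_dist_power smooth_on_subset[OF test_smooth[OF \<zeta>]]) auto
        show "fun_support a \<subseteq> ?U" using supp_a' by simp
      qed
      show "\<zeta>' x = 0" if "x \<notin> fun_support \<zeta>" for x using fun_support_zero[OF that] by (simp add: \<zeta>'_def)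
    qed
    from S0[OF this] have "h (\<lambda>x. a x * (dist_power x0 ?s x * \<zeta>' x)) = 0" by (simp add: S_def h'_def)
    also have "(\<lambda>x. a x * (dist_power x0 ?s x * \<zeta>' x)) = (\<lambda>x. \<zeta> x - \<kappa> x * ((2 - \<kappa> x) * \<zeta> x))"
    proof
      fix x
      have "a x * (dist_power x0 ?s x * \<zeta>' x) = a x * (a x * \<zeta> x)"
      proof (cases "x = x0")
        case True
        then have "a x = 0" using a0 d(1) by simp
        then show ?thesis by simp
      next
        case False
        have "dist_power x0 ?s x * dist_power x0 (- ?s) x = 1"
          using dist_power_add[OF False, of ?s "- ?s"] dist_power_0[OF False] by simp
        then have "dist_power x0 ?s x * (a x * (dist_power x0 (- ?s) x * \<zeta> x)) = a x * \<zeta> x"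
          by (metis (no_types, opaque_lifting) mult.left_commute mult_1 mult.assoc)
        then show ?thesis by (simp add: \<zeta>'_def)
      qed
      then show "a x * (dist_power x0 ?s x * \<zeta>' x) = \<zeta> x - \<kappa> x * ((2 - \<kappa> x) * \<zeta> x)"
        by (simp add: a_def algebra_simps)
    qed
    finally have 0: "h (\<lambda>x. \<zeta> x - \<kappa> x * ((2 - \<kappa> x) * \<zeta> x)) = 0" .
    have t2: "(\<lambda>x. (2 - \<kappa> x) * \<zeta> x) \<in> test_functions"
      by (intro test_mult \<zeta> smooth_on_diff smooth_on_const test_smooth[OF \<kappa>(1)] open_UNIV)
    have t: "(\<lambda>x. \<kappa> x * ((2 - \<kappa> x) * \<zeta> x)) \<in> test_functions"
      by (rule test_mult[OF test_smooth[OF \<kappa>(1)] t2])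
    have "h (\<lambda>x. \<kappa> x * ((2 - \<kappa> x) * \<zeta> x)) = 0"
      using fun_support_mult[of \<kappa> "\<lambda>x. (2 - \<kappa> x) * \<zeta> x"] \<kappa>(2) by (intro h0[OF t]) auto
    then show ?thesis
      using smooth_functional_diff[OF h test_smooth[OF \<zeta>] test_smooth[OF t]] 0 by simp
  qed
  have "T (transposed_op P \<psi>) = 0" if "smooth_on UNIV \<psi>" for \<psi>
    using smooth_functional_eq_0_if_test[OF h h_test that] by (simp add: h_def)
  then have "T (monomial 0 \<beta>) = 0" for \<beta> by (rule vanishes_on_monomials[OF T P])
  then show ?thesis by (rule vanishes_on_tests_if_on_monomials[OF T _ \<phi>])
qed

section \<open>Vector fields whose normal operator has vanishing curl\<close>

theorem theorem1p7:
  fixes V :: "(real^'n::finite) set" and F :: "'n \<Rightarrow> 'n functional"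
  assumes "CARD('n) \<ge> 2"
    and "open V" and "V \<noteq> {}"
    and "\<forall>i. F i \<in> compact_distributions"
    and "\<forall>i j. curl F i j \<in> admissible V"
    and "\<exists>x\<^sub>0\<in>V. \<forall>i j. vanishes_to_infinite_order_at (curl (normal_operator F) i j) x\<^sub>0"
  shows "\<exists>\<phi>\<in>compact_distributions. \<forall>i. dist_eq_on UNIV (F i) (dist_deriv i \<phi>)"
proof (rule exact_if_closed)
  show "CARD('n) \<ge> 2" by (rule assms(1))
  show F: "F i \<in> compact_distributions" for i using assms(4) by blast
  obtain x0 where x0: "x0 \<in> V" "\<And>i j. vanishes_to_infinite_order_at (curl (normal_operator F) i j) x0"
    using assms(6) by blast
  fix i j and f :: "real^'n \<Rightarrow> complex" assume f: "smooth_on UNIV f"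
  have "\<exists>K. smooth_functional UNIV K (compact_pairing (F l))" for l
    using smooth_functional_compact_pairing[OF F[of l]] by blast
  then obtain K where K: "\<And>l. smooth_functional UNIV (K l) (compact_pairing (F l))" by metis
  define T where "T \<psi> = 1 * compact_pairing (F i) (partial_deriv j \<psi>) + (-1) * compact_pairing (F j) (partial_deriv i \<psi>)" for \<psi>
  have T: "smooth_functional UNIV (K i \<union> K j) T"
    unfolding T_def[abs_def]
    by (intro smooth_functional_combination smooth_functional_partial_deriv[OF K open_UNIV])
  have T_curl: "curl F i j \<psi> = T \<psi>" if "\<psi> \<in> test_functions" for \<psi>
    by (simp add: curl_def dist_deriv_def T_def compact_pairing_test[OF F test_partial_deriv[OF that]])
  have "curl F i j \<in> admissible V" using assms(5) by blast
  then obtain u P where u: "dist_eq_on UNIV (curl F i j) u" and P: "P \<noteq> 0" and Pu: "dist_eq_on V (poly_D P u) (\<lambda>_. 0)"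
    unfolding admissible_def by blast
  have uT: "u \<psi> = T \<psi>" if "\<psi> \<in> test_functions" for \<psi>
    using u T_curl[OF that] that by (simp add: dist_eq_on_def)
  have vanish: "T (transposed_op P \<psi>) = 0" if \<psi>: "\<psi> \<in> test_functions" "fun_support \<psi> \<subseteq> V" for \<psi>
  proof -
    have lin: "u (\<lambda>x. a * \<zeta> x + b * \<xi> x) = a * u \<zeta> + b * u \<xi>"
      if t: "\<zeta> \<in> test_functions" "\<xi> \<in> test_functions" for \<zeta> \<xi> a b
      using smooth_functional_linear[OF T test_smooth[OF t(1)] test_smooth[OF t(2)], of a b]
        uT[OF t(1)] uT[OF t(2)] uT[OF test_add[OF test_cmult[OF t(1)] test_cmult[OF t(2)]]] by simp
    have "0 = poly_D P u \<psi>" using Pu \<psi> by (simp add: dist_eq_on_def)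
    also have "\<dots> = u (transposed_op P \<psi>)" by (rule poly_D_transposed[OF lin \<psi>(1)])
    also have "\<dots> = T (transposed_op P \<psi>)" by (rule uT[OF test_transposed_op[OF \<psi>(1)]])
    finally show ?thesis ..
  qed
  obtain W g where W: "open W" "x0 \<in> W" "smooth_on W g"
    and Wg: "dist_eq_on W (curl (normal_operator F) i j) (dist_of_fun g)" and g0: "\<And>\<beta>. multi_deriv \<beta> g x0 = 0"
    using x0(2)[of i j] unfolding vanishes_to_infinite_order_at_def by blast
  have "compact {x0}" "{x0} \<subseteq> W" using W by auto
  then obtain \<kappa> W3 where \<kappa>: "\<kappa> \<in> test_functions" "fun_support \<kappa> \<subseteq> W" "open W3" "{x0} \<subseteq> W3" "\<And>x. x \<in> W3 \<Longrightarrow> \<kappa> x = 1"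
    using cutoff_exists[of "{x0}" W] W(1) by metis
  define G where "G x = \<kappa> x * g x" for x
  have G: "G \<in> test_functions" unfolding G_def[abs_def] by (rule test_cutoff[OF \<kappa>(1) W(1,3) \<kappa>(2)])
  have G0: "derivs js G x0 = 0" for js
  proof -
    have "derivs js G x0 = derivs js g x0"
      by (rule derivs_cong[OF open_Int[OF W(1) \<kappa>(3)]]) (use W \<kappa> in \<open>auto simp: G_def\<close>)
    also have "\<dots> = 0" using derivs_eq_multi_deriv[OF W(1,3,2)] g0 by simp
    finally show ?thesis .
  qed
  have pot: "(2 / of_real (real CARD('n) - 1)) * T (convolve riesz_kernel \<eta>) = (LINT y|lborel. G y * \<eta> y)"
    if \<eta>: "\<eta> \<in> test_functions" "fun_support \<eta> \<subseteq> W \<inter> W3" for \<eta>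
  proof -
    have "(2 / of_real (real CARD('n) - 1)) * T (convolve riesz_kernel \<eta>) = curl (normal_operator F) i j \<eta>"
      unfolding curl_normal_operator[OF assms(1) F \<eta>(1)] T_def by simp
    also have "\<dots> = (LINT y|lborel. g y * \<eta> y)"
      using Wg \<eta> by (simp add: dist_eq_on_def dist_of_fun_def)
    also have "\<dots> = (LINT y|lborel. G y * \<eta> y)"
    proof (rule Bochner_Integration.integral_cong[OF refl])
      show "g y * \<eta> y = G y * \<eta> y" for y
        using \<eta>(2) \<kappa>(5)[of y] fun_support_zero[of y \<eta>] by (cases "y \<in> fun_support \<eta>") (auto simp: G_def)
    qed
    finally show ?thesis .
  qed
  have c: "2 / complex_of_real (real CARD('n) - 1) \<noteq> 0" using assms(1) by simp
  have W': "open (W \<inter> W3)" "x0 \<in> W \<inter> W3" using W \<kappa> by auto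
  have "T \<psi> = 0" if "\<psi> \<in> test_functions" for \<psi>
    by (rule unique_continuation[OF assms(1) T P assms(2) x0(1) vanish W' G G0 c pot that])
  from smooth_functional_eq_0_if_test[OF T this f]
  show "compact_pairing (F i) (partial_deriv j f) = compact_pairing (F j) (partial_deriv i f)"
    by (simp add: T_def)
qed

end
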